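(* Let $\Gamma$ be a non elementary word hyperbolic group, $\rho:\Gamma\to G=\mathrm{PSO}(p,q)$ a $P_1^{p,q}$-Anosov representation, $o\in\mathbf{\Omega}_\rho$, $\tau\in S^o$, and let $\mathfrak{b}^+$ be a closed Weyl chamber of a maximal subalgebra $\mathfrak{b}\subset\mathfrak{p}^\tau\cap\mathfrak{q}^o$, with associated projection $b^o:\mathscr{C}^>_{o,G}\to\mathfrak{b}^+$. Then for every $t\ge0$, $$\#\{\gamma\in\Gamma:\ \rho(\gamma)\in\mathscr{C}^>_{o,G}\ \text{and}\ |b^o(\rho(\gamma))|^{1/2}\le t\}<\infty .$$
   Context: Fix integers $p,q\ge1$ with $d:=p+q>2$. On $\mathbb{R}^d$ let $\langle x,y\rangle_{p,q}:=\sum_{i=1}^p x_iy_i-\sum_{i=p+1}^d x_iy_i$, with orthogonal complements denoted $\cdot^{\perp_{p,q}}$. $G:=\mathrm{PSO}(p,q)\subset\mathrm{PSL}(d,\mathbb{R})$ is the group of projectivized matrices of $\mathrm{SL}(d,\mathbb{R})$ preserving the form, with Lie algebra $\mathfrak{g}=\mathfrak{so}(p,q)$ and Killing form $\kappa(X,Y)=(d-2)\mathrm{tr}(XY)$. $\mathbb{H}^{p,q-1}:=\{o=[\hat o]\in\mathbb{P}(\mathbb{R}^d):\langle\hat o,\hat o\rangle_{p,q}<0\}$. Its space-like geodesics are the intersections with $\mathbb{H}^{p,q-1}$ of projectivized $2$-planes on which the form has signature $(1,1)$. For $o\in\mathbb{H}^{p,q-1}$, $\mathscr{C}^>_o$ is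 the set of points of $\mathbb{H}^{p,q-1}$ that can be joined to $o$ by a space-like geodesic and $\mathscr{C}^>_{o,G}:=\{g\in G:g\cdot o\in\mathscr{C}^>_o\}$. Let $J^o:=\mathrm{id}_o\oplus(-\mathrm{id}_{o^{\perp_{p,q}}})$, $H^o$ the stabilizer of $o$ in $G$, $\mathfrak{q}^o:=\{X\in\mathfrak{g}:J^oXJ^o=-X\}$, and for $X\in\mathfrak{q}^o$ put $|X|:=\frac{1}{2(d-2)}\kappa(X,X)$. $X_G$ is the space of $q$-dimensional negative definite subspaces $\tau$ of $\mathbb{R}^d$; $S^o:=\{\tau\in X_G:o\subset\tau\}$. For $\tau\in X_G$, $\langle\cdot,\cdot\rangle_\tau$ is the inner product equal to $-\langle\cdot,\cdot\rangle_{p,q}$ on $\tau$, to $\langle\cdot,\cdot\rangle_{p,q}$ on $\tau^{\perp_{p,q}}$ and making these orthogonal, and $\mathfrak{p}^\tau$ is the set of $X\in\mathfrak{g}$ symmetric for $\langle\cdot,\cdot\rangle_\tau$. For $\tau\in S^o$, a maximal subalgebra $\mathfrak{b}\subset\mathfrak{p}^\tau\cap\mathfrak{q}^o$ is abelian and one-dimensional; a closed Weyl chamber $\mathfrak{b}^+$ is a closed half-line of $\mathfrak{b}$ starting at $0$. Every $g\in\mathscr{C}^>_{o,G}$ can be written $g=h\exp(X)h'$ with $h,h'\in H^o$ and a unique $X\in\mathfrak{b}^+$; set $b^o(g):=X$. Anosov representations: fix any inner product on $\mathbb{R}^d$ and let $a_1(g)\ge\dots\ge a_d(g)$ be the logarithms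 of the singular values of $g\in\mathrm{PSL}(d,\mathbb{R})$; let $|\cdot|_\Gamma$ be the word length for a finite symmetric generating set of $\Gamma$. $\rho:\Gamma\to\mathrm{PSL}(d,\mathbb{R})$ is projective Anosov if there are $C,\alpha>0$ with $a_1(\rho(\gamma))-a_2(\rho(\gamma))\ge\alpha|\gamma|_\Gamma-C$ for all $\gamma$; it is $P_1^{p,q}$-Anosov if moreover $\rho(\Gamma)\subset G$. Its limit set $\Lambda_{\rho(\Gamma)}$ (contained in the set of isotropic lines) is the closure of the set of attractive fixed lines in $\mathbb{P}(\mathbb{R}^d)$ of proximal elements of $\rho(\Gamma)$, and $\mathbf{\Omega}_\rho:=\{[\hat o]\in\mathbb{H}^{p,q-1}:\langle\hat o,\hat\xi\rangle_{p,q}\ne0\ \forall[\hat\xi]\in\Lambda_{\rho(\Gamma)}\}$. *)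

theory Defs
  imports
    "HOL-Analysis.Analysis"
    "HOL-Algebra.Coset"
    "HOL-Algebra.Generated_Groups"
    "HOL-Library.Multiset"
begin

section \<open>Finitely generated and hyperbolic groups\<close>

definition finite_symmetric_generating_set :: "('g, 'm) monoid_scheme \<Rightarrow> 'g set \<Rightarrow> bool" where
  "finite_symmetric_generating_set \<Gamma> S \<longleftrightarrow>
     finite S \<and> S \<subseteq> carrier \<Gamma> \<and> (\<forall>s\<in>S. inv\<^bsub>\<Gamma>\<^esub> s \<in> S) \<and> generate \<Gamma> S = carrier \<Gamma>"

definition word_length :: "('g, 'm) monoid_scheme \<Rightarrow> 'g set \<Rightarrow> 'g \<Rightarrow> nat" where
  "word_length \<Gamma> S \<gamma> =
     (LEAST n. \<exists>ws. set ws \<subseteq> S \<and> length ws = n \<and> foldr (\<otimes>\<^bsub>\<Gamma>\<^esub>) ws \<one>\<^bsub>\<Gamma>\<^esub> = \<gamma>)"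

definition word_dist :: "('g, 'm) monoid_scheme \<Rightarrow> 'g set \<Rightarrow> 'g \<Rightarrow> 'g \<Rightarrow> real" where
  "word_dist \<Gamma> S x y = real (word_length \<Gamma> S (inv\<^bsub>\<Gamma>\<^esub> x \<otimes>\<^bsub>\<Gamma>\<^esub> y))"

definition gromov_product :: "('g, 'm) monoid_scheme \<Rightarrow> 'g set \<Rightarrow> 'g \<Rightarrow> 'g \<Rightarrow> 'g \<Rightarrow> real" where
  "gromov_product \<Gamma> S w x y =
     (word_dist \<Gamma> S x w + word_dist \<Gamma> S y w - word_dist \<Gamma> S x y) / 2"

text \<open>Gromov's four-point condition for the word metric on the group itself (not on its Cayley
  graph); the two versions differ only in the value of \<^term>\<open>\<delta>\<close>.\<close>

definition word_hyperbolic :: "('g, 'm) monoid_scheme \<Rightarrow> bool" where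
  "word_hyperbolic \<Gamma> \<longleftrightarrow> group \<Gamma> \<and>
     (\<exists>S. finite_symmetric_generating_set \<Gamma> S \<and>
       (\<exists>\<delta>\<ge>0. \<forall>w\<in>carrier \<Gamma>. \<forall>x\<in>carrier \<Gamma>. \<forall>y\<in>carrier \<Gamma>. \<forall>z\<in>carrier \<Gamma>.
          gromov_product \<Gamma> S w x z
            \<ge> min (gromov_product \<Gamma> S w x y) (gromov_product \<Gamma> S w y z) - \<delta>))"

text \<open>Elementary means virtually cyclic; this includes the finite groups, in which the trivial
  subgroup is cyclic and of finite index.\<close>

definition non_elementary :: "('g, 'm) monoid_scheme \<Rightarrow> bool" where
  "non_elementary \<Gamma> \<longleftrightarrow> \<not> (\<exists>a\<in>carrier \<Gamma>. finite (rcosets\<^bsub>\<Gamma>\<^esub> (generate \<Gamma> {a})))"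


section \<open>Projective space and the projective special linear group\<close>

text \<open>Points of the projective space are the one-dimensional subspaces; the topology is the
  quotient topology from the nonzero vectors.\<close>

definition proj_space :: "(real^'n) set set" where
  "proj_space = {L. subspace L \<and> dim L = 1}"

definition proj_topology :: "(real^'n) set topology" where
  "proj_topology = topology (\<lambda>U. U \<subseteq> proj_space \<and> open {v. v \<noteq> 0 \<and> span {v} \<in> U})"

lemma openin_proj_topology:
  "openin proj_topology U \<longleftrightarrow>
     U \<subseteq> (proj_space :: (real^'n) set set) \<and> open {v. v \<noteq> 0 \<and> span {v} \<in> U}"
proof -
  have "istopology (\<lambda>U. U \<subseteq> (proj_space :: (real^'n) set set) \<and> open {v. v \<noteq> 0 \<and> span {v} \<in> U})"
    unfolding istopology_def
  proof (intro conjI allI impI)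
    fix A B :: "(real^'n) set set"
    assume A: "A \<subseteq> proj_space \<and> open {v. v \<noteq> 0 \<and> span {v} \<in> A}"
      and B: "B \<subseteq> proj_space \<and> open {v. v \<noteq> 0 \<and> span {v} \<in> B}"
    show "A \<inter> B \<subseteq> proj_space" using A by auto
    have "{v. v \<noteq> 0 \<and> span {v} \<in> A \<inter> B} =
        {v. v \<noteq> 0 \<and> span {v} \<in> A} \<inter> {v. v \<noteq> 0 \<and> span {v} \<in> B}" by auto
    then show "open {v. v \<noteq> 0 \<and> span {v} \<in> A \<inter> B}" using A B by auto
  next
    fix K :: "(real^'n) set set set"
    assume K: "\<forall>U\<in>K. U \<subseteq> proj_space \<and> open {v. v \<noteq> 0 \<and> span {v} \<in> U}"
    show "\<Union>K \<subseteq> proj_space" using K by auto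
    have "{v. v \<noteq> 0 \<and> span {v} \<in> \<Union>K} = (\<Union>U\<in>K. {v. v \<noteq> 0 \<and> span {v} \<in> U})" by auto
    then show "open {v. v \<noteq> 0 \<and> span {v} \<in> \<Union>K}" using K by auto
  qed
  then show ?thesis
    unfolding proj_topology_def by (simp add: topology_inverse')
qed

definition SL_group :: "(real^'n^'n) monoid" where
  "SL_group = \<lparr>carrier = {A. det A = 1}, mult = (**), one = mat 1\<rparr>"

definition SL_scalars :: "(real^'n^'n) set" where
  "SL_scalars = {A. det A = 1 \<and> (\<exists>c. A = mat c)}"

definition PSL_group :: "(real^'n^'n) set monoid" where
  "PSL_group = SL_group Mod SL_scalars"

definition psl_class :: "real^'n^'n \<Rightarrow> (real^'n^'n) set" where
  "psl_class A = SL_scalars #>\<^bsub>SL_group\<^esub> A"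

definition psl_act :: "(real^'n^'n) set \<Rightarrow> (real^'n) set \<Rightarrow> (real^'n) set" where
  "psl_act g L = (\<Union>A\<in>g. (*v) A ` L)"


section \<open>Eigenvalues, singular values, proximality\<close>

text \<open>The complex eigenvalues with algebraic multiplicity, i.e. the roots of the characteristic
  polynomial.\<close>

definition eigenvalues :: "real^'n^'n \<Rightarrow> complex multiset" where
  "eigenvalues A =
     (THE E. \<forall>z. det (mat z - map_matrix complex_of_real A) = (\<Prod>e\<in>#E. z - e))"

text \<open>The line \<^term>\<open>L\<close> is the attractive fixed line of the proximal matrix \<^term>\<open>A\<close>:
  \<^term>\<open>A\<close> has a simple eigenvalue whose modulus strictly dominates all the others (such an
  eigenvalue is necessarily real), and \<^term>\<open>L\<close> is its eigenline.\<close>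

definition attractive_fixed_line :: "real^'n^'n \<Rightarrow> (real^'n) set \<Rightarrow> bool" where
  "attractive_fixed_line A L \<longleftrightarrow>
     (\<exists>(r::real) E. eigenvalues A = add_mset (complex_of_real r) E \<and>
        (\<forall>\<mu>\<in>#E. cmod \<mu> < \<bar>r\<bar>) \<and> L = {v. A *v v = r *\<^sub>R v})"

definition limit_set :: "(real^'n^'n) set set \<Rightarrow> (real^'n) set set" where
  "limit_set R = proj_topology closure_of {L. \<exists>g\<in>R. \<exists>A\<in>g. attractive_fixed_line A L}"

definition inner_product :: "(real^'n \<Rightarrow> real^'n \<Rightarrow> real) \<Rightarrow> bool" where
  "inner_product ip \<longleftrightarrow>
     bilinear ip \<and> (\<forall>x y. ip x y = ip y x) \<and> (\<forall>x. x \<noteq> 0 \<longrightarrow> ip x x > 0)"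

definition ip_adjoint :: "(real^'n \<Rightarrow> real^'n \<Rightarrow> real) \<Rightarrow> real^'n^'n \<Rightarrow> real^'n^'n" where
  "ip_adjoint ip A = (THE B. \<forall>x y. ip (A *v x) y = ip x (B *v y))"

text \<open>In decreasing order. The eigenvalues of the positive operator whose square roots are taken
  are real, so that \<^term>\<open>Re\<close> only performs a change of type.\<close>

definition singular_values :: "(real^'n \<Rightarrow> real^'n \<Rightarrow> real) \<Rightarrow> real^'n^'n \<Rightarrow> real list" where
  "singular_values ip A =
     rev (sorted_list_of_multiset
       (image_mset (\<lambda>z. sqrt (Re z)) (eigenvalues (ip_adjoint ip A ** A))))"

text \<open>\<^term>\<open>log_sv ip i g\<close> is the \<^term>\<open>i\<close>-th logarithmic singular value, counted from one; it
  does not depend on the representative of \<^term>\<open>g\<close>, since \<^term>\<open>A\<close> and \<^term>\<open>- A\<close> have the same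
  singular values.\<close>

definition log_sv :: "(real^'n \<Rightarrow> real^'n \<Rightarrow> real) \<Rightarrow> nat \<Rightarrow> (real^'n^'n) set \<Rightarrow> real" where
  "log_sv ip i g = ln (singular_values ip (SOME A. A \<in> g) ! (i - 1))"

definition projective_anosov ::
    "('g, 'm) monoid_scheme \<Rightarrow> 'g set \<Rightarrow> (real^'n \<Rightarrow> real^'n \<Rightarrow> real)
      \<Rightarrow> ('g \<Rightarrow> (real^'n^'n) set) \<Rightarrow> bool" where
  "projective_anosov \<Gamma> S ip \<rho> \<longleftrightarrow> \<rho> \<in> hom \<Gamma> PSL_group \<and>
     (\<exists>C \<alpha>. C > 0 \<and> \<alpha> > 0 \<and>
       (\<forall>\<gamma>\<in>carrier \<Gamma>. log_sv ip 1 (\<rho> \<gamma>) - log_sv ip 2 (\<rho> \<gamma>)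
                        \<ge> \<alpha> * real (word_length \<Gamma> S \<gamma>) - C))"


section \<open>The form of signature (p,q) and the group PSO(p,q)\<close>

text \<open>The coordinates of the underlying space are indexed by a disjoint sum of two (nonempty)
  finite types of cardinality p and q.\<close>

definition pq_form :: "real^('p::finite + 'q::finite) \<Rightarrow> real^('p + 'q) \<Rightarrow> real" where
  "pq_form x y = (\<Sum>i\<in>UNIV. x $ Inl i * y $ Inl i) - (\<Sum>j\<in>UNIV. x $ Inr j * y $ Inr j)"

definition pq_orth :: "(real^('p::finite + 'q::finite)) set \<Rightarrow> (real^('p + 'q)) set" where
  "pq_orth V = {x. \<forall>y\<in>V. pq_form x y = 0}"

definition PSO :: "(real^('p::finite + 'q::finite)^('p + 'q)) set set" where
  "PSO = {psl_class A | A. det A = 1 \<and> (\<forall>x y. pq_form (A *v x) (A *v y) = pq_form x y)}"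

definition so_algebra :: "(real^('p::finite + 'q::finite)^('p + 'q)) set" where
  "so_algebra = {X. \<forall>x y. pq_form (X *v x) y + pq_form x (X *v y) = 0}"

definition killing_form ::
    "real^('p::finite + 'q::finite)^('p + 'q) \<Rightarrow> real^('p + 'q)^('p + 'q) \<Rightarrow> real" where
  "killing_form X Y = (real CARD('p + 'q) - 2) * trace (X ** Y)"

definition pq_anosov ::
    "('g, 'm) monoid_scheme \<Rightarrow> 'g set \<Rightarrow> (real^('p::finite + 'q::finite) \<Rightarrow> real^('p + 'q) \<Rightarrow> real)
      \<Rightarrow> ('g \<Rightarrow> (real^('p + 'q)^('p + 'q)) set) \<Rightarrow> bool" where
  "pq_anosov \<Gamma> S ip \<rho> \<longleftrightarrow> projective_anosov \<Gamma> S ip \<rho> \<and> \<rho> ` carrier \<Gamma> \<subseteq> PSO"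


section \<open>Pseudo-Riemannian hyperbolic space\<close>

definition H_pq :: "(real^('p::finite + 'q::finite)) set set" where
  "H_pq = {span {v} | v. pq_form v v < 0}"

definition plane_of_signature_1_1 :: "(real^('p::finite + 'q::finite)) set \<Rightarrow> bool" where
  "plane_of_signature_1_1 P \<longleftrightarrow> subspace P \<and> dim P = 2 \<and>
     (\<exists>u v. P = span {u, v} \<and> pq_form u v = 0 \<and> pq_form u u > 0 \<and> pq_form v v < 0)"

definition spacelike_geodesic :: "(real^('p::finite + 'q::finite)) set set \<Rightarrow> bool" where
  "spacelike_geodesic c \<longleftrightarrow> (\<exists>P. plane_of_signature_1_1 P \<and> c = {L \<in> H_pq. L \<subseteq> P})"

text \<open>The base point itself belongs to this set, because it lies on a space-like geodesic.\<close>

definition C_space :: "(real^('p::finite + 'q::finite)) set \<Rightarrow> (real^('p + 'q)) set set" where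
  "C_space pt = {x \<in> H_pq. \<exists>c. spacelike_geodesic c \<and> pt \<in> c \<and> x \<in> c}"

definition C_space_group ::
    "(real^('p::finite + 'q::finite)) set \<Rightarrow> (real^('p + 'q)^('p + 'q)) set set" where
  "C_space_group pt = {g \<in> PSO. psl_act g pt \<in> C_space pt}"

definition Omega ::
    "(real^('p::finite + 'q::finite)^('p + 'q)) set set \<Rightarrow> (real^('p + 'q)) set set" where
  "Omega R = {pt \<in> H_pq. \<forall>\<xi>\<in>limit_set R. \<forall>v\<in>pt - {0}. \<forall>w\<in>\<xi> - {0}. pq_form v w \<noteq> 0}"


section \<open>The polar projection\<close>

definition J_mat :: "(real^('p::finite + 'q::finite)) set \<Rightarrow> real^('p + 'q)^('p + 'q)" where
  "J_mat pt = (THE J. (\<forall>v\<in>pt. J *v v = v) \<and> (\<forall>v\<in>pq_orth pt. J *v v = - v))"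

definition H_stab ::
    "(real^('p::finite + 'q::finite)) set \<Rightarrow> (real^('p + 'q)^('p + 'q)) set set" where
  "H_stab pt = {g \<in> PSO. psl_act g pt = pt}"

definition q_space ::
    "(real^('p::finite + 'q::finite)) set \<Rightarrow> (real^('p + 'q)^('p + 'q)) set" where
  "q_space pt = {X \<in> so_algebra. J_mat pt ** X ** J_mat pt = - X}"

definition q_abs :: "real^('p::finite + 'q::finite)^('p + 'q) \<Rightarrow> real" where
  "q_abs X = 1 / (2 * (real CARD('p + 'q) - 2)) * killing_form X X"

definition X_G :: "(real^('p::finite + 'q::finite)) set set" where
  "X_G = {\<tau>. subspace \<tau> \<and> dim \<tau> = CARD('q) \<and> (\<forall>v\<in>\<tau>. v \<noteq> 0 \<longrightarrow> pq_form v v < 0)}"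

definition S_sub :: "(real^('p::finite + 'q::finite)) set \<Rightarrow> (real^('p + 'q)) set set" where
  "S_sub pt = {\<tau> \<in> X_G. pt \<subseteq> \<tau>}"

definition ip_of ::
    "(real^('p::finite + 'q::finite)) set \<Rightarrow> real^('p + 'q) \<Rightarrow> real^('p + 'q) \<Rightarrow> real" where
  "ip_of \<tau> = (THE B. inner_product B \<and>
     (\<forall>x\<in>\<tau>. \<forall>y\<in>\<tau>. B x y = - pq_form x y) \<and>
     (\<forall>x\<in>pq_orth \<tau>. \<forall>y\<in>pq_orth \<tau>. B x y = pq_form x y) \<and>
     (\<forall>x\<in>\<tau>. \<forall>y\<in>pq_orth \<tau>. B x y = 0))"

definition p_space ::
    "(real^('p::finite + 'q::finite)) set \<Rightarrow> (real^('p + 'q)^('p + 'q)) set" where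
  "p_space \<tau> = {X \<in> so_algebra. \<forall>x y. ip_of \<tau> (X *v x) y = ip_of \<tau> x (X *v y)}"

definition lie_subalgebra :: "(real^'n^'n) set \<Rightarrow> bool" where
  "lie_subalgebra \<bb> \<longleftrightarrow> subspace \<bb> \<and> (\<forall>X\<in>\<bb>. \<forall>Y\<in>\<bb>. X ** Y - Y ** X \<in> \<bb>)"

definition maximal_subalgebra_in :: "(real^'n^'n) set \<Rightarrow> (real^'n^'n) set \<Rightarrow> bool" where
  "maximal_subalgebra_in V \<bb> \<longleftrightarrow> lie_subalgebra \<bb> \<and> \<bb> \<subseteq> V \<and>
     (\<forall>\<bb>'. lie_subalgebra \<bb>' \<and> \<bb> \<subseteq> \<bb>' \<and> \<bb>' \<subseteq> V \<longrightarrow> \<bb>' = \<bb>)"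

definition closed_weyl_chamber :: "(real^'n^'n) set \<Rightarrow> (real^'n^'n) set \<Rightarrow> bool" where
  "closed_weyl_chamber \<bb> \<bb>\<^sub>p \<longleftrightarrow> (\<exists>X\<in>\<bb>. X \<noteq> 0 \<and> \<bb>\<^sub>p = {s *\<^sub>R X | s. s \<ge> 0})"

text \<open>The constant \<^const>\<open>exp\<close> is not available here, since the type of square matrices is not
  a normed algebra for the matrix product.\<close>

definition mat_exp :: "real^'n^'n \<Rightarrow> real^'n^'n" where
  "mat_exp X = (\<Sum>n. (((**) X ^^ n) (mat 1)) /\<^sub>R fact n)"

definition polar_proj ::
    "(real^('p::finite + 'q::finite)) set \<Rightarrow> (real^('p + 'q)^('p + 'q)) set
      \<Rightarrow> (real^('p + 'q)^('p + 'q)) set \<Rightarrow> real^('p + 'q)^('p + 'q)" where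
  "polar_proj pt \<bb>\<^sub>p g = (THE X. X \<in> \<bb>\<^sub>p \<and>
     (\<exists>h\<in>H_stab pt. \<exists>h'\<in>H_stab pt.
        g = h \<otimes>\<^bsub>PSL_group\<^esub> psl_class (mat_exp X) \<otimes>\<^bsub>PSL_group\<^esub> h'))"

end

theory Submission
  imports
    Defs
    "HOL-Library.Diagonal_Subsequence"
    "HOL-Computational_Algebra.Fundamental_Theorem_Algebra"
begin

text \<open>Suppose that infinitely many \<open>\<gamma>\<close> lie in the set, and let \<open>A\<^sub>\<gamma>\<close> be a matrix representing
  \<open>\<rho>(\<gamma>)\<close>. If \<open>b\<close> spans the base point with \<open>\<langle>b, b\<rangle> = -1\<close>, the polar decomposition gives
  \<open>\<bar>\<langle>b, A\<^sub>\<gamma> b\<rangle>\<bar> = cosh \<bar>b\<^sup>o(\<rho>(\<gamma>))\<bar>\<^sup>1\<^sup>/\<^sup>2\<close>, which stays bounded. By the singular value gap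
  \<open>A\<^sub>\<gamma> / \<parallel>A\<^sub>\<gamma>\<parallel>\<close> subconverges to a matrix \<open>M\<close> of rank one, and \<open>\<parallel>A\<^sub>\<gamma>\<parallel> \<rightarrow> \<infinity>\<close> because
  \<open>det A\<^sub>\<gamma> = 1\<close>; hence \<open>\<langle>b, M b\<rangle> = 0\<close>. The image line of \<open>M\<close>, and likewise that of the adjoint of
  \<open>M\<close> (a limit of the inverses), belongs to the limit set, and one of the two is orthogonal to \<open>b\<close>,
  against the choice of the base point.

  That the image line of \<open>M\<close> is a limit of attracting lines uses hyperbolicity. As the group is not
  elementary, every long \<open>\<gamma>\<close> can be multiplied by some \<open>f\<close> of bounded length such that the powers of
  \<open>\<gamma> f\<close> form a uniform quasigeodesic starting along a geodesic from \<open>1\<close> to \<open>\<gamma>\<close>. The gap along this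
  path makes \<open>\<rho>(\<gamma> f)\<close> proximal, with attracting line exponentially close to the top singular
  direction of \<open>A\<^sub>\<gamma>\<close>.\<close>

section \<open>Word metrics and hyperbolic groups\<close>

locale marked_group = group \<Gamma> for \<Gamma> :: "('g, 'm) monoid_scheme" (structure) +
  fixes S :: "'g set"
  assumes gens: "finite_symmetric_generating_set \<Gamma> S"
begin

abbreviation len :: "'g \<Rightarrow> real" where "len x \<equiv> real (word_length \<Gamma> S x)"
abbreviation d :: "'g \<Rightarrow> 'g \<Rightarrow> real" where "d \<equiv> word_dist \<Gamma> S"
abbreviation word_val :: "'g list \<Rightarrow> 'g" where "word_val ws \<equiv> foldr (\<otimes>) ws \<one>"

lemma gens_finite: "finite S" and gens_carrier: "S \<subseteq> carrier \<Gamma>"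
  and gens_inv: "s \<in> S \<Longrightarrow> inv s \<in> S" and gens_generate: "generate \<Gamma> S = carrier \<Gamma>"
  using gens unfolding finite_symmetric_generating_set_def by auto

lemma word_val_closed [simp]: "set ws \<subseteq> S \<Longrightarrow> word_val ws \<in> carrier \<Gamma>"
  using gens_carrier by (induction ws) auto

lemma word_val_append:
  "set us \<subseteq> S \<Longrightarrow> set vs \<subseteq> S \<Longrightarrow> word_val (us @ vs) = word_val us \<otimes> word_val vs"
  using gens_carrier by (induction us) (auto simp: m_assoc subset_iff)

lemma word_exists: "x \<in> carrier \<Gamma> \<Longrightarrow> \<exists>ws. set ws \<subseteq> S \<and> word_val ws = x"
proof -
  assume "x \<in> carrier \<Gamma>"
  then have "x \<in> generate \<Gamma> S" using gens_generate by simp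
  then show ?thesis
  proof induction
    case one
    show ?case by (rule exI[of _ "[]"]) simp
  next
    case (incl h)
    then show ?case using gens_carrier by (intro exI[of _ "[h]"]) auto
  next
    case (inv h)
    then show ?case using gens_carrier gens_inv by (intro exI[of _ "[inv h]"]) auto
  next
    case (eng h1 h2)
    then obtain us vs where "set us \<subseteq> S" "word_val us = h1" "set vs \<subseteq> S" "word_val vs = h2"
      by auto
    then show ?case by (intro exI[of _ "us @ vs"]) (simp del: foldr_append add: word_val_append)
  qed
qed

lemma len_le: "set ws \<subseteq> S \<Longrightarrow> word_length \<Gamma> S (word_val ws) \<le> length ws"
  unfolding word_length_def by (rule Least_le) auto

lemma geodesic_word:
  assumes "x \<in> carrier \<Gamma>"
  obtains ws where "set ws \<subseteq> S" "length ws = word_length \<Gamma> S x" "word_val ws = x"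
proof -
  have "\<exists>n ws. set ws \<subseteq> S \<and> length ws = n \<and> word_val ws = x"
    using word_exists[OF assms] by auto
  from LeastI_ex[OF this] show ?thesis using that unfolding word_length_def by auto
qed

lemma len_one [simp]: "word_length \<Gamma> S \<one> = 0"
  using len_le[of "[]"] by simp

lemma len_gen_le: "s \<in> S \<Longrightarrow> len s \<le> 1"
  using len_le[of "[s]"] gens_carrier by (auto simp: subset_iff)

lemma len_mult:
  assumes "x \<in> carrier \<Gamma>" "y \<in> carrier \<Gamma>" shows "len (x \<otimes> y) \<le> len x + len y"
proof -
  obtain us where us: "set us \<subseteq> S" "length us = word_length \<Gamma> S x" "word_val us = x"
    using geodesic_word assms by blast
  obtain vs where vs: "set vs \<subseteq> S" "length vs = word_length \<Gamma> S y" "word_val vs = y"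
    using geodesic_word assms by blast
  show ?thesis using len_le[of "us @ vs"] us vs by (simp del: foldr_append add: word_val_append)
qed

lemma len_inv_le: assumes "x \<in> carrier \<Gamma>" shows "len (inv x) \<le> len x"
proof -
  have *: "set ws \<subseteq> S \<Longrightarrow> len (inv (word_val ws)) \<le> length ws" for ws
  proof (induction ws)
    case (Cons a ws)
    then have a: "a \<in> carrier \<Gamma>" "inv a \<in> S" and w: "word_val ws \<in> carrier \<Gamma>"
      using gens_carrier gens_inv by auto
    have "len (inv (a \<otimes> word_val ws)) \<le> len (inv (word_val ws)) + len (inv a)"
      using a w len_mult by (simp add: inv_mult_group)
    then show ?case using Cons len_gen_le[OF a(2)] by auto
  qed simp
  show ?thesis using geodesic_word[OF assms] * by metis
qed

lemma len_inv [simp]: "x \<in> carrier \<Gamma> \<Longrightarrow> word_length \<Gamma> S (inv x) = word_length \<Gamma> S x"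
  using len_inv_le[of x] len_inv_le[of "inv x"] by simp

lemma finite_len_ball: "finite {x \<in> carrier \<Gamma>. len x \<le> r}"
proof -
  have "{x \<in> carrier \<Gamma>. len x \<le> r} \<subseteq> word_val ` {ws. set ws \<subseteq> S \<and> length ws \<le> nat \<lfloor>r\<rfloor>}"
  proof
    fix x assume x: "x \<in> {x \<in> carrier \<Gamma>. len x \<le> r}"
    then obtain ws where "set ws \<subseteq> S" "length ws = word_length \<Gamma> S x" "word_val ws = x"
      using geodesic_word by blast
    moreover have "word_length \<Gamma> S x \<le> nat \<lfloor>r\<rfloor>" using x by (simp add: le_nat_floor)
    ultimately show "x \<in> word_val ` {ws. set ws \<subseteq> S \<and> length ws \<le> nat \<lfloor>r\<rfloor>}" by auto
  qed
  then show ?thesis using finite_lists_length_le[OF gens_finite] finite_surj by blast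
qed

lemma d_one_left [simp]: "x \<in> carrier \<Gamma> \<Longrightarrow> d \<one> x = len x"
  and d_one_right: "x \<in> carrier \<Gamma> \<Longrightarrow> d x \<one> = len x"
  unfolding word_dist_def by auto

lemma d_sym: "x \<in> carrier \<Gamma> \<Longrightarrow> y \<in> carrier \<Gamma> \<Longrightarrow> d x y = d y x"
  unfolding word_dist_def using len_inv[of "inv x \<otimes> y"] by (simp add: inv_mult_group)

lemma d_left:
  assumes "a \<in> carrier \<Gamma>" "x \<in> carrier \<Gamma>" "y \<in> carrier \<Gamma>"
  shows "d (a \<otimes> x) (a \<otimes> y) = d x y"
proof -
  have "inv (a \<otimes> x) \<otimes> (a \<otimes> y) = inv x \<otimes> y"
    using assms by (simp add: inv_mult_group m_assoc) (simp add: m_assoc[symmetric])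
  then show ?thesis unfolding word_dist_def by simp
qed

lemma d_triangle:
  assumes "x \<in> carrier \<Gamma>" "y \<in> carrier \<Gamma>" "z \<in> carrier \<Gamma>"
  shows "d x z \<le> d x y + d y z"
proof -
  have "inv x \<otimes> z = (inv x \<otimes> y) \<otimes> (inv y \<otimes> z)"
    using assms by (metis inv_closed l_one m_assoc m_closed r_inv)
  then show ?thesis unfolding word_dist_def using len_mult assms by simp
qed

lemma d_nonneg [simp]: "d x y \<ge> 0"
  unfolding word_dist_def by simp

lemma d_mult_right:
  assumes "a \<in> carrier \<Gamma>" "x \<in> carrier \<Gamma>" shows "d a (a \<otimes> x) = len x"
  using d_left[of a \<one> x] assms by simp

lemma geodesic_point:
  assumes "x \<in> carrier \<Gamma>" "k \<le> word_length \<Gamma> S x"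
  obtains r where "r \<in> carrier \<Gamma>" "len r = k" "d r x = len x - k"
proof -
  obtain ws where ws: "set ws \<subseteq> S" "length ws = word_length \<Gamma> S x" "word_val ws = x"
    using geodesic_word assms by blast
  define u v where "u = take k ws" and "v = drop k ws"
  have uv: "set u \<subseteq> S" "set v \<subseteq> S" "ws = u @ v" "length u = k" "length v = length ws - k"
    using ws assms set_take_subset[of k ws] set_drop_subset[of k ws] unfolding u_def v_def by auto
  have x: "x = word_val u \<otimes> word_val v" using ws uv word_val_append by metis
  have "len x \<le> len (word_val u) + len (word_val v)" unfolding x using uv len_mult by auto
  moreover have "word_length \<Gamma> S (word_val u) \<le> k" "word_length \<Gamma> S (word_val v) \<le> length ws - k"
    using len_le[OF uv(1)] len_le[OF uv(2)] unfolding uv(4,5) by auto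
  moreover have "d (word_val u) x = len (word_val v)"
    unfolding x by (rule d_mult_right) (use uv(1,2) in simp_all)
  ultimately have "len (word_val u) = k" "d (word_val u) x = len x - k"
    using ws(2) assms(2) by linarith+
  then show ?thesis using that uv(1) word_val_closed by blast
qed

end

locale hyperbolic_marked_group = marked_group \<Gamma> S for \<Gamma> :: "('g, 'm) monoid_scheme" (structure) and S +
  fixes \<delta> :: real
  assumes delta_nonneg: "\<delta> \<ge> 0"
    and four_point: "\<lbrakk>w \<in> carrier \<Gamma>; x \<in> carrier \<Gamma>; y \<in> carrier \<Gamma>; z \<in> carrier \<Gamma>\<rbrakk> \<Longrightarrow>
      gromov_product \<Gamma> S w x z
        \<ge> min (gromov_product \<Gamma> S w x y) (gromov_product \<Gamma> S w y z) - \<delta>"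
begin

lemma four_point_dist:
  assumes "w \<in> carrier \<Gamma>" "x \<in> carrier \<Gamma>" "y \<in> carrier \<Gamma>" "z \<in> carrier \<Gamma>"
  shows "d x z + d y w \<le> max (d x y + d z w) (d x w + d y z) + 2 * \<delta>"
proof -
  have 1: "d x w + d z w - d x z = 2 * gromov_product \<Gamma> S w x z"
    "d x w + d y w - d x y = 2 * gromov_product \<Gamma> S w x y"
    "d y w + d z w - d y z = 2 * gromov_product \<Gamma> S w y z"
    unfolding gromov_product_def by auto
  show ?thesis using four_point[OF assms] 1 unfolding min_def max_def by (smt (verit))
qed

abbreviation gp :: "'g \<Rightarrow> 'g \<Rightarrow> real" where "gp \<equiv> gromov_product \<Gamma> S \<one>"

lemma gp_eq: "x \<in> carrier \<Gamma> \<Longrightarrow> y \<in> carrier \<Gamma> \<Longrightarrow> 2 * gp x y = len x + len y - d x y"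
  unfolding gromov_product_def by (simp add: d_one_right)

lemma gp_sym: "x \<in> carrier \<Gamma> \<Longrightarrow> y \<in> carrier \<Gamma> \<Longrightarrow> gp x y = gp y x"
  using gp_eq[of x y] gp_eq[of y x] d_sym[of x y] by simp

lemma gp_le: "x \<in> carrier \<Gamma> \<Longrightarrow> y \<in> carrier \<Gamma> \<Longrightarrow> gp x y \<le> len x"
  using d_triangle[of \<one> x y] gp_eq[of x y] by simp

lemma gp_left_mult:
  assumes "f \<in> carrier \<Gamma>" "x \<in> carrier \<Gamma>" "y \<in> carrier \<Gamma>"
  shows "gp (f \<otimes> x) (f \<otimes> y) \<ge> gp x y - len f"
proof -
  have "len (f \<otimes> x) \<ge> len x - len f" "len (f \<otimes> y) \<ge> len y - len f"
    using len_mult[of "inv f" "f \<otimes> x"] len_mult[of "inv f" "f \<otimes> y"] assms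
    by (auto simp: m_assoc[symmetric])
  then show ?thesis
    using gp_eq[of x y] gp_eq[of "f \<otimes> x" "f \<otimes> y"] assms by (simp add: d_left)
qed

lemma horofunction_close:
  assumes "h \<in> carrier \<Gamma>" "z \<in> carrier \<Gamma>" "z' \<in> carrier \<Gamma>" and "gp z z' > len h + \<delta>"
  shows "\<bar>(len z - d h z) - (len z' - d h z')\<bar> \<le> 2 * \<delta>"
proof -
  have "len z + d h z' \<le> max (len h + d z z') (len z' + d h z) + 2 * \<delta>"
    using four_point_dist[of z' \<one> h z] assms d_sym[of h z] d_sym[of z z'] d_one_left
    by (smt (verit) one_closed)
  moreover have "len z' + d h z \<le> max (len h + d z z') (len z + d h z') + 2 * \<delta>"
    using four_point_dist[of z \<one> h z'] assms d_sym[of z z']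
    by (smt (verit) d_one_left one_closed)
  moreover have "d h z' \<ge> len z' - len h" "d h z \<ge> len z - len h"
    using d_triangle[of \<one> h z'] d_triangle[of \<one> h z] assms by auto
  ultimately show ?thesis using assms(4) gp_eq[OF assms(2,3)] by (auto simp: max_def split: if_splits)
qed


lemma horofunction_subsequence:
  fixes z :: "nat \<Rightarrow> 'g"
  assumes z: "\<And>n. z n \<in> carrier \<Gamma>"
  obtains s L where "strict_mono (s :: nat \<Rightarrow> nat)"
    "\<And>f. f \<in> carrier \<Gamma> \<Longrightarrow> (\<lambda>i. len (z (s i)) - d f (z (s i))) \<longlonglongrightarrow> L f"
proof -
  define c where "c f n = len (z n) - d f (z n)" for f n
  have cb: "\<bar>c f n\<bar> \<le> len f" if "f \<in> carrier \<Gamma>" for f n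
    using d_triangle[of \<one> f "z n"] d_triangle[of f \<one> "z n"] d_one_right[OF that] that z
    unfolding c_def by (auto simp: abs_le_iff)
  have un: "carrier \<Gamma> = (\<Union>n. {x \<in> carrier \<Gamma>. len x \<le> real n})"
    using real_arch_simple by auto
  have cnt: "countable (carrier \<Gamma>)"
    by (subst un) (intro countable_UN countableI_type countable_finite finite_len_ball)
  define e where "e = from_nat_into (carrier \<Gamma>)"
  have e: "range e = carrier \<Gamma>" unfolding e_def by (rule range_from_nat_into[OF _ cnt]) auto
  interpret subseqs "\<lambda>n s. convergent (c (e n) \<circ> s)"
  proof
    fix n and s :: "nat \<Rightarrow> nat" assume "strict_mono s"
    have "e n \<in> carrier \<Gamma>" using e by auto
    then have "bounded (range (c (e n) \<circ> s))"
      using cb by (intro boundedI[of _ "len (e n)"]) auto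
    from bounded_imp_convergent_subsequence[OF this]
    show "\<exists>r'. strict_mono r' \<and> convergent (c (e n) \<circ> (s \<circ> r'))"
      by (auto simp: convergent_def o_assoc)
  qed
  have conv: "convergent (c f \<circ> diagseq)" if f: "f \<in> carrier \<Gamma>" for f
  proof -
    obtain k where k: "f = e k" using e f by auto
    have "convergent (c f \<circ> (diagseq \<circ> (+) (Suc k)))" unfolding k
      by (rule diagseq_holds) (auto simp: o_assoc intro: convergent_subseq_convergent)
    then obtain l where "(\<lambda>i. (c f \<circ> diagseq) (i + Suc k)) \<longlonglongrightarrow> l"
      unfolding convergent_def by (auto simp: o_def add.commute)
    from LIMSEQ_offset[OF this] show ?thesis unfolding convergent_def by blast
  qed
  show ?thesis
  proof (rule that[OF subseq_diagseq])
    fix f assume "f \<in> carrier \<Gamma>"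
    from conv[OF this] show "(\<lambda>i. len (z (diagseq i)) - d f (z (diagseq i))) \<longlonglongrightarrow> lim (c f \<circ> diagseq)"
      by (simp add: convergent_LIMSEQ_iff c_def o_def)
  qed
qed

context
  fixes z :: "nat \<Rightarrow> 'g" and L :: "'g \<Rightarrow> real"
  assumes z_carrier: "\<And>n. z n \<in> carrier \<Gamma>"
    and z_fixed: "\<And>f M. f \<in> carrier \<Gamma> \<Longrightarrow> \<forall>\<^sub>F n in sequentially. gp (z n) (f \<otimes> z n) \<ge> M"
    and z_lim: "\<And>f. f \<in> carrier \<Gamma> \<Longrightarrow> (\<lambda>n. len (z n) - d f (z n)) \<longlonglongrightarrow> L f"
begin

lemma horofunction_quasimorphism:
  assumes f: "f \<in> carrier \<Gamma>" and h: "h \<in> carrier \<Gamma>"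
  shows "\<bar>L (f \<otimes> h) - L f - L h\<bar> \<le> 2 * \<delta>"
proof (rule tendsto_upperbound)
  let ?c = "\<lambda>f n. len (z n) - d f (z n)"
  show "(\<lambda>n. \<bar>?c (f \<otimes> h) n - ?c f n - ?c h n\<bar>) \<longlonglongrightarrow> \<bar>L (f \<otimes> h) - L f - L h\<bar>"
    using f h by (intro tendsto_intros z_lim) auto
  show "\<forall>\<^sub>F n in sequentially. \<bar>?c (f \<otimes> h) n - ?c f n - ?c h n\<bar> \<le> 2 * \<delta>"
    using z_fixed[of "inv f" "len h + \<delta> + 1", OF inv_closed[OF f]]
  proof eventually_elim
    case (elim n)
    let ?z = "z n" and ?y = "inv f \<otimes> z n"
    have y: "?y \<in> carrier \<Gamma>" using f z_carrier by auto
    have "\<bar>(len ?z - d h ?z) - (len ?y - d h ?y)\<bar> \<le> 2 * \<delta>"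
      using horofunction_close[OF h z_carrier y] elim by auto
    moreover have "d (f \<otimes> h) ?z = d h ?y" "d f ?z = len ?y"
      using d_left[of f h ?y] d_left[of f \<one> ?y] f h y z_carrier by (auto simp: m_assoc[symmetric])
    ultimately show ?case by simp
  qed
qed simp

lemma horofunction_inv:
  assumes f: "f \<in> carrier \<Gamma>" shows "\<bar>L (inv f) + L f\<bar> \<le> 2 * \<delta>"
proof -
  have "L \<one> = 0"
    using LIMSEQ_unique[OF z_lim[OF one_closed]] z_carrier by (simp add: LIMSEQ_unique)
  then show ?thesis using horofunction_quasimorphism[of "inv f" f] f by auto
qed

text \<open>Elements of bounded horofunction value move a far away point of a geodesic towards the fixed
  end by a bounded amount, so conjugating by such a point embeds them in a fixed ball.\<close>

lemma horofunction_sublevel_card: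
  assumes F: "finite F" "F \<subseteq> carrier \<Gamma>" and FK: "\<And>f. f \<in> F \<Longrightarrow> \<bar>L f\<bar> \<le> K"
  shows "card F \<le> card {x \<in> carrier \<Gamma>. len x \<le> 3 * K + 14 * \<delta> + 3}"
proof (cases "F = {}")
  case False
  define m where "m = nat \<lceil>2 * Max (len ` F) + \<delta> + 1\<rceil>"
  have K0: "K \<ge> 0" using False FK by (meson abs_ge_zero ex_in_conv order_trans)
  have lenF: "2 * len f + \<delta> < m" if "f \<in> F" for f
  proof -
    have "len f \<le> Max (len ` F)" using F that by auto
    then show ?thesis unfolding m_def by linarith
  qed
  have "\<forall>\<^sub>F n in sequentially. \<forall>f\<in>F. gp (z n) (f \<otimes> z n) \<ge> m \<and> \<bar>len (z n) - d f (z n)\<bar> \<le> K + 1"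
  proof (intro eventually_ball_finite F ballI)
    fix f assume f: "f \<in> F"
    have "\<bar>L f\<bar> < K + 1" using FK[OF f] by simp
    then have "\<forall>\<^sub>F n in sequentially. \<bar>len (z n) - d f (z n)\<bar> < K + 1"
      using tendsto_rabs[OF z_lim[of f]] f F order_tendstoD(2) by blast
    moreover have "\<forall>\<^sub>F n in sequentially. gp (z n) (f \<otimes> z n) \<ge> m" using z_fixed f F by blast
    ultimately show "\<forall>\<^sub>F n in sequentially. gp (z n) (f \<otimes> z n) \<ge> m \<and> \<bar>len (z n) - d f (z n)\<bar> \<le> K + 1"
      by eventually_elim auto
  qed
  from eventually_happens'[OF sequentially_bot this]
  obtain n where n: "\<And>f. f \<in> F \<Longrightarrow> gp (z n) (f \<otimes> z n) \<ge> m"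
      "\<And>f. f \<in> F \<Longrightarrow> \<bar>len (z n) - d f (z n)\<bar> \<le> K + 1" by auto
  let ?z = "z n"
  have zc: "?z \<in> carrier \<Gamma>" by (rule z_carrier)
  obtain f0 where f0: "f0 \<in> F" using False by auto
  have "m \<le> word_length \<Gamma> S ?z"
    using n(1)[OF f0] gp_le[of ?z "f0 \<otimes> ?z"] zc f0 F by auto
  then obtain r where r: "r \<in> carrier \<Gamma>" "len r = m" "d r ?z = len ?z - m"
    using geodesic_point[OF zc] by blast
  have "len (inv r \<otimes> (f \<otimes> r)) \<le> 3 * K + 14 * \<delta> + 3" if f: "f \<in> F" for f
  proof -
    have fc: "f \<in> carrier \<Gamma>" using f F by auto
    let ?y = "f \<otimes> ?z" and ?s = "f \<otimes> r"
    have c: "?y \<in> carrier \<Gamma>" "?s \<in> carrier \<Gamma>" using fc zc r by auto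
    have d1: "d f ?y = len ?z" "d f ?s = m" "d ?s ?y = len ?z - m"
      using d_mult_right d_left fc zc r by auto
    have m: "len f + \<delta> < m - len f" using lenF[OF f] by simp
    have "\<bar>(len ?z - d f ?z) - (len ?y - d f ?y)\<bar> \<le> 2 * \<delta>"
      using n(1)[OF f] m by (intro horofunction_close fc zc c) auto
    then have c1: "\<bar>len ?y - len ?z\<bar> \<le> K + 1 + 2 * \<delta>" using n(2)[OF f] d1 by linarith
    have "2 * gp r ?z = 2 * m" using gp_eq[OF r(1) zc] r by simp
    then have "gp ?s ?y \<ge> m - len f" using gp_left_mult[OF fc r(1) zc] by simp
    then have "\<bar>(len ?s - d f ?s) - (len ?y - d f ?y)\<bar> \<le> 2 * \<delta>"
      using m by (intro horofunction_close fc c) auto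
    then have c2: "\<bar>len ?s - m\<bar> \<le> K + 1 + 4 * \<delta>" using c1 d1 by linarith
    have g1: "2 * gp ?y ?s \<ge> 2 * real m - 2 * (K + 1) - 6 * \<delta>"
      using gp_eq[OF c] d_sym[OF c] d1 abs_le_D2[OF c1] abs_le_D2[OF c2]
      by (simp add: algebra_simps)
    have "gp r ?y \<ge> m - \<delta>"
      using four_point[of \<one> r ?z ?y] n(1)[OF f] \<open>2 * gp r ?z = 2 * m\<close> r zc c by auto
    then have "gp r ?s \<ge> m - (K + 1) - 4 * \<delta> - \<delta>"
      using four_point[of \<one> r ?y ?s] g1 r c K0 delta_nonneg by (auto simp: min_def split: if_splits)
    then have "d r ?s \<le> 3 * K + 14 * \<delta> + 3"
      using gp_eq[OF r(1) c(2)] c2 r by linarith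
    then show ?thesis unfolding word_dist_def .
  qed
  moreover have "inj_on (\<lambda>f. inv r \<otimes> (f \<otimes> r)) F"
  proof (rule inj_onI)
    fix f g assume fg: "f \<in> F" "g \<in> F" "inv r \<otimes> (f \<otimes> r) = inv r \<otimes> (g \<otimes> r)"
    then have c: "f \<in> carrier \<Gamma>" "g \<in> carrier \<Gamma>" using F by auto
    then have "f \<otimes> r = g \<otimes> r" using fg(3) r by (subst (asm) Units_l_cancel) auto
    then show "f = g" using c r by simp
  qed
  ultimately show ?thesis
    using F r by (intro card_inj_on_le[where f = "\<lambda>f. inv r \<otimes> (f \<otimes> r)"] finite_len_ball) auto
qed simp

lemma horofunction_sublevel_finite: "finite {f \<in> carrier \<Gamma>. \<bar>L f\<bar> \<le> K}"
proof (rule ccontr)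
  assume "infinite {f \<in> carrier \<Gamma>. \<bar>L f\<bar> \<le> K}"
  then obtain F where "finite F" "card F = Suc (card {x \<in> carrier \<Gamma>. len x \<le> 3 * K + 14 * \<delta> + 3})"
      "F \<subseteq> {f \<in> carrier \<Gamma>. \<bar>L f\<bar> \<le> K}"
    using infinite_arbitrarily_large by blast
  with horofunction_sublevel_card[of F K] show False by auto
qed

lemma descending_steps_hit:
  fixes e :: "nat \<Rightarrow> real"
  assumes "e 0 \<ge> 0" and "\<And>k. e (Suc k) - e k \<le> -1" and "\<And>k. e (Suc k) - e k \<ge> - M"
  shows "\<exists>k. \<bar>e k\<bar> \<le> M"
proof -
  have "e k \<le> e 0 - k" for k
  proof (induction k)
    case (Suc k)
    then show ?case using assms(2)[of k] by simp
  qed simp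
  then have "\<exists>k. e k < 0" by (metis le_less_trans less_iff_diff_less_0 reals_Archimedean2)
  define k where "k = (LEAST k. e k < 0)"
  have k: "e k < 0" unfolding k_def by (rule LeastI_ex) fact
  then have "k \<noteq> 0" using assms(1) by (metis not_less)
  then obtain j where j: "k = Suc j" using not0_implies_Suc by blast
  then have "e j \<ge> 0" using not_less_Least[of j "\<lambda>k. e k < 0"] k_def by auto
  then show ?thesis using k j assms(3)[of j] by (intro exI[of _ k]) auto
qed

lemma fixed_end_cyclic_cosets:
  "\<exists>a\<in>carrier \<Gamma>. finite (rcosets (generate \<Gamma> {a}))"
proof (cases "\<forall>f\<in>carrier \<Gamma>. \<bar>L f\<bar> \<le> 6 * \<delta> + 1")
  case True
  then have "carrier \<Gamma> = {f \<in> carrier \<Gamma>. \<bar>L f\<bar> \<le> 6 * \<delta> + 1}" by auto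
  then have "finite (carrier \<Gamma>)" using horofunction_sublevel_finite by metis
  then show ?thesis unfolding RCOSETS_def by auto
next
  case False
  then obtain f where f: "f \<in> carrier \<Gamma>" "\<bar>L f\<bar> > 6 * \<delta> + 1" by force
  have "\<exists>a\<in>carrier \<Gamma>. L a > 4 * \<delta> + 1"
  proof (cases "L f > 0")
    case True
    then show ?thesis using f delta_nonneg by (intro bexI[of _ f]) auto
  next
    case False
    then show ?thesis using f horofunction_inv[of f] by (intro bexI[of _ "inv f"]) auto
  qed
  then obtain a where a: "a \<in> carrier \<Gamma>" "L a > 4 * \<delta> + 1" by auto
  define H where "H = generate \<Gamma> {a}"
  have H: "subgroup H \<Gamma>" unfolding H_def using a by (intro generate_is_subgroup) auto
  have step: "\<exists>y h. y \<in> carrier \<Gamma> \<and> h \<in> H \<and> \<bar>L y\<bar> \<le> L a + 4 * \<delta> \<and> y = h \<otimes> g" if g: "g \<in> carrier \<Gamma>" for g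
  proof (cases "L g \<ge> 0")
    case True
    define e where "e k = L ((inv a) [^] (k::nat) \<otimes> g)" for k
    have e: "\<bar>e (Suc k) - e k - L (inv a)\<bar> \<le> 2 * \<delta>" for k
      using horofunction_quasimorphism[of "inv a" "inv a [^] k \<otimes> g"] a g nat_pow_Suc2[of "inv a" k]
      unfolding e_def by (simp add: m_assoc[symmetric] algebra_simps del: nat_pow_Suc)
    have "e 0 \<ge> 0" using True g by (simp add: e_def)
    moreover have "e (Suc k) - e k \<le> -1" "e (Suc k) - e k \<ge> - (L a + 4 * \<delta>)" for k
      using e[of k] horofunction_inv[OF a(1)] a by linarith+
    ultimately obtain k where "\<bar>e k\<bar> \<le> L a + 4 * \<delta>" using descending_steps_hit by metis
    moreover have "inv a \<in> H" unfolding H_def by (auto intro: generate.inv)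
    then have "inv a [^] k \<in> H" using H by (induction k) (auto simp: subgroup.one_closed subgroup.m_closed)
    ultimately show ?thesis using a g unfolding e_def by (metis inv_closed m_closed nat_pow_closed)
  next
    case False
    define e where "e k = - L (a [^] (k::nat) \<otimes> g)" for k
    have e: "\<bar>e (Suc k) - e k + L a\<bar> \<le> 2 * \<delta>" for k
      using horofunction_quasimorphism[of a "a [^] k \<otimes> g"] a g nat_pow_Suc2[of a k]
      unfolding e_def by (simp add: m_assoc[symmetric] algebra_simps del: nat_pow_Suc)
    have "e 0 \<ge> 0" using False g by (simp add: e_def)
    moreover have "e (Suc k) - e k \<le> -1" "e (Suc k) - e k \<ge> - (L a + 4 * \<delta>)" for k
      using e[of k] a delta_nonneg by linarith+
    ultimately obtain k where "\<bar>e k\<bar> \<le> L a + 4 * \<delta>" using descending_steps_hit by metis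
    then have "\<bar>L (a [^] k \<otimes> g)\<bar> \<le> L a + 4 * \<delta>" unfolding e_def by simp
    moreover have "a \<in> H" unfolding H_def by (auto intro: generate.incl)
    then have "a [^] k \<in> H" using H by (induction k) (auto simp: subgroup.one_closed subgroup.m_closed)
    ultimately show ?thesis using a g by (metis m_closed nat_pow_closed)
  qed
  have "rcosets H \<subseteq> (\<lambda>y. H #> y) ` {f \<in> carrier \<Gamma>. \<bar>L f\<bar> \<le> L a + 4 * \<delta>}"
  proof
    fix C assume "C \<in> rcosets H"
    then obtain g where g: "g \<in> carrier \<Gamma>" "C = H #> g" unfolding RCOSETS_def by auto
    obtain y h where y: "y \<in> carrier \<Gamma>" "h \<in> H" "\<bar>L y\<bar> \<le> L a + 4 * \<delta>" "y = h \<otimes> g"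
      using step[OF g(1)] by auto
    have "y \<in> H #> g" using y unfolding r_coset_def by auto
    then have "C = H #> y" using g H repr_independence by auto
    then show "C \<in> (\<lambda>y. H #> y) ` {f \<in> carrier \<Gamma>. \<bar>L f\<bar> \<le> L a + 4 * \<delta>}" using y by auto
  qed
  then have "finite (rcosets H)" using horofunction_sublevel_finite finite_surj by blast
  then show ?thesis using a unfolding H_def by auto
qed

end


lemma bounded_gromov_product_extension:
  assumes "non_elementary \<Gamma>"
  obtains N :: nat where
    "\<And>x. x \<in> carrier \<Gamma> \<Longrightarrow> \<exists>f\<in>carrier \<Gamma>. len f \<le> N \<and> gp x (f \<otimes> inv x) \<le> N"
proof (rule ccontr)
  assume "\<not> thesis"
  then have "\<forall>N::nat. \<exists>x\<in>carrier \<Gamma>. \<forall>f\<in>carrier \<Gamma>. len f \<le> N \<longrightarrow> gp x (f \<otimes> inv x) > N"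
    using that by (meson not_le)
  then obtain z where z: "\<And>N::nat. z N \<in> carrier \<Gamma>"
    "\<And>N f. f \<in> carrier \<Gamma> \<Longrightarrow> len f \<le> real N \<Longrightarrow> gp (z N) (f \<otimes> inv (z N)) > real N" by metis
  have ev: "\<forall>\<^sub>F n in sequentially. gp (z n) (f \<otimes> z n) \<ge> M" if f: "f \<in> carrier \<Gamma>" for f M
  proof -
    obtain n0 :: nat where n0: "real n0 \<ge> max (len f) (M + len f + \<delta>)" using real_arch_simple by blast
    have "gp (z n) (f \<otimes> z n) \<ge> M" if "n \<ge> n0" for n
    proof -
      have n: "real n \<ge> len f" "real n \<ge> M + len f + \<delta>" using n0 that by auto
      have "gp (z n) (inv (z n)) > n" using z(2)[OF one_closed, of n] z(1) by simp
      then have "gp (f \<otimes> inv (z n)) (f \<otimes> z n) > n - len f"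
        using gp_left_mult[OF f, of "z n" "inv (z n)"] z(1) f gp_sym[of "f \<otimes> z n" "f \<otimes> inv (z n)"] by auto
      then show ?thesis
        using four_point[of \<one> "z n" "f \<otimes> inv (z n)" "f \<otimes> z n"] z(2)[OF f n(1)] z(1) f n(2) 
        by (auto simp: min_def split: if_splits)
    qed
    then show ?thesis unfolding eventually_sequentially by auto
  qed
  obtain s L where s: "strict_mono (s :: nat \<Rightarrow> nat)"
    "\<And>f. f \<in> carrier \<Gamma> \<Longrightarrow> (\<lambda>i. len (z (s i)) - d f (z (s i))) \<longlonglongrightarrow> L f"
    using horofunction_subsequence[of z] z(1) by blast
  have "\<exists>a\<in>carrier \<Gamma>. finite (rcosets (generate \<Gamma> {a}))"
    by (rule fixed_end_cyclic_cosets[of "\<lambda>i. z (s i)" L])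
      (use z(1) s eventually_subseq[OF s(1) ev] in auto)
  then show False using assms unfolding non_elementary_def by auto
qed

lemma power_chain:
  assumes h: "h \<in> carrier \<Gamma>" and C: "gp h (inv h) \<le> C" "C \<ge> 0" and big: "len h > 2 * C + 2 * \<delta>"
  shows "gp (inv (h [^] k)) h \<le> C + \<delta>" (is ?A)
    and "len (h [^] Suc k) \<ge> len (h [^] k) + len h - 2 * C - 2 * \<delta>" (is ?B)
proof -
  have *: "len (h [^] Suc k) = len (h [^] k) + len h - 2 * gp (inv (h [^] k)) h" for k
    using gp_eq[of "inv (h [^] k)" h] h unfolding word_dist_def by simp
  have "?A \<and> ?B"
  proof (induction k)
    case 0
    have "gp \<one> h = 0" using gp_eq[of \<one> h] h by simp
    then show ?case using C delta_nonneg h by simp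
  next
    case (Suc k)
    have "d (inv h) (inv (h [^] Suc k)) = len (h [^] k)"
    proof -
      have "inv (inv h) \<otimes> inv (h [^] Suc k) = inv (h [^] k)"
        using h nat_pow_Suc2[OF h, of k] inv_mult_group[of "h [^] k" h] by (simp add: m_assoc[symmetric])
      then show ?thesis unfolding word_dist_def using h by simp
    qed
    then have "2 * gp (inv h) (inv (h [^] Suc k)) = len h + len (h [^] Suc k) - len (h [^] k)"
      using gp_eq[of "inv h" "inv (h [^] Suc k)"] h by (simp del: nat_pow_Suc)
    then have "gp (inv h) (inv (h [^] Suc k)) > C + \<delta>" using Suc big by linarith
    moreover have "gp (inv h) h \<le> C" using C gp_sym[of h "inv h"] h by simp
    ultimately have "gp (inv (h [^] Suc k)) h \<le> C + \<delta>"
      using four_point[of \<one> "inv h" "inv (h [^] Suc k)" h] h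
      by (auto simp: min_def simp del: nat_pow_Suc split: if_splits)
    then show ?case using *[of "Suc k"] by linarith
  qed
  then show ?A ?B by auto
qed

lemma quasigeodesic_power_path:
  assumes "non_elementary \<Gamma>"
  shows "\<exists>N D. \<forall>x\<in>carrier \<Gamma>. len x \<ge> N \<longrightarrow> (\<exists>f m p. f \<in> carrier \<Gamma> \<and> (m::nat) > 0 \<and>
        (\<forall>i::nat. p i \<in> carrier \<Gamma>) \<and> (\<forall>i. \<exists>s\<in>S. p (Suc i) = p i \<otimes> s) \<and>
        p (word_length \<Gamma> S x) = x \<and> (\<forall>k. p (k * m) = (x \<otimes> f) [^] k) \<and>
        (\<forall>i. len (p i) \<ge> real i / 2 - D))"
proof -
  obtain N :: nat where N: "\<And>x. x \<in> carrier \<Gamma> \<Longrightarrow> \<exists>f\<in>carrier \<Gamma>. len f \<le> N \<and> gp x (f \<otimes> inv x) \<le> N"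
    using bounded_gromov_product_extension[OF assms] by blast
  define D where "D = 8 * real N + 4 * \<delta>"
  have path: "\<exists>f m p. f \<in> carrier \<Gamma> \<and> (m::nat) > 0 \<and>
        (\<forall>i::nat. p i \<in> carrier \<Gamma>) \<and> (\<forall>i. \<exists>s\<in>S. p (Suc i) = p i \<otimes> s) \<and>
        p (word_length \<Gamma> S x) = x \<and> (\<forall>k. p (k * m) = (x \<otimes> f) [^] k) \<and>
        (\<forall>i. len (p i) \<ge> real i / 2 - D)"
    if x: "x \<in> carrier \<Gamma>" and xN: "len x \<ge> 12 * real N + 4 * \<delta> + 1" for x
  proof -
    obtain f' where f': "f' \<in> carrier \<Gamma>" "len f' \<le> N" "gp x (f' \<otimes> inv x) \<le> N" using N[OF x] by blast
    define f where "f = inv f'"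
    have f: "f \<in> carrier \<Gamma>" "len f \<le> N" "gp x (inv f \<otimes> inv x) \<le> N" using f' unfolding f_def by auto
    define h where "h = x \<otimes> f"
    have h: "h \<in> carrier \<Gamma>" "inv h = inv f \<otimes> inv x" using x f by (auto simp: h_def inv_mult_group)
    have hpow: "h [^] k \<in> carrier \<Gamma>" for k :: nat using h by simp
    obtain us where us: "set us \<subseteq> S" "length us = word_length \<Gamma> S x" "word_val us = x"
      using geodesic_word[OF x] by blast
    obtain vs where vs: "set vs \<subseteq> S" "length vs = word_length \<Gamma> S f" "word_val vs = f"
      using geodesic_word[OF f(1)] by blast
    define ws where "ws = us @ vs"
    define m where "m = length ws"
    have ws: "set ws \<subseteq> S" "word_val ws = h"
      using us vs word_val_append unfolding ws_def h_def by (auto simp del: foldr_append)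
    have m: "real m = len x + len f" unfolding m_def ws_def using us vs by simp
    have "real m > 0" using m xN delta_nonneg by linarith
    then have m0: "m > 0" by simp
    have lenh: "len h \<ge> m - 2 * real N" "len h \<le> m"
      using len_mult[of h "inv f"] len_mult[OF x f(1)] x f m unfolding h_def by (auto simp: m_assoc)
    have "d x h \<le> N" unfolding h_def using d_mult_right x f by simp
    have "gp h (inv h) \<le> 2 * real N"
    proof -
      have "d h (inv h) \<ge> d x (inv h) - N"
        using d_triangle[of x h "inv h"] \<open>d x h \<le> N\<close> x h(1) by auto
      moreover have "len h \<le> len x + N" using len_mult[OF x f(1)] f unfolding h_def by simp
      ultimately show ?thesis
        using gp_eq[OF h(1) inv_closed[OF h(1)]] gp_eq[OF x inv_closed[OF h(1)]] f(3) h(2) by simp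
    qed
    note chain = power_chain[OF h(1) this]
    have big: "len h > 2 * (2 * real N) + 2 * \<delta>" using lenh m xN f delta_nonneg by linarith
    have pow_len: "len (h [^] k) \<ge> real k * (real m / 2)" for k :: nat
    proof (induction k)
      case (Suc k)
      have "len (h [^] Suc k) \<ge> len (h [^] k) + real m / 2"
        using chain(2)[of k] big lenh m xN f delta_nonneg by linarith
      then show ?case using Suc by (simp add: algebra_simps)
    qed simp
    define w where "w s = word_val (take s ws)" for s
    have tk: "set (take s ws) \<subseteq> S" "set (drop s ws) \<subseteq> S" for s
      using ws set_take_subset[of s ws] set_drop_subset[of s ws] by auto
    have w: "w s \<in> carrier \<Gamma>" for s unfolding w_def using tk by simp
    define p where "p i = h [^] (i div m) \<otimes> w (i mod m)" for i
    have lower: "len (h [^] k \<otimes> w s) \<ge> len (h [^] k) + s - D" if s: "s \<le> m" for k s :: nat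
    proof -
      have "word_val (take s ws @ drop s ws) = w s \<otimes> word_val (drop s ws)"
        unfolding w_def using tk by (rule word_val_append)
      then have hs: "h = w s \<otimes> word_val (drop s ws)" using ws by simp
      have "d (w s) h = len (word_val (drop s ws))" 
        unfolding hs by (rule d_mult_right) (use w tk in auto)
      also have "\<dots> \<le> m - s" using len_le[OF tk(2)[of s]] m_def by simp
      finally have dw: "d (w s) h \<le> m - s" .
      have l1: "len (w s) \<le> s" using len_le[OF tk(1)[of s]] s unfolding m_def w_def by simp
      have l2: "len (w s) \<ge> s - 2 * real N"
        using d_triangle[of \<one> "w s" h] w h dw lenh s by (simp add: of_nat_diff)
      have g: "gp (w s) h \<ge> s - 2 * real N" using gp_eq[OF w[of s] h(1)] l2 dw lenh(1) s by (simp only: of_nat_diff)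
      have e: "len (h [^] k \<otimes> w s) = len (h [^] k) + len (w s) - 2 * gp (inv (h [^] k)) (w s)"
        using gp_eq[of "inv (h [^] k)" "w s"] h w unfolding word_dist_def by simp
      have "min (gp (inv (h [^] k)) (w s)) (gp (w s) h) \<le> 2 * real N + 2 * \<delta>"
        using order_trans[OF four_point[OF one_closed inv_closed[OF hpow[of k]] w[of s] h(1)] chain(1)[of k, OF _ big]]
        by linarith
      then consider "gp (inv (h [^] k)) (w s) \<le> 2 * real N + 2 * \<delta>" | "s - 2 * real N \<le> 2 * real N + 2 * \<delta>"
        using g by (auto simp: min_def split: if_splits)
      then show ?thesis
      proof cases
        case 1
        then show ?thesis using e l2 unfolding D_def by simp
      next
        case 2
        have "len (h [^] k) \<le> len (h [^] k \<otimes> w s) + len (w s)"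
          using len_mult[of "h [^] k \<otimes> w s" "inv (w s)"] hpow w by (simp add: m_assoc)
        then show ?thesis using l1 2 unfolding D_def by simp
      qed
    qed
    have "len (p i) \<ge> real i / 2 - D" for i
    proof -
      have "i mod m \<le> m" using m0 by (simp add: less_imp_le)
      moreover have "real i = real (i div m) * real m + real (i mod m)"
        by (metis div_mult_mod_eq of_nat_add of_nat_mult)
      ultimately show ?thesis
        using lower[of "i mod m" "i div m"] pow_len[of "i div m"] unfolding p_def
        by (simp add: add_divide_distrib)
    qed
    moreover have "\<exists>s\<in>S. p (Suc i) = p i \<otimes> s" for i
    proof -
      have i: "i mod m < m" using m0 by simp
      define s where "s = ws ! (i mod m)"
      have sS: "s \<in> S" using i ws(1) unfolding s_def m_def by (meson nth_mem subsetD)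
      then have sc: "s \<in> carrier \<Gamma>" using gens_carrier by auto
      have "w (Suc (i mod m)) = w (i mod m) \<otimes> s"
      proof -
        have "take (Suc (i mod m)) ws = take (i mod m) ws @ [s]"
          using i unfolding s_def m_def by (simp add: take_Suc_conv_app_nth)
        then show ?thesis unfolding w_def using word_val_append[of "take (i mod m) ws" "[s]"] tk sS sc 
          by (simp del: foldr_append)
      qed
      then have e: "p i \<otimes> s = h [^] (i div m) \<otimes> w (Suc (i mod m))"
        unfolding p_def using hpow w sc by (simp add: m_assoc)
      have "p (Suc i) = p i \<otimes> s"
      proof (cases "Suc (i mod m) = m")
        case True
        then have "Suc i mod m = 0" "Suc i div m = Suc (i div m)" by (simp_all add: mod_Suc div_Suc)
        moreover have "w m = h" "w 0 = \<one>" unfolding w_def m_def using ws by auto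
        ultimately show ?thesis using e True hpow h unfolding p_def by simp
      next
        case False
        then have "Suc i mod m = Suc (i mod m)" "Suc i div m = i div m" by (simp_all add: mod_Suc div_Suc)
        then show ?thesis using e unfolding p_def by simp
      qed
      then show ?thesis using sS by auto
    qed
    moreover have "p (word_length \<Gamma> S x) = x"
    proof (cases "length us = m")
      case True
      then have "vs = []" unfolding m_def ws_def by simp
      then have "h = x" using vs x unfolding h_def by auto
      then show ?thesis unfolding p_def using True us m0 h by (simp add: w_def)
    next
      case False
      then have "length us < m" unfolding m_def ws_def by simp
      then have "p (length us) = w (length us)" using w unfolding p_def by simp
      also have "\<dots> = x" using us unfolding w_def ws_def by simp
      finally show ?thesis using us by simp
    qed
    moreover have "p (k * m) = h [^] k" for k unfolding p_def using m0 hpow by (simp add: w_def)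
    moreover have "p i \<in> carrier \<Gamma>" for i unfolding p_def using hpow w by simp
    ultimately show ?thesis using f(1) m0 unfolding h_def by blast
  qed
  show ?thesis
    by (rule exI[of _ "12 * real N + 4 * \<delta> + 1"], rule exI[of _ D], intro ballI impI, rule path)
qed

end

section \<open>Matrices close to rank one\<close>

definition outer :: "real^'n \<Rightarrow> real^'n \<Rightarrow> real^'n^'n" where
  "outer u w = (\<chi> i j. u $ i * w $ j)"

lemma outer_nth [simp]: "outer u w $ i $ j = u $ i * w $ j"
  by (simp add: outer_def)

lemma outer_mult_vec: "outer u w *v x = (w \<bullet> x) *\<^sub>R u"
  by (simp add: vec_eq_iff matrix_vector_mult_def inner_vec_def sum_distrib_left sum_distrib_right ac_simps)

lemma mult_outer: "A ** outer u w = outer (A *v u) w"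
  by (simp add: vec_eq_iff matrix_matrix_mult_def matrix_vector_mult_def sum_distrib_left sum_distrib_right
      ac_simps)

lemma outer_mult: "outer u w ** A = outer u (transpose A *v w)"
  by (simp add: vec_eq_iff matrix_matrix_mult_def matrix_vector_mult_def transpose_def
      sum_distrib_left algebra_simps)

lemma outer_scaleR_left: "outer (c *\<^sub>R u) w = c *\<^sub>R outer u w"
  and outer_scaleR_right: "outer u (c *\<^sub>R w) = c *\<^sub>R outer u w"
  by (simp_all add: vec_eq_iff)

lemma outer_mult_outer: "outer u w ** outer a b = (w \<bullet> a) *\<^sub>R outer u b"
  by (simp add: mult_outer outer_mult_vec outer_scaleR_left)

lemma trace_outer: "trace (outer u w) = u \<bullet> w"
  by (simp add: trace_def inner_vec_def)

lemma inner_outer: "outer u w \<bullet> outer a b = (u \<bullet> a) * (w \<bullet> b)"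
  unfolding inner_vec_def by (simp add: sum_product algebra_simps)

lemma norm_outer: "norm (outer u w) = norm u * norm w"
  by (simp add: norm_eq_sqrt_inner inner_outer real_sqrt_mult)

lemma norm_matrix_vector_mult: "norm (A *v x) \<le> norm A * norm x" for A :: "real^'n^'m"
proof (rule power2_le_imp_le)
  have "(norm (A *v x))\<^sup>2 = (\<Sum>i\<in>UNIV. (A $ i \<bullet> x)\<^sup>2)"
    by (simp add: power2_norm_eq_inner inner_vec_def[of "A *v x"] matrix_vector_mul_component flip: power2_eq_square)
  also have "\<dots> \<le> (\<Sum>i\<in>UNIV. (A $ i \<bullet> A $ i) * (x \<bullet> x))"
    by (intro sum_mono Cauchy_Schwarz_ineq)
  also have "\<dots> = (norm A * norm x)\<^sup>2"
    by (simp add: power_mult_distrib power2_norm_eq_inner inner_vec_def[of A] sum_distrib_right)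
  finally show "(norm (A *v x))\<^sup>2 \<le> (norm A * norm x)\<^sup>2" .
qed simp

lemma norm_transpose: "norm (transpose A) = norm A" for A :: "real^'n^'m"
proof -
  have "transpose A \<bullet> transpose A = A \<bullet> A"
    unfolding inner_vec_def transpose_def by (simp, rule sum.swap)
  then show ?thesis by (simp add: norm_eq_sqrt_inner)
qed

lemma transpose_mult_nth: "transpose (A ** B) $ j = A *v (transpose B $ j)" 
  for A :: "real^'n^'m" and B :: "real^'k^'n"
  by (simp add: vec_eq_iff transpose_def matrix_matrix_mult_def matrix_vector_mult_def)

lemma norm_matrix_mult: "norm (A ** B) \<le> norm A * norm B"
  for A :: "real^'n^'m" and B :: "real^'k^'n"
proof -
  have "norm (transpose (A ** B)) \<le> norm A * norm (transpose B)"
  proof (rule power2_le_imp_le)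
    have "(norm (transpose (A ** B)))\<^sup>2 = (\<Sum>j\<in>UNIV. (norm (A *v (transpose B $ j)))\<^sup>2)"
      by (simp add: power2_norm_eq_inner inner_vec_def[of "transpose (A ** B)"] transpose_mult_nth)
    also have "\<dots> \<le> (\<Sum>j\<in>UNIV. (norm A * norm (transpose B $ j))\<^sup>2)"
      by (intro sum_mono power_mono norm_matrix_vector_mult) auto
    also have "\<dots> = (norm A * norm (transpose B))\<^sup>2"
      by (simp add: power_mult_distrib power2_norm_eq_inner inner_vec_def[of "transpose B"] sum_distrib_left)
    finally show "(norm (transpose (A ** B)))\<^sup>2 \<le> (norm A * norm (transpose B))\<^sup>2" .
  qed simp
  then show ?thesis by (simp add: norm_transpose)
qed

interpretation matrix_mult: bounded_bilinear "(**) :: real^'n^'m \<Rightarrow> real^'k^'n \<Rightarrow> real^'k^'m"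
proof
  show "\<exists>K. \<forall>a b. norm ((a :: real^'n^'m) ** (b :: real^'k^'n)) \<le> norm a * norm b * K"
    using norm_matrix_mult by (intro exI[of _ 1]) auto
qed (simp_all add: vec_eq_iff matrix_matrix_mult_def sum.distrib sum_distrib_left algebra_simps)

lemma bounded_bilinear_outer: "bounded_bilinear (outer :: real^'n \<Rightarrow> real^'n \<Rightarrow> real^'n^'n)"
proof
  show "\<exists>K. \<forall>a b :: real^'n. norm (outer a b) \<le> norm a * norm b * K"
    by (intro exI[of _ 1]) (simp add: norm_outer)
qed (simp_all add: vec_eq_iff algebra_simps)

lemma norm_mat_1_pos: "norm (mat 1 :: real^'n^'n) > 0"
proof -
  have "(mat 1 :: real^'n^'n) $ undefined $ undefined \<noteq> 0" by (simp add: mat_def)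
  then show ?thesis by (metis zero_index zero_less_norm_iff)
qed

lemma linear_trace: "linear (trace :: real^'n^'n \<Rightarrow> real)"
  by (rule linearI) (simp_all add: trace_def sum.distrib sum_distrib_left)

definition matpow :: "real^'n^'n \<Rightarrow> nat \<Rightarrow> real^'n^'n" where
  "matpow A k = (((**) A) ^^ k) (mat 1)"

lemma matpow_0 [simp]: "matpow A 0 = mat 1"
  and matpow_Suc: "matpow A (Suc k) = A ** matpow A k"
  by (simp_all add: matpow_def)

lemma matpow_add: "matpow A (j + k) = matpow A j ** matpow A k"
  by (induction j) (simp_all add: matpow_Suc matrix_mul_assoc)

lemma matpow_1 [simp]: "matpow A (Suc 0) = A"
  by (simp add: matpow_Suc)

lemma matpow_Suc2: "matpow A (Suc k) = matpow A k ** A"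
  using matpow_add[of A k 1] by simp

lemma transpose_matpow: "transpose (matpow A k) = matpow (transpose A) k"
  by (induction k) (simp_all add: matpow_Suc matrix_transpose_mul matpow_Suc2[symmetric])

lemma norm_matpow_le: "norm (matpow A k) \<le> norm (mat 1 :: real^'n^'n) * norm A ^ k"
  for A :: "real^'n^'n"
proof (induction k)
  case (Suc k)
  have "norm (matpow A (Suc k)) \<le> norm A * norm (matpow A k)"
    by (simp add: matpow_Suc norm_matrix_mult)
  also have "\<dots> \<le> norm A * (norm (mat 1 :: real^'n^'n) * norm A ^ k)"
    by (intro mult_left_mono Suc) simp
  finally show ?case by (simp add: algebra_simps)
qed simp

lemma matpow_inverse: assumes "B ** A = mat 1" shows "matpow B k ** matpow A k = mat 1"
proof (induction k)
  case (Suc k)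
  have "matpow B (Suc k) ** matpow A (Suc k) = matpow B k ** (B ** A) ** matpow A k"
    by (simp add: matpow_Suc2[of B] matpow_Suc[of A] matrix_mul_assoc del: assms)
  then show ?case using Suc assms by simp
qed simp

lemma norm_matpow_ge:
  fixes A B :: "real^'n^'n"
  assumes "B ** A = mat 1" shows "norm B ^ k * norm (matpow A k) \<ge> 1"
proof -
  have "norm (mat 1 :: real^'n^'n) \<le> norm (matpow B k) * norm (matpow A k)"
    using norm_matrix_mult[of "matpow B k" "matpow A k"] matpow_inverse[OF assms] by simp
  also have "\<dots> \<le> (norm (mat 1 :: real^'n^'n) * norm B ^ k) * norm (matpow A k)"
    by (intro mult_right_mono norm_matpow_le) simp
  finally show ?thesis using norm_mat_1_pos[where 'n='n] by (simp add: mult.assoc)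
qed

lemma exponential_steps_convergent:
  fixes X :: "nat \<Rightarrow> 'a::banach"
  assumes "\<beta> > 0" and step: "\<And>k. norm (X (Suc k) - X k) \<le> C * exp (- \<beta> * k)"
  obtains l where "X \<longlonglongrightarrow> l"
    "\<And>k. norm (X k - l) \<le> C / (1 - exp (- \<beta>)) * exp (- \<beta> * k)"
proof -
  define q where "q = exp (- \<beta>)"
  have q: "0 < q" "q < 1" using assms(1) by (auto simp: q_def)
  have qk: "exp (- \<beta> * real k) = q ^ k" for k
    unfolding q_def by (simp add: exp_of_nat_mult[symmetric] mult.commute)
  have C: "C \<ge> 0" using order_trans[OF norm_ge_zero step[of 0]] by simp
  have diff: "norm (X (k + j) - X k) \<le> C / (1 - q) * q ^ k" for k j
  proof -
    have "norm (X (k + j) - X k) \<le> C / (1 - q) * q ^ k * (1 - q ^ j)"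
    proof (induction j)
      case (Suc j)
      have "norm (X (k + Suc j) - X k) \<le> norm (X (Suc (k + j)) - X (k + j)) + norm (X (k + j) - X k)"
        using norm_triangle_ineq[of "X (Suc (k + j)) - X (k + j)" "X (k + j) - X k"] by simp
      also have "\<dots> \<le> C * q ^ (k + j) + C / (1 - q) * q ^ k * (1 - q ^ j)"
        using step[of "k + j"] Suc unfolding qk by simp
      also have "\<dots> = C / (1 - q) * q ^ k * (1 - q ^ Suc j)"
        using q by (simp add: field_simps power_add)
      finally show ?case .
    qed simp
    also have "\<dots> \<le> C / (1 - q) * q ^ k * 1"
      using C q by (intro mult_left_mono) auto
    finally show ?thesis by simp
  qed
  have lim0: "(\<lambda>k. C / (1 - q) * q ^ k) \<longlonglongrightarrow> 0"
    using q by (intro tendsto_mult_right_zero LIMSEQ_power_zero) auto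
  have "Cauchy X"
  proof (rule metric_CauchyI)
    fix e :: real assume e: "e > 0"
    from order_tendstoD(2)[OF lim0, of "e / 2"] obtain N where N: "C / (1 - q) * q ^ N < e / 2"
      using e by (auto simp: eventually_sequentially)
    have "dist (X m) (X n) < e" if "m \<ge> N" "n \<ge> N" for m n
    proof -
      have "dist (X m) (X N) < e / 2" "dist (X n) (X N) < e / 2"
        using order_le_less_trans[OF diff[of N "m - N"] N] order_le_less_trans[OF diff[of N "n - N"] N] that
        by (simp_all add: dist_norm)
      then show ?thesis by (metis dist_commute dist_triangle_half_l)
    qed
    then show "\<exists>M. \<forall>m\<ge>M. \<forall>n\<ge>M. dist (X m) (X n) < e" by blast
  qed
  then obtain l where l: "X \<longlonglongrightarrow> l" using Cauchy_convergent_iff convergent_def by metis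
  have "norm (X k - l) \<le> C / (1 - q) * q ^ k" for k
  proof (rule tendsto_upperbound)
    have "(\<lambda>j. X (j + k)) \<longlonglongrightarrow> l" using l by (simp add: LIMSEQ_ignore_initial_segment)
    then show "(\<lambda>j. norm (X k - X (j + k))) \<longlonglongrightarrow> norm (X k - l)" by (intro tendsto_intros)
    show "\<forall>\<^sub>F j in sequentially. norm (X k - X (j + k)) \<le> C / (1 - q) * q ^ k"
      using diff[of k] by (simp add: norm_minus_commute add.commute)
  qed simp
  then show ?thesis using that l unfolding qk q_def by blast
qed

definition near_rank1 :: "real \<Rightarrow> real^'n^'n \<Rightarrow> real^'n \<Rightarrow> real^'n \<Rightarrow> bool" where
  "near_rank1 \<epsilon> A u v \<longleftrightarrow>
     norm u = 1 \<and> norm v = 1 \<and> norm (A - norm A *\<^sub>R outer u v) \<le> \<epsilon> * norm A"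

lemma near_rank1_mono: "near_rank1 \<epsilon> A u v \<Longrightarrow> \<epsilon> \<le> \<epsilon>' \<Longrightarrow> near_rank1 \<epsilon>' A u v"
  unfolding near_rank1_def by (meson mult_right_mono norm_ge_zero order_trans)

lemma near_rank1_normalized:
  assumes "near_rank1 \<epsilon> A u v" "A \<noteq> 0"
  shows "norm ((1 / norm A) *\<^sub>R A - outer u v) \<le> \<epsilon>"
proof -
  have "(1 / norm A) *\<^sub>R A - outer u v = (1 / norm A) *\<^sub>R (A - norm A *\<^sub>R outer u v)"
    using assms(2) by (simp add: scaleR_diff_right)
  then have "norm ((1 / norm A) *\<^sub>R A - outer u v) = norm (A - norm A *\<^sub>R outer u v) / norm A" by simp
  also have "\<dots> \<le> \<epsilon>" using assms unfolding near_rank1_def by (simp add: pos_divide_le_eq)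
  finally show ?thesis .
qed

lemma near_rank1_nonneg: "near_rank1 \<epsilon> A u v \<Longrightarrow> A \<noteq> 0 \<Longrightarrow> \<epsilon> \<ge> 0"
  using near_rank1_normalized norm_ge_zero order_trans by blast

lemma near_rank1_transpose:
  assumes "near_rank1 \<epsilon> A u v" shows "near_rank1 \<epsilon> (transpose A) v u"
proof -
  have "transpose A - norm A *\<^sub>R outer v u = transpose (A - norm A *\<^sub>R outer u v)"
    by (simp add: vec_eq_iff transpose_def algebra_simps)
  then show ?thesis using assms by (simp add: near_rank1_def norm_transpose)
qed

lemma outer_directions_close:
  fixes u u' a b :: "real^'n"
  assumes u: "norm u = 1" and u': "norm u' = 1" and le: "norm (outer u a - outer u' b) \<le> \<eta>"
  shows "norm (outer u u - outer u' u') * norm b \<le> 2 * \<eta>"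
proof (cases "b = 0")
  case True
  then show ?thesis using order_trans[OF norm_ge_zero le] by simp
next
  case False
  define y where "y = u' - (u \<bullet> u') *\<^sub>R u"
  have uu: "u \<bullet> u = 1" "u' \<bullet> u' = 1" using u u' by (simp_all add: norm_eq_1)
  have yy: "y \<bullet> y = 1 - (u \<bullet> u')\<^sup>2" "u \<bullet> y = 0" "u' \<bullet> y = 1 - (u \<bullet> u')\<^sup>2"
    unfolding y_def using uu by (simp_all add: inner_diff_left inner_diff_right inner_commute power2_eq_square algebra_simps)
  have ny: "(norm y)\<^sup>2 = 1 - (u \<bullet> u')\<^sup>2" by (simp add: power2_norm_eq_inner yy)
  have "((outer u a - outer u' b) *v b) \<bullet> y = - ((b \<bullet> b) * (u' \<bullet> y))"
    by (simp add: matrix_vector_mult_diff_rdistrib outer_mult_vec inner_diff_left yy)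
  then have "(norm b)\<^sup>2 * (norm y)\<^sup>2 = \<bar>((outer u a - outer u' b) *v b) \<bullet> y\<bar>"
    using ny zero_le_power2[of "norm y"] by (simp add: yy power2_norm_eq_inner abs_mult)
  also have "\<dots> \<le> norm ((outer u a - outer u' b) *v b) * norm y" by (rule Cauchy_Schwarz_ineq2)
  also have "\<dots> \<le> (\<eta> * norm b) * norm y"
    by (intro mult_right_mono order_trans[OF norm_matrix_vector_mult] le) auto
  finally have le1: "(norm b * norm y) * (norm b * norm y) \<le> \<eta> * (norm b * norm y)"
    by (simp add: power2_eq_square algebra_simps)
  have le2: "norm y * norm b \<le> \<eta>"
  proof (cases "norm y = 0")
    case True
    then show ?thesis using order_trans[OF norm_ge_zero le] by simp
  next
    case False
    then have "norm b * norm y > 0" using \<open>b \<noteq> 0\<close> by simp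
    from mult_right_le_imp_le[OF le1 this] show ?thesis by (simp add: mult.commute)
  qed
  have "(norm (outer u u - outer u' u'))\<^sup>2 = 2 * (norm y)\<^sup>2"
    unfolding ny power2_norm_eq_inner
    by (simp add: inner_diff_left inner_diff_right inner_outer uu yy inner_commute[of u' u] power2_eq_square)
  also have "\<dots> \<le> (2 * norm y)\<^sup>2" by (simp add: power_mult_distrib)
  finally have "norm (outer u u - outer u' u') \<le> 2 * norm y" by (rule power2_le_imp_le) simp
  then have "norm (outer u u - outer u' u') * norm b \<le> 2 * norm y * norm b" by (rule mult_right_mono) simp
  then show ?thesis using le2 by simp
qed

lemma near_rank1_mult_right_close:
  fixes A B :: "real^'n^'n"
  assumes A: "near_rank1 \<epsilon> A u v" and AB: "near_rank1 \<epsilon>' (A ** B) u' v'"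
    and "A ** B \<noteq> 0" and K: "norm A * norm B \<le> K * norm (A ** B)" and "\<epsilon> \<ge> 0"
  shows "norm (outer u u - outer u' u') \<le> 2 * (\<epsilon> * K + \<epsilon>')"
proof -
  let ?N = "norm (A ** B)"
  have N: "?N > 0" using assms(3) by simp
  define a where "a = norm A *\<^sub>R (transpose B *v v)"
  have oa: "outer u a = (norm A *\<^sub>R outer u v) ** B"
    unfolding a_def by (simp add: outer_scaleR_right matrix_mult.scaleR_left outer_mult)
  have "norm (A ** B - outer u a) = norm ((A - norm A *\<^sub>R outer u v) ** B)"
    unfolding oa by (simp add: matrix_mult.diff_left)
  also have "\<dots> \<le> norm (A - norm A *\<^sub>R outer u v) * norm B" by (rule norm_matrix_mult)
  also have "\<dots> \<le> (\<epsilon> * norm A) * norm B"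
    using A unfolding near_rank1_def by (intro mult_right_mono) auto
  also have "\<dots> \<le> \<epsilon> * (K * ?N)"
    using mult_left_mono[OF K \<open>\<epsilon> \<ge> 0\<close>] by (simp add: mult.assoc)
  finally have 1: "norm (A ** B - outer u a) \<le> \<epsilon> * K * ?N" by simp
  have 2: "norm (A ** B - outer u' (?N *\<^sub>R v')) \<le> \<epsilon>' * ?N"
    using AB unfolding near_rank1_def by (simp add: outer_scaleR_right)
  have "norm (outer u a - outer u' (?N *\<^sub>R v')) \<le> (\<epsilon> * K + \<epsilon>') * ?N"
    using norm_triangle_ineq4[of "A ** B - outer u' (?N *\<^sub>R v')" "A ** B - outer u a"] 1 2
    by (simp add: algebra_simps)
  from outer_directions_close[OF _ _ this]
  have "norm (outer u u - outer u' u') * ?N \<le> 2 * ((\<epsilon> * K + \<epsilon>') * ?N)"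
    using A AB unfolding near_rank1_def by auto
  then show ?thesis using N by (simp add: mult.assoc[symmetric])
qed

lemma norm_mult_le_mult_inverse:
  fixes A B B' :: "real^'n^'n"
  assumes "B ** B' = mat 1" shows "norm A * norm B \<le> norm B' * norm B * norm (A ** B)"
proof -
  have "A = (A ** B) ** B'" using assms by (simp flip: matrix_mul_assoc)
  then have "norm A \<le> norm (A ** B) * norm B'" by (metis norm_matrix_mult)
  then have "norm A * norm B \<le> norm (A ** B) * norm B' * norm B" by (intro mult_right_mono) auto
  then show ?thesis by (simp add: algebra_simps)
qed

lemma matpow_directions_convergent:
  fixes A B :: "real^'n^'n" and u v :: "nat \<Rightarrow> real^'n"
  assumes AB: "A ** B = mat 1" "B ** A = mat 1" and beta: "\<beta> > 0"
    and near: "\<And>k. near_rank1 (C * exp (- \<beta> * k)) (matpow A k) (u k) (v k)"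
  obtains w K where "norm w = 1" "K \<ge> 0"
    "\<And>k. norm (outer (u k) (u k) - outer w w) \<le> K * exp (- \<beta> * k)"
proof -
  define Q where "Q k = outer (u k) (u k)" for k
  have nz: "matpow A k \<noteq> 0" for k using norm_matpow_ge[OF AB(2), of k] by auto
  have C: "C \<ge> 0" using near_rank1_nonneg[OF near[of 0] nz] by simp
  let ?K = "norm B * norm A"
  have "norm (Q (Suc k) - Q k) \<le> (2 * (C * ?K + C)) * exp (- \<beta> * k)" for k
  proof -
    have s: "near_rank1 (C * exp (- \<beta> * Suc k)) (matpow A k ** A) (u (Suc k)) (v (Suc k))"
      using near[of "Suc k"] by (simp add: matpow_Suc2)
    have "norm (Q k - Q (Suc k)) \<le> 2 * ((C * exp (- \<beta> * k)) * ?K + C * exp (- \<beta> * Suc k))"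
      unfolding Q_def using near_rank1_mult_right_close[OF near s] nz[of "Suc k"]
        norm_mult_le_mult_inverse[OF AB(1), of "matpow A k"] C by (simp add: matpow_Suc2)
    also have "\<dots> \<le> 2 * ((C * exp (- \<beta> * k)) * ?K + C * exp (- \<beta> * k))"
      using beta C by (intro mult_left_mono add_left_mono) (auto simp: algebra_simps)
    finally show ?thesis by (simp add: norm_minus_commute algebra_simps)
  qed
  from exponential_steps_convergent[OF beta this] obtain l where l: "Q \<longlonglongrightarrow> l"
    "\<And>k. norm (Q k - l) \<le> 2 * (C * ?K + C) / (1 - exp (- \<beta>)) * exp (- \<beta> * k)" by blast
  have "\<forall>k. u k \<in> sphere 0 1" using near unfolding near_rank1_def by simp
  then obtain w r where w: "w \<in> sphere 0 1" "strict_mono (r :: nat \<Rightarrow> nat)" "(u \<circ> r) \<longlonglongrightarrow> w"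
    using compact_sphere[of "0 :: real^'n" 1] unfolding compact_def by metis
  have "(\<lambda>k. outer ((u \<circ> r) k) ((u \<circ> r) k)) \<longlonglongrightarrow> outer w w"
    by (intro bounded_bilinear.tendsto[OF bounded_bilinear_outer] w)
  moreover have "(\<lambda>k. outer ((u \<circ> r) k) ((u \<circ> r) k)) \<longlonglongrightarrow> l"
    using LIMSEQ_subseq_LIMSEQ[OF l(1) w(2)] unfolding Q_def o_def .
  ultimately have "l = outer w w" using LIMSEQ_unique by blast
  moreover have "2 * (C * ?K + C) / (1 - exp (- \<beta>)) \<ge> 0"
    using C beta by (intro divide_nonneg_nonneg mult_nonneg_nonneg add_nonneg_nonneg) auto
  ultimately show ?thesis using that[of w "2 * (C * ?K + C) / (1 - exp (- \<beta>))"] w(1) l(2) unfolding Q_def by auto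
qed


lemma no_superquadratic_decay:
  fixes x :: "nat \<Rightarrow> real"
  assumes pos: "\<And>k. x k > 0" and lower: "\<And>k. x k \<ge> b ^ k" and b: "b > 0"
    and sq: "\<And>k. x (2 * k) \<le> K * exp (- \<beta> * k) * (x k)\<^sup>2" and beta: "\<beta> > 0"
  shows False
proof -
  define L where "L = \<bar>ln (max K 1)\<bar>"
  define y where "y j = ln (x (2 ^ j)) / 2 ^ j" for j
  have step: "y (Suc j) \<le> y j + L / 2 ^ Suc j - \<beta> / 2" for j
  proof -
    have "x (2 ^ Suc j) \<le> K * exp (- \<beta> * real (2 ^ j)) * (x (2 ^ j))\<^sup>2" using sq[of "2 ^ j"] by simp
    also have "\<dots> \<le> max K 1 * exp (- \<beta> * real (2 ^ j)) * (x (2 ^ j))\<^sup>2"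
      by (intro mult_right_mono) auto
    finally have "ln (x (2 ^ Suc j)) \<le> ln (max K 1 * exp (- \<beta> * real (2 ^ j)) * (x (2 ^ j))\<^sup>2)"
      using pos[of "2 ^ Suc j"] pos[of "2 ^ j"] by (subst ln_le_cancel_iff) (auto intro!: mult_pos_pos)
    also have "\<dots> = ln (max K 1) - \<beta> * 2 ^ j + 2 * ln (x (2 ^ j))"
      using pos[of "2 ^ j"] by (subst ln_mult_pos | simp add: ln_realpow)+
    finally have le: "ln (x (2 ^ Suc j)) \<le> L - \<beta> * 2 ^ j + 2 * ln (x (2 ^ j))"
      unfolding L_def by simp
    have "y (Suc j) \<le> (L - \<beta> * 2 ^ j + 2 * ln (x (2 ^ j))) / 2 ^ Suc j"
      unfolding y_def by (intro divide_right_mono le) simp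
    also have "\<dots> = y j + L / 2 ^ Suc j - \<beta> / 2"
      unfolding y_def by (simp add: field_simps)
    finally show ?thesis .
  qed
  have up: "y j \<le> y 0 + L * (1 - 1 / 2 ^ j) - real j * (\<beta> / 2)" for j
  proof (induction j)
    case (Suc j)
    have "L * (1 - 1 / 2 ^ j) + L / 2 ^ Suc j = L * (1 - 1 / 2 ^ Suc j)" by (simp add: field_simps)
    moreover have "real (Suc j) * (\<beta> / 2) = real j * (\<beta> / 2) + \<beta> / 2" by (simp add: field_simps)
    ultimately show ?case using step[of j] Suc by linarith
  qed simp
  have low: "y j \<ge> ln b" for j
  proof -
    have "ln (b ^ 2 ^ j) \<le> ln (x (2 ^ j))" using pos b lower by (subst ln_le_cancel_iff) auto
    then show ?thesis unfolding y_def using b by (simp add: ln_realpow field_simps)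
  qed
  obtain j :: nat where "real j > (y 0 + L - ln b) / (\<beta> / 2)" using reals_Archimedean2 by blast
  then have "real j * (\<beta> / 2) > y 0 + L - ln b" using beta by (simp add: field_simps)
  moreover have "L * (1 - 1 / 2 ^ j) \<le> L" unfolding L_def by (intro mult_left_le) auto
  ultimately show False using up[of j] low[of j] by linarith
qed

lemma norm_square_near_rank1:
  fixes A :: "real^'n^'n"
  assumes "near_rank1 \<epsilon> A u v"
  shows "norm (A ** A) \<le> (\<bar>u \<bullet> v\<bar> + 2 * \<epsilon>) * (norm A)\<^sup>2"
proof -
  let ?R = "norm A *\<^sub>R outer u v" and ?E = "A - norm A *\<^sub>R outer u v"
  have u: "norm u = 1" "norm v = 1" "norm ?E \<le> \<epsilon> * norm A" using assms by (auto simp: near_rank1_def)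
  have R: "norm ?R = norm A" using u by (simp add: norm_outer)
  have "A ** A = ?R ** ?R + ?R ** ?E + ?E ** A"
    by (simp add: matrix_mult.diff_left matrix_mult.diff_right)
  then have "norm (A ** A) \<le> norm (?R ** ?R) + norm (?R ** ?E) + norm (?E ** A)"
    by (metis (no_types, lifting) add_right_mono norm_triangle_ineq order_trans)
  moreover have "norm (?R ** ?R) = \<bar>u \<bullet> v\<bar> * (norm A)\<^sup>2"
    using u by (simp add: matrix_mult.scaleR_left matrix_mult.scaleR_right outer_mult_outer norm_outer
        inner_commute abs_mult power2_eq_square)
  moreover have "norm (?R ** ?E) \<le> norm A * (\<epsilon> * norm A)"
    using order_trans[OF norm_matrix_mult[of ?R ?E] mult_left_mono[OF u(3) norm_ge_zero[of ?R]]]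
    unfolding R .
  moreover have "norm (?E ** A) \<le> (\<epsilon> * norm A) * norm A"
    using order_trans[OF norm_matrix_mult[of ?E A] mult_right_mono[OF u(3)]] by simp
  ultimately show ?thesis by (simp add: algebra_simps power2_eq_square)
qed

text \<open>An exponential gap of the powers forces the limiting image line not to lie in the limiting kernel:
  otherwise the norms would satisfy \<open>\<parallel>A\<^sup>2\<^sup>k\<parallel> \<le> K e\<^sup>-\<^sup>\<beta>\<^sup>k \<parallel>A\<^sup>k\<parallel>\<^sup>2\<close>.\<close>

lemma exponential_gap_dominant:
  fixes A B :: "real^'n^'n" and u v :: "nat \<Rightarrow> real^'n"
  assumes AB: "A ** B = mat 1" "B ** A = mat 1" and beta: "\<beta> > 0"
    and near: "\<And>k. near_rank1 (C * exp (- \<beta> * k)) (matpow A k) (u k) (v k)"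
  obtains a b r where "norm a = 1" "a \<bullet> b = 1" "r \<noteq> 0"
    "A ** outer a b = r *\<^sub>R outer a b" "outer a b ** A = r *\<^sub>R outer a b"
    "(\<lambda>k. (1 / r ^ k) *\<^sub>R matpow A k) \<longlonglongrightarrow> outer a b"
    "(\<lambda>k. outer (u k) (u k)) \<longlonglongrightarrow> outer a a"
proof -
  obtain a K1 where a: "norm a = 1" "K1 \<ge> 0"
    "\<And>k. norm (outer (u k) (u k) - outer a a) \<le> K1 * exp (- \<beta> * k)"
    using matpow_directions_convergent[OF AB beta near] by blast
  have TAB: "transpose A ** transpose B = mat 1" "transpose B ** transpose A = mat 1"
    using AB by (metis matrix_transpose_mul transpose_mat)+
  have nearT: "near_rank1 (C * exp (- \<beta> * k)) (matpow (transpose A) k) (v k) (u k)" for k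
    using near_rank1_transpose[OF near[of k]] by (simp add: transpose_matpow)
  obtain w K2 where w: "norm w = 1" "K2 \<ge> 0"
    "\<And>k. norm (outer (v k) (v k) - outer w w) \<le> K2 * exp (- \<beta> * k)"
    using matpow_directions_convergent[OF TAB beta nearT] by blast
  have uv: "norm (u k) = 1" "norm (v k) = 1" for k using near unfolding near_rank1_def by auto
  have exp0: "(\<lambda>k. exp (- \<beta> * real k)) \<longlonglongrightarrow> 0"
  proof -
    have "(\<lambda>k. exp (- \<beta>) ^ k) \<longlonglongrightarrow> 0" using beta by (intro LIMSEQ_power_zero) auto
    then show ?thesis by (simp add: exp_of_nat_mult[symmetric] mult.commute)
  qed
  have lim_exp: "X \<longlonglongrightarrow> l" if "\<And>k. norm (X k - l) \<le> K * exp (- \<beta> * k)" for X :: "nat \<Rightarrow> real^'n^'n" and l K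
  proof -
    have "(\<lambda>k. X k - l) \<longlonglongrightarrow> 0"
      by (rule Lim_null_comparison[of _ "\<lambda>k. K * exp (- \<beta> * real k)"])
        (use that exp0 in \<open>auto intro: tendsto_mult_right_zero\<close>)
    then show ?thesis using LIM_zero_iff by blast
  qed
  have limu: "(\<lambda>k. outer (u k) (u k)) \<longlonglongrightarrow> outer a a" and limv: "(\<lambda>k. outer (v k) (v k)) \<longlonglongrightarrow> outer w w"
    by (rule lim_exp[OF a(3)], rule lim_exp[OF w(3)])
  have A0: "matpow A k \<noteq> 0" for k using norm_matpow_ge[OF AB(2), of k] by auto
  have C: "C \<ge> 0" using near_rank1_nonneg[OF near[of 0] A0] by simp
  have aw: "a \<bullet> w \<noteq> 0"
  proof
    assume aw: "a \<bullet> w = 0"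
    define K where "K = sqrt (K1 + K2) + 2 * C"
    have "norm (matpow A (2 * k)) \<le> K * exp (- (\<beta> / 2) * k) * (norm (matpow A k))\<^sup>2" for k
    proof -
      let ?U = "outer (u k) (u k)" and ?V = "outer (v k) (v k)"
      have "(u k \<bullet> v k)\<^sup>2 = (?U - outer a a) \<bullet> ?V + outer a a \<bullet> (?V - outer w w)"
        using aw by (simp add: inner_diff_left inner_diff_right inner_outer power2_eq_square)
      also have "\<dots> \<le> norm (?U - outer a a) * norm ?V + norm (outer a a) * norm (?V - outer w w)"
        by (intro add_mono norm_cauchy_schwarz)
      also have "\<dots> \<le> (K1 + K2) * exp (- \<beta> * k)"
        using a(1) a(3)[of k] w(3)[of k] w(1) uv[of k] by (simp add: norm_outer algebra_simps)
      finally have "\<bar>u k \<bullet> v k\<bar> \<le> sqrt ((K1 + K2) * exp (- \<beta> * k))"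
        by (simp add: real_le_rsqrt)
      also have "\<dots> = sqrt (K1 + K2) * exp (- (\<beta> / 2) * k)"
      proof -
        have "exp (- \<beta> * k) = (exp (- (\<beta> / 2) * k))\<^sup>2" by (simp add: power2_eq_square flip: exp_add)
        then show ?thesis by (simp only: real_sqrt_mult real_sqrt_abs abs_exp_cancel)
      qed
      finally have 1: "\<bar>u k \<bullet> v k\<bar> \<le> sqrt (K1 + K2) * exp (- (\<beta> / 2) * k)" .
      have 2: "C * exp (- \<beta> * k) \<le> C * exp (- (\<beta> / 2) * k)"
        using C beta by (intro mult_left_mono) auto
      have "norm (matpow A (2 * k)) \<le> (\<bar>u k \<bullet> v k\<bar> + 2 * (C * exp (- \<beta> * k))) * (norm (matpow A k))\<^sup>2"
        using norm_square_near_rank1[OF near[of k]] unfolding mult_2[of k] matpow_add .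
      also have "\<dots> \<le> (K * exp (- (\<beta> / 2) * k)) * (norm (matpow A k))\<^sup>2"
        using 1 2 unfolding K_def by (intro mult_right_mono) (auto simp: algebra_simps)
      finally show ?thesis .
    qed
    moreover have "norm B > 0" using AB(2) norm_mat_1_pos[where 'n='n] by auto
    then have "norm (matpow A k) \<ge> (1 / norm B) ^ k" for k
      using norm_matpow_ge[OF AB(2), of k] by (simp add: power_divide divide_simps mult.commute)
    ultimately show False
      using no_superquadratic_decay[of "\<lambda>k. norm (matpow A k)" "1 / norm B" K "\<beta> / 2"] A0 beta \<open>norm B > 0\<close>
      by auto
  qed
  define M where "M k = (1 / norm (matpow A k)) *\<^sub>R matpow A k" for k
  have MM: "norm (M k - outer (u k) (v k)) \<le> C * exp (- \<beta> * k)" for k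
    unfolding M_def by (rule near_rank1_normalized[OF near A0])
  have diff0: "(\<lambda>k. M k - outer (u k) (v k)) \<longlonglongrightarrow> 0"
    by (rule lim_exp[of _ _ C]) (use MM in simp)
  define T where "T k = trace (M k)" for k
  define c where "c k = u k \<bullet> v k" for k
  have Tc: "(\<lambda>k. T k - c k) \<longlonglongrightarrow> 0"
  proof -
    have "(\<lambda>k. trace (M k - outer (u k) (v k))) \<longlonglongrightarrow> trace (0 :: real^'n^'n)"
      using linear_trace linear_conv_bounded_linear bounded_linear.tendsto diff0 by blast
    then show ?thesis unfolding T_def c_def by (simp add: linear_diff[OF linear_trace] trace_outer linear_0[OF linear_trace])
  qed
  have c1: "\<bar>c k\<bar> \<le> 1" for k using Cauchy_Schwarz_ineq2[of "u k" "v k"] uv by (simp add: c_def)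
  have M1: "norm (M k) = 1" for k using A0 unfolding M_def by simp
  define t where "t = a \<bullet> w"
  have lim1: "(\<lambda>k. c k *\<^sub>R outer (u k) (v k)) \<longlonglongrightarrow> t *\<^sub>R outer a w"
    using matrix_mult.tendsto[OF limu limv] unfolding c_def t_def outer_mult_outer .
  have lim2: "(\<lambda>k. (T k - c k) *\<^sub>R M k) \<longlonglongrightarrow> 0"
    by (rule Lim_null_comparison[of _ "\<lambda>k. \<bar>T k - c k\<bar>"]) (use M1 tendsto_rabs_zero[OF Tc] in auto)
  have lim3: "(\<lambda>k. c k *\<^sub>R (M k - outer (u k) (v k))) \<longlonglongrightarrow> 0"
    by (rule Lim_null_comparison[of _ "\<lambda>k. norm (M k - outer (u k) (v k))"])
      (use c1 tendsto_norm_zero[OF diff0] in \<open>auto intro!: always_eventually mult_left_le_one_le\<close>)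
  have "(\<lambda>k. (T k - c k) *\<^sub>R M k + (c k *\<^sub>R (M k - outer (u k) (v k)) + c k *\<^sub>R outer (u k) (v k)))
      \<longlonglongrightarrow> 0 + (0 + t *\<^sub>R outer a w)"
    by (intro tendsto_add lim1 lim2 lim3)
  moreover have "(T k - c k) *\<^sub>R M k + (c k *\<^sub>R (M k - outer (u k) (v k)) + c k *\<^sub>R outer (u k) (v k)) = T k *\<^sub>R M k" for k
    by (simp add: algebra_simps)
  ultimately have lim4: "(\<lambda>k. T k *\<^sub>R M k) \<longlonglongrightarrow> t *\<^sub>R outer a w" by simp
  have "(\<lambda>k. trace (T k *\<^sub>R M k)) \<longlonglongrightarrow> trace (t *\<^sub>R outer a w)"
    using linear_trace linear_conv_bounded_linear bounded_linear.tendsto lim4 by blast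
  then have limT: "(\<lambda>k. T k * T k) \<longlonglongrightarrow> t * t"
    unfolding linear_scale[OF linear_trace] trace_outer T_def[symmetric] t_def[symmetric] by simp
  define b where "b = (1 / t) *\<^sub>R w"
  define s where "s k = 1 / (T k * T k) * T k * (1 / norm (matpow A k))" for k
  have t: "t \<noteq> 0" using aw by (simp add: t_def)
  have ab: "a \<bullet> b = 1" using t unfolding b_def t_def by simp
  define P where "P = outer a b"
  have "(\<lambda>k. (1 / (T k * T k)) *\<^sub>R (T k *\<^sub>R M k)) \<longlonglongrightarrow> (1 / (t * t)) *\<^sub>R (t *\<^sub>R outer a w)"
    using t by (intro tendsto_scaleR tendsto_divide tendsto_const limT lim4) auto
  then have limP: "(\<lambda>k. s k *\<^sub>R matpow A k) \<longlonglongrightarrow> P"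
    using t unfolding s_def M_def P_def b_def by (simp add: outer_scaleR_right mult.assoc)
  have limAP: "(\<lambda>k. A ** (s k *\<^sub>R matpow A k)) \<longlonglongrightarrow> A ** P"
    and limPA: "(\<lambda>k. (s k *\<^sub>R matpow A k) ** A) \<longlonglongrightarrow> P ** A"
    by (intro matrix_mult.tendsto tendsto_const limP)+
  have "A ** (s k *\<^sub>R matpow A k) = (s k *\<^sub>R matpow A k) ** A" for k
    by (simp add: matrix_mult.scaleR_left matrix_mult.scaleR_right flip: matpow_Suc matpow_Suc2)
  with limPA have "(\<lambda>k. A ** (s k *\<^sub>R matpow A k)) \<longlonglongrightarrow> P ** A" by (simp only:)
  with limAP have comm: "A ** P = P ** A" by (rule LIMSEQ_unique)
  define r where "r = (transpose A *v b) \<bullet> a"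
  have "outer (A *v a) b *v a = outer a (transpose A *v b) *v a"
    using comm unfolding P_def mult_outer outer_mult by simp
  then have Aa: "A *v a = r *\<^sub>R a" unfolding outer_mult_vec r_def using ab by (simp add: inner_commute)
  then have AP: "A ** P = r *\<^sub>R P" unfolding P_def mult_outer by (simp add: outer_scaleR_left)
  have "r \<noteq> 0"
  proof
    assume "r = 0"
    then have "B *v (A *v a) = 0" using Aa by simp
    then have "a = 0" by (simp add: matrix_vector_mul_assoc AB)
    then show False using a by simp
  qed
  have PP: "P ** P = P" unfolding P_def outer_mult_outer using ab by (simp add: inner_commute)
  have P0: "P \<bullet> P \<noteq> 0" using ab unfolding P_def by (auto simp: inner_outer)
  have AkP: "matpow A k ** P = r ^ k *\<^sub>R P" for k
  proof (induction k)
    case (Suc k)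
    then show ?case
      by (simp add: matpow_Suc matrix_mult.scaleR_right AP flip: matrix_mul_assoc)
  qed simp
  have "(\<lambda>k. ((s k *\<^sub>R matpow A k) ** P) \<bullet> P) \<longlonglongrightarrow> (P ** P) \<bullet> P"
    by (intro tendsto_inner matrix_mult.tendsto tendsto_const limP)
  then have "(\<lambda>k. (s k * r ^ k) * (P \<bullet> P)) \<longlonglongrightarrow> P \<bullet> P"
    by (simp add: matrix_mult.scaleR_left AkP PP mult.assoc)
  from tendsto_divide[OF this tendsto_const[of "P \<bullet> P"] P0]
  have lim5: "(\<lambda>k. s k * r ^ k) \<longlonglongrightarrow> 1" using P0 by simp
  have "(\<lambda>k. inverse (s k * r ^ k) *\<^sub>R (s k *\<^sub>R matpow A k)) \<longlonglongrightarrow> inverse 1 *\<^sub>R P"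
    by (intro tendsto_scaleR tendsto_inverse lim5 limP) simp
  moreover have "\<forall>\<^sub>F k in sequentially. inverse (s k * r ^ k) *\<^sub>R (s k *\<^sub>R matpow A k) = (1 / r ^ k) *\<^sub>R matpow A k"
    using order_tendstoD(1)[OF lim5, of 0, simplified]
  proof eventually_elim
    case (elim k)
    then have "s k \<noteq> 0" by auto
    then show ?case by (simp add: field_simps)
  qed
  ultimately have lim6: "(\<lambda>k. (1 / r ^ k) *\<^sub>R matpow A k) \<longlonglongrightarrow> P"
    using Lim_transform_eventually by fastforce
  show ?thesis
    using that[OF a(1) ab \<open>r \<noteq> 0\<close> _ _ _ limu] AP comm lim6 unfolding P_def by simp
qed

section \<open>Characteristic polynomials and proximality\<close>

abbreviation cmatrix :: "real^'n^'n \<Rightarrow> complex^'n^'n" where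
  "cmatrix \<equiv> map_matrix complex_of_real"

definition char_matrix :: "'a::comm_ring_1^'n^'n \<Rightarrow> 'a poly^'n^'n" where
  "char_matrix M = (\<chi> i j. if i = j then [:- M $ i $ j, 1:] else [:- M $ i $ j:])"

lemma poly_det_char_matrix: "poly (det (char_matrix M)) z = det (mat z - M)"
proof -
  have "poly (char_matrix M $ i $ j) z = (mat z - M) $ i $ j" for i j
    by (simp add: char_matrix_def mat_def)
  then show ?thesis unfolding det_def poly_sum by (simp add: poly_prod)
qed

lemma char_matrix_term:
  fixes M :: "'a::idom^'n^'n"
  assumes p: "p permutes (UNIV :: 'n set)"
  shows "degree (\<Prod>i\<in>UNIV. char_matrix M $ i $ p i) \<le> CARD('n)"
    and "coeff (\<Prod>i\<in>UNIV. char_matrix M $ i $ p i) CARD('n) = (if p = id then 1 else 0)"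
proof -
  have le1: "degree (char_matrix M $ i $ p i) \<le> 1" for i by (simp add: char_matrix_def)
  have d: "degree (\<Prod>i\<in>UNIV. char_matrix M $ i $ p i) \<le> (\<Sum>i\<in>UNIV. degree (char_matrix M $ i $ p i))"
    using degree_prod_sum_le[of UNIV "\<lambda>i. char_matrix M $ i $ p i"] by (simp add: o_def)
  also have "\<dots> \<le> (\<Sum>i\<in>(UNIV::'n set). 1)" by (intro sum_mono le1)
  finally show "degree (\<Prod>i\<in>UNIV. char_matrix M $ i $ p i) \<le> CARD('n)" by simp
  show "coeff (\<Prod>i\<in>UNIV. char_matrix M $ i $ p i) CARD('n) = (if p = id then 1 else 0)"
  proof (cases "p = id")
    case True
    have "degree (\<Prod>i\<in>UNIV. char_matrix M $ i $ p i) = (\<Sum>i\<in>(UNIV::'n set). 1)"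
      unfolding True by (subst degree_prod_eq_sum_degree) (auto simp: char_matrix_def)
    then have "coeff (\<Prod>i\<in>UNIV. char_matrix M $ i $ p i) CARD('n) = lead_coeff (\<Prod>i\<in>UNIV. char_matrix M $ i $ p i)"
      by simp
    also have "\<dots> = 1" unfolding True lead_coeff_prod by (simp add: char_matrix_def)
    finally show ?thesis using True by simp
  next
    case False
    then obtain i where "p i \<noteq> i" by (auto simp: fun_eq_iff)
    then have "degree (char_matrix M $ i $ p i) = 0" by (simp add: char_matrix_def)
    then have "(\<Sum>i\<in>UNIV. degree (char_matrix M $ i $ p i)) < (\<Sum>i\<in>(UNIV::'n set). 1)"
      using le1 by (intro sum_strict_mono_ex1) (auto intro!: exI[of _ i])
    then show ?thesis using d False by (intro trans[OF coeff_eq_0]) auto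
  qed
qed

lemma monic_det_char_matrix:
  fixes M :: "'a::idom^'n^'n"
  shows "lead_coeff (det (char_matrix M)) = 1"
proof -
  have id: "id permutes (UNIV :: 'n set)" by (rule permutes_id)
  have fin: "finite {p. p permutes (UNIV :: 'n set)}" by (rule finite_permutations) simp
  have "coeff (det (char_matrix M)) CARD('n) =
      (\<Sum>p\<in>{p. p permutes (UNIV :: 'n set)}. of_int (sign p) * coeff (\<Prod>i\<in>UNIV. char_matrix M $ i $ p i) CARD('n))"
    unfolding det_def coeff_sum by (simp add: of_int_poly)
  also have "\<dots> = (\<Sum>p\<in>{p. p permutes (UNIV :: 'n set)}. if p = id then 1 else 0)"
    using char_matrix_term(2)[of _ M] by (intro sum.cong) (auto simp: sign_id)
  also have "\<dots> = 1" using id fin by simp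
  finally have c: "coeff (det (char_matrix M)) CARD('n) = 1" .
  have "degree (det (char_matrix M)) \<le> CARD('n)"
    unfolding det_def
  proof (rule degree_sum_le[OF fin])
    fix p assume "p \<in> {p. p permutes (UNIV :: 'n set)}"
    then have "degree (\<Prod>i\<in>UNIV. char_matrix M $ i $ p i) \<le> CARD('n)" using char_matrix_term(1) by blast
    then show "degree (of_int (sign p) * (\<Prod>i\<in>UNIV. char_matrix M $ i $ p i)) \<le> CARD('n)"
      using degree_mult_le[of "of_int (sign p)" "\<Prod>i\<in>UNIV. char_matrix M $ i $ p i"] by simp
  qed
  moreover have "CARD('n) \<le> degree (det (char_matrix M))" using c by (intro le_degree) simp
  ultimately show ?thesis using c by simp
qed

lemma poly_prod_linear: "poly (\<Prod>x\<in>#E. [:- x, 1:]) z = (\<Prod>x\<in>#E. z - x)" for z :: "'a::idom"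
  by (induction E) (auto simp: algebra_simps)

lemma proots_prod_linear: "proots (\<Prod>x\<in>#E. [:- x, 1:]) = E" for E :: "'a::idom multiset"
proof (induction E)
  case (add x E)
  have "(\<Prod>x\<in>#E. [:- x, 1:]) \<noteq> 0" by (auto simp: prod_mset_zero_iff)
  then show ?case using add by (simp add: proots_mult del: mult_pCons_left)
qed simp

lemma det_cmatrix: "det (cmatrix A) = of_real (det A)"
  unfolding det_def by (simp add: of_real_sum of_real_prod)

lemma linear_factors_unique:
  fixes E F :: "'a::{idom,ring_char_0} multiset"
  assumes "infinite Z" "\<And>z. z \<in> Z \<Longrightarrow> (\<Prod>x\<in>#E. z - x) = (\<Prod>x\<in>#F. z - x)"
  shows "E = F"
proof -
  let ?p = "(\<Prod>x\<in>#E. [:- x, 1:]) - (\<Prod>x\<in>#F. [:- x, 1:])"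
  have "Z \<subseteq> {z. poly ?p z = 0}" using assms(2) by (auto simp: poly_prod_linear)
  then have "?p = 0" using assms(1) poly_roots_finite finite_subset by blast
  then have "(\<Prod>x\<in>#E. [:- x, 1:]) = (\<Prod>x\<in>#F. [:- x, 1:])" by simp
  then show ?thesis by (metis proots_prod_linear)
qed

lemma eigenvalues_eqI:
  assumes "\<And>z. det (mat z - cmatrix A) = (\<Prod>e\<in>#E. z - e)"
  shows "eigenvalues A = E"
  unfolding eigenvalues_def
proof (rule the_equality)
  fix F assume "\<forall>z. det (mat z - cmatrix A) = (\<Prod>e\<in>#F. z - e)"
  then show "F = E" using assms by (intro linear_factors_unique[of UNIV]) (auto simp: infinite_UNIV_char_0)
qed (use assms in auto)

lemma det_eigenvalues: "det (mat z - cmatrix A) = (\<Prod>e\<in>#eigenvalues A. z - e)"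
proof -
  let ?p = "det (char_matrix (cmatrix A))"
  have "?p \<noteq> 0" using monic_det_char_matrix[of "cmatrix A"] by auto
  from alg_closed_imp_factorization[OF this] obtain E
    where "?p = (\<Prod>x\<in>#E. [:- x, 1:])" using monic_det_char_matrix[of "cmatrix A"] by auto
  then have E: "det (mat z - cmatrix A) = (\<Prod>e\<in>#E. z - e)" for z
    by (metis poly_det_char_matrix poly_prod_linear)
  show ?thesis unfolding eigenvalues_eqI[OF E] by (rule E)
qed

lemma eigenvector_of_eigenvalue:
  assumes "\<mu> \<in># eigenvalues A"
  obtains x where "x \<noteq> 0" "cmatrix A *v x = \<mu> *s x"
proof -
  have "det (mat \<mu> - cmatrix A) = 0" unfolding det_eigenvalues using assms
    by (metis cancel_comm_monoid_add_class.diff_cancel image_eqI prod_mset_zero_iff set_image_mset)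
  then have "\<not> (\<exists>B. B ** (mat \<mu> - cmatrix A) = mat 1)"
    using invertible_det_nz invertible_left_inverse by metis
  then obtain x where x: "x \<noteq> 0" "(mat \<mu> - cmatrix A) *v x = 0" using matrix_left_invertible_ker by blast
  have "mat \<mu> *v x = \<mu> *s x"
    by (simp add: vec_eq_iff matrix_vector_mult_def mat_def if_distrib[of "\<lambda>t. t * _"] cong: if_cong)
  then have "cmatrix A *v x = \<mu> *s x" using x(2) by (simp add: matrix_vector_mult_diff_rdistrib)
  then show ?thesis using that x(1) by blast
qed

lemma det_mat1_plus_outer:
  fixes a b :: "real^'n"
  shows "det (mat 1 + outer a b) = 1 + a \<bullet> b"
proof (cases "b = 0")
  case True
  then have "outer a b = 0" by (simp add: vec_eq_iff)
  then show ?thesis using True by simp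
next
  case False
  define k :: 'n where "k = undefined"
  have "norm ((1 / norm b) *\<^sub>R b) = 1" using False by simp
  then obtain Q :: "real^'n^'n" where Q: "orthogonal_matrix Q" "Q *v axis k 1 = (1 / norm b) *\<^sub>R b"
    using orthogonal_matrix_exists_basis by metis
  then have QQ: "transpose Q ** Q = mat 1" by (simp add: orthogonal_matrix)
  define a' where "a' = transpose Q *v a"
  have "transpose Q *v b = norm b *\<^sub>R (transpose Q *v (Q *v axis k 1))"
    using False by (simp add: Q(2) matrix_vector_mult_scaleR)
  then have b: "transpose Q *v b = norm b *\<^sub>R axis k 1" by (simp add: matrix_vector_mul_assoc QQ)
  let ?x = "axis k 1 + norm b *\<^sub>R a'"
  have e1: "transpose Q ** (mat 1 + outer a b) ** Q = mat 1 + outer a' (norm b *\<^sub>R axis k 1)"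
    by (simp add: matrix_mult.add_left matrix_mult.add_right QQ mult_outer outer_mult a'_def b
        del: transpose_matrix_vector)
  have e2: "mat 1 + outer a' (norm b *\<^sub>R axis k 1) = (\<chi> i j. if j = k then (mat 1 *v ?x) $ i else mat 1 $ i $ j)"
    unfolding matrix_vector_mul_lid by (auto simp: vec_eq_iff mat_def axis_def)
  have "det (mat 1 + outer a b) = det (transpose Q ** Q) * det (mat 1 + outer a b)" by (simp only: QQ det_I mult_1)
  also have "\<dots> = det (transpose Q ** (mat 1 + outer a b) ** Q)"
    by (simp only: det_mul mult.commute mult.left_commute)
  also have "\<dots> = ?x $ k * det (mat 1 :: real^'n^'n)" unfolding e1 e2 by (rule cramer_lemma)
  also have "\<dots> = 1 + a' \<bullet> (norm b *\<^sub>R axis k 1)" by (simp add: inner_axis)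
  also have "a' \<bullet> (norm b *\<^sub>R axis k 1) = a \<bullet> (Q *v (norm b *\<^sub>R axis k 1))"
    unfolding a'_def by (metis dot_lmul_matrix transpose_matrix_vector)
  also have "Q *v (norm b *\<^sub>R axis k 1) = b" using False by (simp add: matrix_vector_mult_scaleR Q(2))
  finally show ?thesis .
qed

lemma eigenvalues_deflation:
  fixes A :: "real^'n^'n"
  assumes ab: "a \<bullet> b = 1" and AP: "A ** outer a b = r *\<^sub>R outer a b"
  shows "add_mset (of_real r) (eigenvalues (A - r *\<^sub>R outer a b)) = add_mset 0 (eigenvalues A)"
proof (rule linear_factors_unique)
  let ?P = "outer a b" and ?B = "A - r *\<^sub>R outer a b"
  have "infinite (UNIV - {r})" by (simp add: infinite_UNIV_char_0)
  then show "infinite (complex_of_real ` (UNIV - {r}))" by (subst finite_image_iff) (auto simp: inj_on_def)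
  fix z assume "z \<in> complex_of_real ` (UNIV - {r})"
  then obtain x where x: "z = of_real x" "x \<noteq> r" by auto
  have mx: "mat x = x *\<^sub>R (mat 1 :: real^'n^'n)" by (simp add: vec_eq_iff mat_def)
  have "mat x - ?B = (mat x - A) ** (mat 1 + outer ((r / (x - r)) *\<^sub>R a) b)"
  proof -
    have "(mat x - A) ** outer ((r / (x - r)) *\<^sub>R a) b = (r / (x - r)) *\<^sub>R ((x - r) *\<^sub>R ?P)"
      by (simp add: outer_scaleR_left matrix_mult.scaleR_right matrix_mult.diff_left AP mx
          matrix_mult.scaleR_left scaleR_diff_left)
    then show ?thesis using x by (simp add: matrix_mult.add_right)
  qed
  then have "det (mat x - ?B) = det (mat x - A) * (1 + r / (x - r))"
    by (simp add: det_mul det_mat1_plus_outer ab)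
  then have e: "(x - r) * det (mat x - ?B) = x * det (mat x - A)" using x by (simp add: field_simps)
  have c: "det (mat z - cmatrix M) = of_real (det (mat x - M))" for M :: "real^'n^'n"
  proof -
    have "mat z - cmatrix M = cmatrix (mat x - M)" using x by (simp add: vec_eq_iff mat_def)
    then show ?thesis by (simp add: det_cmatrix)
  qed
  have "(z - of_real r) * det (mat z - cmatrix ?B) = z * det (mat z - cmatrix A)"
    unfolding c using arg_cong[OF e, of complex_of_real] x by simp
  then show "(\<Prod>x\<in>#add_mset (of_real r) (eigenvalues ?B). z - x) = (\<Prod>x\<in>#add_mset 0 (eigenvalues A). z - x)"
    by (simp add: det_eigenvalues)
qed

lemma cmatrix_matpow_eigenvector:
  fixes A :: "real^'n^'n"
  assumes "cmatrix A *v x = \<mu> *s x"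
  shows "cmatrix (matpow A k) *v x = \<mu> ^ k *s x"
proof (induction k)
  case 0
  have "cmatrix (mat 1 :: real^'n^'n) = mat 1" by (simp add: vec_eq_iff mat_def)
  then show ?case by simp
next
  case (Suc k)
  have "cmatrix (matpow A (Suc k)) = cmatrix A ** cmatrix (matpow A k)"
    by (simp add: vec_eq_iff matpow_Suc matrix_matrix_mult_def)
  then show ?case using Suc assms
    by (simp add: matrix_vector_mul_assoc[symmetric] vector_scalar_commute vector_smult_assoc mult.commute)
qed

lemma attractive_fixed_line_of_power_limit:
  fixes A :: "real^'n^'n"
  assumes ab: "a \<bullet> b = 1" and r: "r \<noteq> 0"
    and AP: "A ** outer a b = r *\<^sub>R outer a b" and PA: "outer a b ** A = r *\<^sub>R outer a b"
    and lim: "(\<lambda>k. (1 / r ^ k) *\<^sub>R matpow A k) \<longlonglongrightarrow> outer a b"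
  shows "attractive_fixed_line A (span {a})"
proof -
  let ?P = "outer a b"
  define B where "B = A - r *\<^sub>R ?P"
  have PP: "?P ** ?P = ?P" using ab by (simp add: outer_mult_outer inner_commute)
  have AkP: "matpow A k ** ?P = r ^ k *\<^sub>R ?P" for k
  proof (induction k)
    case (Suc k)
    then show ?case by (simp add: matpow_Suc matrix_mult.scaleR_right AP flip: matrix_mul_assoc)
  qed simp
  have Bk: "matpow B (Suc k) = matpow A (Suc k) - r ^ Suc k *\<^sub>R ?P" for k
  proof (induction k)
    case (Suc k)
    have "matpow B (Suc (Suc k)) = (matpow A (Suc k) - r ^ Suc k *\<^sub>R ?P) ** (A - r *\<^sub>R ?P)"
      unfolding matpow_Suc2[of B "Suc k"] Suc by (simp add: B_def)
    also have "\<dots> = matpow A (Suc k) ** A - r *\<^sub>R (matpow A (Suc k) ** ?P) - r ^ Suc k *\<^sub>R (?P ** A)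
        + (r ^ Suc k * r) *\<^sub>R (?P ** ?P)"
      by (simp add: matrix_mult.diff_left matrix_mult.diff_right matrix_mult.scaleR_left
          matrix_mult.scaleR_right algebra_simps)
    also have "\<dots> = matpow A (Suc (Suc k)) - r ^ Suc (Suc k) *\<^sub>R ?P"
      unfolding AkP PA PP by (simp add: matpow_Suc2[of A "Suc k"] algebra_simps)
    finally show ?case .
  qed (simp add: B_def)
  have Blim: "(\<lambda>k. (1 / r ^ Suc k) *\<^sub>R matpow B (Suc k)) \<longlonglongrightarrow> 0"
  proof -
    have "(\<lambda>k. (1 / r ^ Suc k) *\<^sub>R matpow A (Suc k) - ?P) \<longlonglongrightarrow> 0"
      using LIMSEQ_Suc[OF lim] LIM_zero by blast
    then show ?thesis using r by (simp add: Bk scaleR_diff_right)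
  qed
  have small: "cmod \<mu> < \<bar>r\<bar>" if mu: "\<mu> \<in># eigenvalues B" for \<mu>
  proof (rule ccontr)
    assume ge: "\<not> cmod \<mu> < \<bar>r\<bar>"
    obtain x where x: "x \<noteq> 0" "cmatrix B *v x = \<mu> *s x" using eigenvector_of_eigenvalue[OF mu] by blast
    then obtain i where i: "x $ i \<noteq> 0" by (auto simp: vec_eq_iff)
    have "(\<lambda>k. \<Sum>j\<in>UNIV. complex_of_real (((1 / r ^ Suc k) *\<^sub>R matpow B (Suc k)) $ i $ j) * x $ j)
        \<longlonglongrightarrow> (\<Sum>j\<in>UNIV. complex_of_real ((0 :: real^'n^'n) $ i $ j) * x $ j)"
      by (intro tendsto_sum tendsto_mult tendsto_of_real tendsto_vec_nth Blim tendsto_const)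
    moreover have "(\<Sum>j\<in>UNIV. complex_of_real (((1 / r ^ Suc k) *\<^sub>R matpow B (Suc k)) $ i $ j) * x $ j) =
        (\<mu> / r) ^ Suc k * x $ i" for k
    proof -
      have "(\<Sum>j\<in>UNIV. complex_of_real (((1 / r ^ Suc k) *\<^sub>R matpow B (Suc k)) $ i $ j) * x $ j) =
          of_real (1 / r ^ Suc k) * ((cmatrix (matpow B (Suc k)) *v x) $ i)"
        by (simp add: matrix_vector_mult_def sum_distrib_left mult.assoc)
      then show ?thesis by (simp add: cmatrix_matpow_eigenvector[OF x(2)] power_divide)
    qed
    ultimately have "(\<lambda>k. (\<mu> / r) ^ Suc k * x $ i) \<longlonglongrightarrow> 0" by simp
    then have "(\<lambda>k. norm ((\<mu> / r) ^ Suc k * x $ i)) \<longlonglongrightarrow> 0" by (rule tendsto_norm_zero)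
    then have "\<forall>\<^sub>F k in sequentially. norm ((\<mu> / r) ^ Suc k * x $ i) < norm (x $ i)"
      using i by (intro order_tendstoD) auto
    then obtain k where k: "norm ((\<mu> / r) ^ Suc k * x $ i) < norm (x $ i)"
      using eventually_happens'[OF sequentially_bot] by blast
    have "norm (\<mu> / of_real r) \<ge> 1" using ge r by (simp add: norm_divide)
    then have "norm ((\<mu> / r) ^ Suc k) \<ge> 1" unfolding norm_power by (rule one_le_power)
    then have "norm (x $ i) \<le> norm ((\<mu> / r) ^ Suc k) * norm (x $ i)" by (simp add: mult_left_mono mult_le_cancel_right1)
    then show False using k unfolding norm_mult by linarith
  qed
  have defl: "add_mset (of_real r) (eigenvalues B) = add_mset 0 (eigenvalues A)"
    unfolding B_def by (rule eigenvalues_deflation[OF ab AP])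
  then obtain E where E: "eigenvalues B = add_mset 0 E" "eigenvalues A = add_mset (of_real r) E"
    using r by (auto simp: add_eq_conv_ex)
  have "A *v (c *\<^sub>R a) = r *\<^sub>R (c *\<^sub>R a)" for c
  proof -
    have "(A ** ?P) *v a = r *\<^sub>R (?P *v a)" unfolding AP by (simp add: scaleR_matrix_vector_assoc)
    then show ?thesis using ab
      by (simp add: outer_mult_vec inner_commute matrix_vector_mult_scaleR flip: matrix_vector_mul_assoc)
  qed
  moreover have "v \<in> span {a}" if v: "A *v v = r *\<^sub>R v" for v
  proof -
    have "matpow A k *v v = r ^ k *\<^sub>R v" for k
      by (induction k) (simp_all add: matpow_Suc v matrix_vector_mult_scaleR flip: matrix_vector_mul_assoc)
    then have "((1 / r ^ k) *\<^sub>R matpow A k) *v v = v" for k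
      using r by (simp add: scaleR_matrix_vector_assoc[symmetric])
    moreover have "(\<lambda>k. ((1 / r ^ k) *\<^sub>R matpow A k) *v v) \<longlonglongrightarrow> ?P *v v"
    proof -
      have "bounded_linear (\<lambda>M :: real^'n^'n. M *v v)"
        by (intro bounded_linearI'[where 'b = "real^'n"] matrix_vector_mult_add_rdistrib) (simp add: scaleR_matrix_vector_assoc)
      from bounded_linear.tendsto[OF this lim] show ?thesis .
    qed
    ultimately have "(\<lambda>k::nat. v) \<longlonglongrightarrow> ?P *v v" by simp
    then have "v = ?P *v v" by (simp only: LIMSEQ_const_iff)
    then have "v = (b \<bullet> v) *\<^sub>R a" by (simp only: outer_mult_vec)
    then show ?thesis unfolding span_singleton by blast
  qed
  ultimately have "span {a} = {v. A *v v = r *\<^sub>R v}" unfolding span_singleton by blast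
  then show ?thesis unfolding attractive_fixed_line_def using E small
    by (intro exI[of _ r] exI[of _ E]) auto
qed

section \<open>Singular values\<close>

locale inner_product_space =
  fixes ip :: "real^'n \<Rightarrow> real^'n \<Rightarrow> real"
  assumes ip: "inner_product ip"
begin

lemma ip_bilinear: "bilinear ip" and ip_sym: "ip x y = ip y x" and ip_pos: "x \<noteq> 0 \<Longrightarrow> ip x x > 0"
  using ip unfolding inner_product_def by auto

lemmas ip_add_left = bilinear_ladd[OF ip_bilinear]
  and ip_add_right = bilinear_radd[OF ip_bilinear]
  and ip_diff_left = bilinear_lsub[OF ip_bilinear]
  and ip_diff_right = bilinear_rsub[OF ip_bilinear]
  and ip_scale_left = bilinear_lmul[OF ip_bilinear, unfolded real_scaleR_def]
  and ip_scale_right = bilinear_rmul[OF ip_bilinear, unfolded real_scaleR_def]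
  and ip_zero_left = bilinear_lzero[OF ip_bilinear]
  and ip_zero_right = bilinear_rzero[OF ip_bilinear]

lemma ip_sum_right: "ip x (\<Sum>i\<in>I. f i) = (\<Sum>i\<in>I. ip x (f i))"
proof -
  have "linear (ip x)" using ip_bilinear unfolding bilinear_def by blast
  then show ?thesis by (rule linear_sum)
qed

lemma ip_sum_left: "ip (\<Sum>i\<in>I. f i) x = (\<Sum>i\<in>I. ip (f i) x)"
proof -
  have "linear (\<lambda>y. ip y x)" using ip_bilinear unfolding bilinear_def by blast
  then show ?thesis by (rule linear_sum)
qed

lemma ip_eq_0_iff: "ip x x = 0 \<longleftrightarrow> x = 0"
  using ip_pos[of x] by (cases "x = 0") (auto simp: ip_zero_left)

lemma continuous_ip [continuous_intros]:
  "continuous_on S f \<Longrightarrow> continuous_on S g \<Longrightarrow> continuous_on S (\<lambda>x. ip (f x) (g x))"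
  by (rule bounded_bilinear.continuous_on[OF ip_bilinear[unfolded bilinear_conv_bounded_bilinear]])

lemma ip_norm_equiv:
  obtains c C where "c > 0" "C > 0" "\<And>x. c * (norm x)\<^sup>2 \<le> ip x x" "\<And>x. ip x x \<le> C * (norm x)\<^sup>2"
proof -
  let ?S = "sphere (0 :: real^'n) 1"
  have ne: "?S \<noteq> {}" by simp
  have cont: "continuous_on ?S (\<lambda>x. ip x x)" by (intro continuous_intros)
  obtain a where a: "a \<in> ?S" "\<And>x. x \<in> ?S \<Longrightarrow> ip a a \<le> ip x x"
    using continuous_attains_inf[OF compact_sphere ne cont] by blast
  obtain b where b: "b \<in> ?S" "\<And>x. x \<in> ?S \<Longrightarrow> ip x x \<le> ip b b"
    using continuous_attains_sup[OF compact_sphere ne cont] by blast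
  have scale: "ip x x = (norm x)\<^sup>2 * ip ((1 / norm x) *\<^sub>R x) ((1 / norm x) *\<^sub>R x)" if "x \<noteq> 0" for x
    using that by (simp add: ip_scale_left ip_scale_right power2_eq_square)
  have S: "(1 / norm x) *\<^sub>R x \<in> ?S" if "x \<noteq> 0" for x using that by simp
  have "ip a a * (norm x)\<^sup>2 \<le> ip x x" "ip x x \<le> ip b b * (norm x)\<^sup>2" for x
  proof -
    show "ip a a * (norm x)\<^sup>2 \<le> ip x x"
    proof (cases "x = 0")
      case False
      then show ?thesis using a(2)[OF S[OF False]] scale[OF False]
        by (metis mult.commute mult_left_mono zero_le_power2)
    qed (simp add: ip_zero_left)
    show "ip x x \<le> ip b b * (norm x)\<^sup>2"
    proof (cases "x = 0")
      case False
      then show ?thesis using b(2)[OF S[OF False]] scale[OF False]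
        by (metis mult.commute mult_left_mono zero_le_power2)
    qed (simp add: ip_zero_left)
  qed
  moreover have "ip a a > 0" "ip b b > 0" using a(1) b(1) by (auto intro!: ip_pos)
  ultimately show ?thesis using that by blast
qed

lemma eigenvector_in_subspace:
  assumes M: "\<And>x y. ip (M *v x) y = ip x (M *v y)"
    and S: "subspace S" "\<And>x. x \<in> S \<Longrightarrow> M *v x \<in> S" "S \<noteq> {0}"
  obtains x \<mu> where "x \<in> S" "ip x x = 1" "M *v x = \<mu> *\<^sub>R x"
proof -
  let ?f = "\<lambda>x. ip (M *v x) x / ip x x"
  let ?K = "S \<inter> sphere 0 1"
  have comp: "compact ?K" using closed_subspace[OF S(1)] by (intro closed_Int_compact compact_sphere)
  obtain s where s: "s \<in> S" "s \<noteq> 0" using S subspace_0 by blast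
  then have "(1 / norm s) *\<^sub>R s \<in> ?K" using S(1) by (simp add: subspace_scale)
  then have ne: "?K \<noteq> {}" by blast
  have "continuous_on ?K ?f"
    by (intro continuous_intros linear_continuous_on matrix_vector_mul_bounded_linear)
      (auto simp: ip_eq_0_iff)
  from continuous_attains_sup[OF comp ne this]
  obtain x0 where x0: "x0 \<in> ?K" "\<And>y. y \<in> ?K \<Longrightarrow> ?f y \<le> ?f x0" by blast
  define l where "l = ?f x0"
  have x0S: "x0 \<in> S" "x0 \<noteq> 0" using x0 by auto
  have le: "ip (M *v y) y \<le> l * ip y y" if y: "y \<in> S" for y
  proof (cases "y = 0")
    case False
    then have "(1 / norm y) *\<^sub>R y \<in> ?K" using S(1) y by (simp add: subspace_scale)
    from x0(2)[OF this] have "?f y \<le> l"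
      using False by (simp add: l_def ip_scale_left ip_scale_right matrix_vector_mult_scaleR)
    then show ?thesis using ip_pos[OF False] by (simp add: field_simps)
  qed (simp add: ip_zero_left ip_zero_right)
  have eq0: "ip (M *v x0) x0 = l * ip x0 x0" using x0S by (simp add: l_def ip_eq_0_iff)
  have crit: "ip (l *\<^sub>R x0 - M *v x0) y = 0" if y: "y \<in> S" for y
  proof -
    define a where "a = ip (l *\<^sub>R x0 - M *v x0) y"
    define b where "b = l * ip y y - ip (M *v y) y"
    have "2 * t * a + t * t * b \<ge> 0" for t
    proof -
      have z: "x0 + t *\<^sub>R y \<in> S" using x0S y S(1) by (simp add: subspace_add subspace_scale)
      have "ip (M *v y) x0 = ip (M *v x0) y" using M ip_sym by metis
      then have "l * ip (x0 + t *\<^sub>R y) (x0 + t *\<^sub>R y) - ip (M *v (x0 + t *\<^sub>R y)) (x0 + t *\<^sub>R y) = 2 * t * a + t * t * b"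
        using eq0 ip_sym[of y x0] unfolding a_def b_def
        by (simp add: ip_add_left ip_add_right ip_diff_left ip_scale_left ip_scale_right
            matrix_vector_right_distrib matrix_vector_mult_scaleR algebra_simps)
      then show ?thesis using le[OF z] by linarith
    qed
    note q = this
    have "b \<ge> 0" using le[OF y] unfolding b_def by simp
    show ?thesis
    proof (cases "b = 0")
      case True
      then have "a * a \<le> 0" using q[of "-a"] by simp
      then show ?thesis unfolding a_def[symmetric] by (auto simp: mult_le_0_iff)
    next
      case False
      have "2 * (- a / b) * a + (- a / b) * (- a / b) * b = - (a * a / b)" using False by (simp add: field_simps)
      then have "a * a / b \<le> 0" using q[of "- a / b"] by linarith
      then have "a * a \<le> 0" using False \<open>b \<ge> 0\<close> by (simp add: divide_le_0_iff mult_le_0_iff)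
      then have "a = 0" by (auto simp: mult_le_0_iff)
      then show ?thesis unfolding a_def .
    qed
  qed
  have "l *\<^sub>R x0 - M *v x0 \<in> S" using x0S S by (simp add: subspace_diff subspace_scale)
  from crit[OF this] have "l *\<^sub>R x0 - M *v x0 = 0" by (simp only: ip_eq_0_iff)
  then have Mx: "M *v x0 = l *\<^sub>R x0" by (simp only: right_minus_eq)
  define x where "x = (1 / sqrt (ip x0 x0)) *\<^sub>R x0"
  have "ip x0 x0 > 0" using x0S ip_pos by blast
  then have "sqrt (ip x0 x0) * sqrt (ip x0 x0) = ip x0 x0" "sqrt (ip x0 x0) > 0" by auto
  then have "ip x x = 1" unfolding x_def ip_scale_left ip_scale_right by (simp add: field_simps)
  moreover have "x \<in> S" unfolding x_def using x0S S(1) by (simp add: subspace_scale)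
  moreover have "M *v x = l *\<^sub>R x" unfolding x_def by (simp add: matrix_vector_mult_scaleR Mx)
  ultimately show ?thesis using that by blast
qed

lemma orthonormal_eigenbasis_subspace:
  assumes M: "\<And>x y. ip (M *v x) y = ip x (M *v y)"
    and S: "subspace S" "\<And>x. x \<in> S \<Longrightarrow> M *v x \<in> S"
  shows "\<exists>B. finite B \<and> B \<subseteq> S \<and> card B = dim S \<and>
    (\<forall>x\<in>B. ip x x = 1 \<and> (\<exists>\<mu>. M *v x = \<mu> *\<^sub>R x) \<and> (\<forall>y\<in>B. x \<noteq> y \<longrightarrow> ip x y = 0))"
  using S
proof (induction "dim S" arbitrary: S)
  case 0
  then show ?case by (intro exI[of _ "{}"]) auto
next
  case (Suc n)
  have "S \<noteq> {0}" using Suc.hyps(2) by auto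
  then obtain x \<mu> where x: "x \<in> S" "ip x x = 1" "M *v x = \<mu> *\<^sub>R x"
    using eigenvector_in_subspace[OF M Suc.prems] by blast
  define S' where "S' = {y \<in> S. ip x y = 0}"
  have S': "subspace S'" unfolding S'_def using Suc.prems(1)
    by (intro subspaceI) (auto simp: subspace_0 subspace_add subspace_scale ip_zero_right ip_add_right ip_scale_right)
  have inv: "M *v y \<in> S'" if "y \<in> S'" for y
  proof -
    have "ip x (M *v y) = ip (M *v x) y" using M by simp
    then show ?thesis using that Suc.prems(2) x(3) unfolding S'_def by (simp add: ip_scale_left)
  qed
  have xS': "x \<notin> span S'" using S' x(2) by (simp add: span_eq_iff[THEN iffD2] S'_def)
  have "S \<subseteq> span (insert x S')"
  proof
    fix y assume y: "y \<in> S"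
    have "y - ip x y *\<^sub>R x \<in> S'" unfolding S'_def using y x Suc.prems(1)
      by (simp add: subspace_diff subspace_scale ip_diff_right ip_scale_right)
    then have "y - ip x y *\<^sub>R x + ip x y *\<^sub>R x \<in> span (insert x S')"
      by (intro span_add span_scale) (auto intro: span_base)
    then show "y \<in> span (insert x S')" by simp
  qed
  moreover have "insert x S' \<subseteq> S" using x unfolding S'_def by auto
  ultimately have "S = span (insert x S')" using span_minimal[of "insert x S'" S] Suc.prems(1) by blast
  then have "dim S = dim (insert x S')" using dim_span by metis
  then have "dim S = Suc (dim S')" using xS' by (simp add: dim_insert)
  then obtain B where B: "finite B" "B \<subseteq> S'" "card B = dim S'"
    "\<forall>x\<in>B. ip x x = 1 \<and> (\<exists>\<mu>. M *v x = \<mu> *\<^sub>R x) \<and> (\<forall>y\<in>B. x \<noteq> y \<longrightarrow> ip x y = 0)"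
    using Suc.hyps(1)[OF _ S' inv] Suc.hyps(2) by auto
  have "x \<notin> B" using B(2) xS' span_base by blast
  then have "card (insert x B) = dim S" using B \<open>dim S = Suc (dim S')\<close> by simp
  moreover have "ip x y = 0" "ip y x = 0" if "y \<in> B" for y using that B(2) ip_sym[of y x] unfolding S'_def by auto
  ultimately show ?case using B x unfolding S'_def by (intro exI[of _ "insert x B"]) auto
qed

lemma orthonormal_eigenbasis:
  assumes M: "\<And>x y. ip (M *v x) y = ip x (M *v y)"
  obtains v :: "'n \<Rightarrow> real^'n" and \<mu> where
    "\<And>i j. ip (v i) (v j) = (if i = j then 1 else 0)" "\<And>i. M *v v i = \<mu> i *\<^sub>R v i"
proof -
  obtain B where B: "finite B" "card B = dim (UNIV :: (real^'n) set)"
    "\<forall>x\<in>B. ip x x = 1 \<and> (\<exists>\<mu>. M *v x = \<mu> *\<^sub>R x) \<and> (\<forall>y\<in>B. x \<noteq> y \<longrightarrow> ip x y = 0)"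
    using orthonormal_eigenbasis_subspace[OF M subspace_UNIV] by blast
  have "card (UNIV :: 'n set) = card B" using B(2) by simp
  then obtain v where v: "bij_betw v (UNIV :: 'n set) B" using finite_same_card_bij[OF finite B(1)] by blast
  then have vB: "v i \<in> B" for i by (rule bij_betw_apply) simp
  then have "\<forall>i. \<exists>\<mu>. M *v v i = \<mu> *\<^sub>R v i" using B(3) by blast
  then obtain \<mu> where "\<And>i. M *v v i = \<mu> i *\<^sub>R v i" by metis
  moreover have "ip (v i) (v j) = (if i = j then 1 else 0)" for i j
  proof (cases "i = j")
    case False
    then have "v i \<noteq> v j" using v by (simp add: bij_betw_def inj_eq)
    then show ?thesis using B(3) vB False by simp
  qed (use B(3) vB in simp)
  ultimately show ?thesis using that by blast
qed

end

locale ip_orthonormal_basis = inner_product_space ip for ip :: "real^'n \<Rightarrow> real^'n \<Rightarrow> real" +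
  fixes v :: "'n \<Rightarrow> real^'n"
  assumes orthonormal: "\<And>i j. ip (v i) (v j) = (if i = j then 1 else 0)"
begin

definition Vmat :: "real^'n^'n" where "Vmat = (\<chi> a i. v i $ a)"
definition Wmat :: "real^'n^'n" where "Wmat = (\<chi> i a. ip (v i) (axis a 1))"

lemma Wmat_mult: "(Wmat *v x) $ i = ip (v i) x"
proof -
  have "x = (\<Sum>a\<in>UNIV. x $ a *\<^sub>R axis a 1)"
    using basis_expansion[of x] by (simp add: scalar_mult_eq_scaleR)
  then have "ip (v i) x = (\<Sum>a\<in>UNIV. ip (v i) (x $ a *\<^sub>R axis a 1))" using ip_sum_right by metis
  then show ?thesis by (simp add: Wmat_def matrix_vector_mult_def ip_scale_right mult.commute)
qed

lemma Vmat_column: "(A ** Vmat) $ a $ i = (A *v v i) $ a"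
  by (simp add: matrix_matrix_mult_def matrix_vector_mult_def Vmat_def)

lemma WV: "Wmat ** Vmat = mat 1"
  by (simp add: vec_eq_iff Vmat_column Wmat_mult orthonormal mat_def)

lemma VW: "Vmat ** Wmat = mat 1"
  using WV by (rule matrix_left_right_inverse[THEN iffD1])

lemma expansion: "x = (\<Sum>i\<in>UNIV. ip (v i) x *\<^sub>R v i)"
proof -
  have "x = Vmat *v (Wmat *v x)" by (simp add: matrix_vector_mul_assoc VW)
  also have "\<dots> = (\<Sum>i\<in>UNIV. ip (v i) x *\<^sub>R v i)"
    by (simp add: vec_eq_iff matrix_vector_mult_def[of Vmat "Wmat *v x"] Wmat_mult) (simp add: Vmat_def mult.commute)
  finally show ?thesis .
qed

lemma parseval: "ip x y = (\<Sum>i\<in>UNIV. ip (v i) x * ip (v i) y)"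
proof -
  have "ip x y = ip (\<Sum>i\<in>UNIV. ip (v i) x *\<^sub>R v i) y" using expansion[of x] by simp
  then show ?thesis by (simp add: ip_sum_left ip_scale_left)
qed

lemma eigenvalues_diagonal:
  assumes M: "\<And>i. M *v v i = \<mu> i *\<^sub>R v i"
  shows "eigenvalues M = image_mset (\<lambda>i. complex_of_real (\<mu> i)) (mset_set UNIV)"
proof (rule eigenvalues_eqI)
  fix z
  define D where "D = (\<chi> i j. if i = j then \<mu> i else 0)"
  have MV: "M ** Vmat = Vmat ** D"
    by (simp add: vec_eq_iff Vmat_column M) (simp add: matrix_matrix_mult_def Vmat_def D_def
        if_distrib[of "\<lambda>t. _ * t"] mult.commute cong: if_cong)
  have cmult: "cmatrix (A ** B) = cmatrix A ** cmatrix B" for A B :: "real^'n^'n"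
    by (simp add: vec_eq_iff matrix_matrix_mult_def)
  have "(mat z - cmatrix M) ** cmatrix Vmat = cmatrix Vmat ** (mat z - cmatrix D)"
  proof -
    have "mat z ** X = X ** mat z" for X :: "complex^'n^'n"
      by (simp add: vec_eq_iff matrix_matrix_mult_def mat_def if_distrib[of "\<lambda>t. t * _"]
          if_distrib[of "\<lambda>t. _ * t"] mult.commute cong: if_cong)
    moreover have "(X - Y) ** Z = X ** Z - Y ** Z" "Z ** (X - Y) = Z ** X - Z ** Y" for X Y Z :: "complex^'n^'n"
      by (simp_all add: vec_eq_iff matrix_matrix_mult_def algebra_simps sum_subtractf)
    ultimately show ?thesis using MV by (simp flip: cmult)
  qed
  then have "det (mat z - cmatrix M) * det (cmatrix Vmat) = det (cmatrix Vmat) * det (mat z - cmatrix D)"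
    by (metis det_mul)
  moreover have "det Wmat * det Vmat = 1" using WV det_mul det_I by metis
  then have "det (cmatrix Vmat) \<noteq> 0" by (auto simp: det_cmatrix)
  ultimately have "det (mat z - cmatrix M) = det (mat z - cmatrix D)" by simp
  also have "\<dots> = (\<Prod>i\<in>UNIV. (mat z - cmatrix D) $ i $ i)"
    by (rule det_diagonal) (simp add: mat_def D_def)
  also have "\<dots> = (\<Prod>e\<in>#image_mset (\<lambda>i. complex_of_real (\<mu> i)) (mset_set UNIV). z - e)"
    by (simp add: mat_def D_def prod_unfold_prod_mset image_mset.compositionality o_def)
  finally show "det (mat z - cmatrix M) = (\<Prod>e\<in>#image_mset (\<lambda>i. complex_of_real (\<mu> i)) (mset_set UNIV). z - e)" .
qed

end

lemma (in inner_product_space) ip_adjoint: "ip (A *v x) y = ip x (ip_adjoint ip A *v y)"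
proof -
  have "\<exists>e :: 'n \<Rightarrow> real^'n. \<forall>i j. ip (e i) (e j) = (if i = j then 1 else 0)"
    by (rule orthonormal_eigenbasis[of "mat 1"]) (simp, blast)
  then obtain e :: "'n \<Rightarrow> real^'n" where "\<forall>i j. ip (e i) (e j) = (if i = j then 1 else 0)" ..
  then have e: "ip (e i) (e j) = (if i = j then 1 else 0)" for i j by blast
  interpret ip_orthonormal_basis ip e by unfold_locales (rule e)
  define B where "B = matrix (\<lambda>y. \<Sum>i\<in>UNIV. ip (A *v e i) y *\<^sub>R e i)"
  have "linear (\<lambda>y. \<Sum>i\<in>UNIV. ip (A *v e i) y *\<^sub>R e i)"
    by (rule linearI) (simp_all add: ip_add_right ip_scale_right scaleR_add_left sum.distrib scaleR_sum_right)
  then have Bv: "B *v y = (\<Sum>i\<in>UNIV. ip (A *v e i) y *\<^sub>R e i)" for y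
    unfolding B_def by (simp add: matrix_works)
  have B: "ip (A *v x) y = ip x (B *v y)" for x y
  proof -
    have "A *v x = A *v (\<Sum>i\<in>UNIV. ip (e i) x *\<^sub>R e i)" using expansion[of x] by simp
    also have "\<dots> = (\<Sum>i\<in>UNIV. ip (e i) x *\<^sub>R (A *v e i))"
      by (simp add: linear_sum[OF matrix_vector_mul_linear] matrix_vector_mult_scaleR)
    finally show ?thesis
      by (simp add: Bv ip_sum_left ip_sum_right ip_scale_left ip_scale_right ip_sym[of x] mult.commute)
  qed
  have "ip_adjoint ip A = B" unfolding ip_adjoint_def
  proof (rule the_equality)
    fix C assume C: "\<forall>x y. ip (A *v x) y = ip x (C *v y)"
    have "C *v y = B *v y" for y
    proof -
      have "ip z (C *v y - B *v y) = 0" for z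
        using C[rule_format, of z y] B[of z y] by (simp only: ip_diff_right)
      then have "ip (C *v y - B *v y) (C *v y - B *v y) = 0" .
      then show ?thesis by (simp add: ip_eq_0_iff)
    qed
    then show "C = B" by (simp add: matrix_eq)
  qed (use B in auto)
  then show ?thesis using B by simp
qed

lemma top_two_of_sorted:
  fixes s :: "'n::finite \<Rightarrow> real"
  assumes "CARD('n) \<ge> 2" and L: "L = rev (sorted_list_of_multiset (image_mset s (mset_set UNIV)))"
  obtains i j where "s i = L ! 0" "s j = L ! 1" "\<And>k. k \<noteq> i \<Longrightarrow> s k \<le> L ! 1"
proof -
  have mL: "mset L = image_mset s (mset_set UNIV)" unfolding L by simp
  then have len: "length L = CARD('n)" by (metis size_image_mset size_mset size_mset_set)
  then obtain a b l where ab: "L = a # b # l"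
    using assms(1) by (cases L; cases "tl L") auto
  have srt: "sorted (rev L)" unfolding L by simp
  then have desc: "x \<le> b" if "x \<in> set (b # l)" for x using that unfolding ab by (auto simp: sorted_append)
  have "set_mset (mset L) = range s" unfolding mL by simp
  then have "a \<in> range s" "b \<in> range s" unfolding ab by auto
  then obtain i j where i: "s i = a" and j: "s j = b" by blast
  have "s k \<le> b" if "k \<noteq> i" for k
  proof -
    have "mset_set UNIV = add_mset i (mset_set (UNIV - {i}))"
      by (simp add: mset_set.remove)
    then have "mset (b # l) = image_mset s (mset_set (UNIV - {i}))" using mL i unfolding ab by simp
    then have "s k \<in># mset (b # l)" using that by simp
    then show ?thesis using desc by simp
  qed
  then show ?thesis using that i j unfolding ab by simp
qed

lemma near_rank1_of_outer:
  assumes pq: "norm (A - outer p q) \<le> \<epsilon> * norm A" "p \<noteq> 0" "q \<noteq> 0"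
  shows "\<exists>u w. near_rank1 (2 * \<epsilon>) A u w"
proof -
  define u w where "u = (1 / norm p) *\<^sub>R p" and "w = (1 / norm q) *\<^sub>R q"
  have R: "outer p q = norm (outer p q) *\<^sub>R outer u w"
    unfolding u_def w_def norm_outer using pq by (simp add: outer_scaleR_left outer_scaleR_right)
  have uw: "norm u = 1" "norm w = 1" unfolding u_def w_def using pq by auto
  have "norm (A - norm A *\<^sub>R outer u w) \<le> norm (A - outer p q) + norm (outer p q - norm A *\<^sub>R outer u w)"
    using norm_triangle_ineq[of "A - outer p q" "outer p q - norm A *\<^sub>R outer u w"] by simp
  also have "outer p q - norm A *\<^sub>R outer u w = (norm (outer p q) - norm A) *\<^sub>R outer u w"
    by (subst R) (simp add: algebra_simps)
  also have "norm \<dots> = \<bar>norm A - norm (outer p q)\<bar>" using uw by (simp add: norm_outer)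
  also have "\<dots> \<le> norm (A - outer p q)" by (rule norm_triangle_ineq3)
  finally show ?thesis using pq(1) uw unfolding near_rank1_def by (intro exI[of _ u] exI[of _ w]) auto
qed

lemma singular_value_gap_near_rank1:
  fixes ip :: "real^'n \<Rightarrow> real^'n \<Rightarrow> real"
  assumes ip: "inner_product ip" and card: "CARD('n) \<ge> 2"
  obtains K where "K > 0" "\<And>A. invertible A \<Longrightarrow> \<exists>u w. near_rank1
    (K * exp (- (ln (singular_values ip A ! 0) - ln (singular_values ip A ! 1)))) A u w"
proof -
  interpret inner_product_space ip by unfold_locales (rule ip)
  obtain c C where cC: "c > 0" "C > 0" "\<And>x. c * (norm x)\<^sup>2 \<le> ip x x" "\<And>x. ip x x \<le> C * (norm x)\<^sup>2"
    using ip_norm_equiv by blast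
  define K where "K = 2 * (CARD('n) * (C / c))"
  have "\<exists>u w. near_rank1 (K * exp (- (ln (singular_values ip A ! 0) - ln (singular_values ip A ! 1)))) A u w"
    if inv: "invertible A" for A
  proof -
    define M where "M = ip_adjoint ip A ** A"
    have Mip: "ip x (M *v y) = ip (A *v x) (A *v y)" for x y
      unfolding M_def by (simp add: ip_adjoint flip: matrix_vector_mul_assoc)
    then have Msym: "ip (M *v x) y = ip x (M *v y)" for x y by (metis ip_sym)
    from orthonormal_eigenbasis[OF this] obtain v :: "'n \<Rightarrow> real^'n" and \<mu> where
      v: "\<And>i j. ip (v i) (v j) = (if i = j then 1 else 0)" "\<And>i. M *v v i = \<mu> i *\<^sub>R v i" by blast
    interpret ip_orthonormal_basis ip v by unfold_locales (rule v)
    have mu: "\<mu> i = ip (A *v v i) (A *v v i)" for i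
      using Mip[of "v i" "v i"] v by (simp add: ip_scale_right)
    have v0: "v i \<noteq> 0" for i using v(1)[of i i] by (auto simp: ip_zero_left)
    have Av0: "A *v v i \<noteq> 0" for i
    proof
      assume "A *v v i = 0"
      moreover obtain A' where "A' ** A = mat 1" using inv unfolding invertible_def by blast
      ultimately have "v i = 0" using matrix_left_invertible_ker[of A] by blast
      then show False using v0 by simp
    qed
    have mu_pos: "\<mu> i > 0" for i unfolding mu by (intro ip_pos Av0)
    define L where "L = singular_values ip A"
    have L: "L = rev (sorted_list_of_multiset (image_mset (\<lambda>i. sqrt (\<mu> i)) (mset_set UNIV)))"
      unfolding L_def singular_values_def M_def[symmetric] eigenvalues_diagonal[of M, OF v(2)]
      by (simp add: image_mset.compositionality o_def)
    obtain i j where ij: "sqrt (\<mu> i) = L ! 0" "sqrt (\<mu> j) = L ! 1" "\<And>k. k \<noteq> i \<Longrightarrow> sqrt (\<mu> k) \<le> L ! 1"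
      using top_two_of_sorted[OF card L] by blast
    define s1 s2 where "s1 = L ! 0" and "s2 = L ! 1"
    have s: "s1 > 0" "s2 > 0" unfolding s1_def s2_def ij(1)[symmetric] ij(2)[symmetric]
      using mu_pos by auto
    have s1: "ip (A *v v i) (A *v v i) = s1\<^sup>2" using ij(1) mu mu_pos unfolding s1_def by (simp add: less_imp_le flip: ij(1))
    have mu_le: "\<mu> k \<le> s2\<^sup>2" if "k \<noteq> i" for k
      using ij(3)[OF that] mu_pos[of k] unfolding s2_def by (simp add: real_le_lsqrt sqrt_le_D)
    define q where "q = Wmat $ i"
    have q: "q \<bullet> x = ip (v i) x" for x
      unfolding q_def using Wmat_mult[of x i] by (simp add: matrix_vector_mul_component)
    define E where "E = A - outer (A *v v i) q"
    have Ex: "norm (E *v x) \<le> sqrt (C / c) * s2 * norm x" for x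
    proof -
      define y where "y = x - ip (v i) x *\<^sub>R v i"
      have Ey: "E *v x = A *v y"
        unfolding E_def y_def by (simp add: matrix_vector_mult_diff_rdistrib outer_mult_vec q
            matrix_vector_mult_diff_distrib matrix_vector_mult_scaleR)
      have yk: "ip (v k) y = (if k = i then 0 else ip (v k) x)" for k
        unfolding y_def using v(1) by (simp add: ip_diff_right ip_scale_right)
      have "ip (A *v y) (A *v y) = (\<Sum>k\<in>UNIV. ip (v k) y * ip (v k) (M *v y))"
        using Mip[of y y] parseval[of y "M *v y"] by simp
      also have "\<dots> = (\<Sum>k\<in>UNIV. \<mu> k * (ip (v k) y)\<^sup>2)"
      proof (intro sum.cong refl)
        fix k
        have "ip (v k) (M *v y) = ip (M *v v k) y" by (rule Msym[symmetric])
        then show "ip (v k) y * ip (v k) (M *v y) = \<mu> k * (ip (v k) y)\<^sup>2"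
          by (simp add: v(2) ip_scale_left power2_eq_square)
      qed
      also have "\<dots> \<le> (\<Sum>k\<in>UNIV. s2\<^sup>2 * (ip (v k) x)\<^sup>2)"
        using mu_le by (intro sum_mono) (auto simp: yk intro: mult_right_mono)
      also have "\<dots> = s2\<^sup>2 * ip x x"
        using parseval[of x x] by (simp add: sum_distrib_left power2_eq_square)
      finally have "c * (norm (E *v x))\<^sup>2 \<le> s2\<^sup>2 * (C * (norm x)\<^sup>2)"
        using cC(3)[of "A *v y"] mult_left_mono[OF cC(4)[of x] zero_le_power2[of s2]] unfolding Ey by linarith
      then have "(norm (E *v x))\<^sup>2 \<le> (sqrt (C / c) * s2 * norm x)\<^sup>2"
        using cC(1,2) by (simp add: power_mult_distrib field_simps)
      then show ?thesis by (rule power2_le_imp_le) (use s cC in auto)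
    qed
    have normE: "norm E \<le> CARD('n) * (sqrt (C / c) * s2)"
    proof -
      have "norm E = norm (transpose E)" by (simp add: norm_transpose)
      also have "\<dots> \<le> (\<Sum>a\<in>UNIV. norm (transpose E $ a))" unfolding norm_vec_def[of "transpose E"]
        by (rule L2_set_le_sum) simp
      also have "\<dots> \<le> (\<Sum>a\<in>(UNIV::'n set). sqrt (C / c) * s2)"
      proof (intro sum_mono)
        fix a
        have "transpose E $ a = E *v axis a 1" by (simp add: matrix_vector_mult_basis column_def transpose_def vec_eq_iff)
        then show "norm (transpose E $ a) \<le> sqrt (C / c) * s2" using Ex[of "axis a 1"] by simp
      qed
      finally show ?thesis by simp
    qed
    have normA: "sqrt (c / C) * s1 \<le> norm A"
    proof -
      have "s1\<^sup>2 \<le> C * (norm (A *v v i))\<^sup>2" using cC(4)[of "A *v v i"] s1 by simp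
      also have "\<dots> \<le> C * (norm A * norm (v i))\<^sup>2"
        using cC by (intro mult_left_mono power_mono norm_matrix_vector_mult) auto
      finally have "s1\<^sup>2 \<le> C * (norm A)\<^sup>2 * (norm (v i))\<^sup>2" by (simp add: power_mult_distrib)
      then have "c * s1\<^sup>2 \<le> C * (norm A)\<^sup>2 * (c * (norm (v i))\<^sup>2)" using cC(1) by (simp add: mult.left_commute)
      also have "\<dots> \<le> C * (norm A)\<^sup>2 * 1"
        using cC(3)[of "v i"] v(1)[of i i] cC(2) by (intro mult_left_mono) auto
      finally have "(sqrt (c / C) * s1)\<^sup>2 \<le> (norm A)\<^sup>2"
        using cC(1,2) by (simp add: power_mult_distrib field_simps)
      then show ?thesis by (rule power2_le_imp_le) simp
    qed
    have "norm E \<le> (CARD('n) * (C / c) * (s2 / s1)) * norm A"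
    proof -
      have "sqrt (C / c) = (C / c) * sqrt (c / C)"
        using cC by (simp add: real_sqrt_divide field_simps)
      then have "CARD('n) * (sqrt (C / c) * s2) = (CARD('n) * (C / c) * (s2 / s1)) * (sqrt (c / C) * s1)"
        using s by simp
      also have "\<dots> \<le> (CARD('n) * (C / c) * (s2 / s1)) * norm A"
        using s cC by (intro mult_left_mono normA) auto
      finally show ?thesis using normE by linarith
    qed
    moreover have "q \<noteq> 0" using q[of "v i"] v(1)[of i i] by auto
    ultimately have "\<exists>u w. near_rank1 (2 * (CARD('n) * (C / c) * (s2 / s1))) A u w"
      using near_rank1_of_outer[of A "A *v v i" q] Av0 unfolding E_def by blast
    moreover have "exp (- (ln s1 - ln s2)) = s2 / s1" using s by (simp add: exp_diff)
    ultimately show ?thesis unfolding K_def s1_def s2_def L_def by (simp add: mult.assoc)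
  qed
  moreover have "K > 0" unfolding K_def using cC by simp
  ultimately show ?thesis using that by blast
qed

section \<open>The isometry group of the form\<close>

lemma SL_scalars_iff: "X \<in> SL_scalars \<longleftrightarrow> (\<exists>c. X = c *\<^sub>R (mat 1 :: real^'n^'n) \<and> c ^ CARD('n) = 1)"
proof -
  have m: "mat c = c *\<^sub>R (mat 1 :: real^'n^'n)" for c by (simp add: vec_eq_iff mat_def)
  have "det (mat c :: real^'n^'n) = c ^ CARD('n)" for c :: real
    by (subst det_diagonal) (auto simp: mat_def)
  then show ?thesis unfolding SL_scalars_def by (auto simp flip: m)
qed

lemma psl_class_iff: "X \<in> psl_class (A :: real^'n^'n) \<longleftrightarrow> (\<exists>c. X = c *\<^sub>R A \<and> c ^ CARD('n) = 1)"
proof -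
  have "X \<in> psl_class A \<longleftrightarrow> (\<exists>Y\<in>SL_scalars. X = Y ** A)"
    unfolding psl_class_def r_coset_def SL_group_def by auto
  also have "\<dots> \<longleftrightarrow> (\<exists>c. X = c *\<^sub>R A \<and> c ^ CARD('n) = 1)"
    unfolding Bex_def SL_scalars_iff by (auto simp: matrix_mult.scaleR_left)
  finally show ?thesis .
qed

lemma psl_class_self: "A \<in> psl_class A"
  unfolding psl_class_iff by (intro exI[of _ 1]) simp

lemma root_of_unity_real:
  fixes c :: real assumes "c ^ n = 1" "n > 0" shows "c = 1 \<or> c = -1"
proof -
  have "\<bar>c\<bar> ^ n = 1 ^ n" using assms by (simp flip: power_abs)
  then have "\<bar>c\<bar> = 1" using assms(2) by (intro power_eq_imp_eq_base[of _ n 1]) auto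
  then show ?thesis by auto
qed

lemma psl_class_sign:
  assumes "X \<in> psl_class (A :: real^'n^'n)" obtains c where "c = 1 \<or> c = -1" "X = c *\<^sub>R A"
  using assms root_of_unity_real unfolding psl_class_iff by (metis zero_less_card_finite)

lemma PSL_mult: "psl_class A \<otimes>\<^bsub>PSL_group\<^esub> psl_class B = psl_class (A ** B)" for A B :: "real^'n^'n"
proof -
  have "psl_class A \<otimes>\<^bsub>PSL_group\<^esub> psl_class B = {X ** Y |X Y. X \<in> psl_class A \<and> Y \<in> psl_class B}"
    unfolding PSL_group_def FactGroup_def set_mult_def SL_group_def by auto
  also have "\<dots> = psl_class (A ** B)"
  proof (intro subset_antisym subsetI)
    fix Z assume "Z \<in> {X ** Y |X Y. X \<in> psl_class A \<and> Y \<in> psl_class B}"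
    then obtain c c' where c: "Z = (c *\<^sub>R A) ** (c' *\<^sub>R B)" "c ^ CARD('n) = 1" "c' ^ CARD('n) = 1"
      unfolding psl_class_iff by auto
    then show "Z \<in> psl_class (A ** B)" unfolding psl_class_iff
      by (intro exI[of _ "c * c'"]) (simp add: matrix_mult.scaleR_left matrix_mult.scaleR_right power_mult_distrib)
  next
    fix Z assume "Z \<in> psl_class (A ** B)"
    then obtain c where c: "Z = c *\<^sub>R (A ** B)" "c ^ CARD('n) = 1" unfolding psl_class_iff by auto
    then have "Z = (c *\<^sub>R A) ** B" "c *\<^sub>R A \<in> psl_class A"
      unfolding psl_class_iff by (auto simp: matrix_mult.scaleR_left)
    then show "Z \<in> {X ** Y |X Y. X \<in> psl_class A \<and> Y \<in> psl_class B}" using psl_class_self by blast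
  qed
  finally show ?thesis .
qed

lemma psl_class_eqI: assumes "X \<in> psl_class (A :: real^'n^'n)" shows "psl_class X = psl_class A"
proof -
  obtain c where c: "X = c *\<^sub>R A" "c ^ CARD('n) = 1" using assms unfolding psl_class_iff by auto
  have "c \<noteq> 0" using c(2) zero_power[OF zero_less_card_finite, where 'a=real] by (metis zero_neq_one)
  then have A: "A = inverse c *\<^sub>R X" using c(1) by simp
  show ?thesis
  proof (intro subset_antisym subsetI)
    fix Z assume "Z \<in> psl_class X"
    then show "Z \<in> psl_class A" using c unfolding psl_class_iff by (metis mult_1 power_mult_distrib scaleR_scaleR)
  next
    fix Z assume "Z \<in> psl_class A"
    then obtain e where "Z = e *\<^sub>R A" "e ^ CARD('n) = 1" unfolding psl_class_iff by auto
    then show "Z \<in> psl_class X" unfolding psl_class_iff using A c(2)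
      by (intro exI[of _ "e * inverse c"]) (simp add: power_mult_distrib power_inverse)
  qed
qed

lemma span_scaleR_singleton: "c \<noteq> 0 \<Longrightarrow> span {c *\<^sub>R x} = span {x :: 'a::real_vector}"
proof (intro subset_antisym)
  assume c: "c \<noteq> 0"
  show "span {c *\<^sub>R x} \<subseteq> span {x}" by (intro span_minimal) (auto intro: span_scale span_base)
  have "(1 / c) *\<^sub>R (c *\<^sub>R x) \<in> span {c *\<^sub>R x}" by (intro span_scale span_base) simp
  then show "span {x} \<subseteq> span {c *\<^sub>R x}" using c by (intro span_minimal) auto
qed

lemma psl_act_line: "psl_act (psl_class A) (span {x}) = span {A *v x}"
proof -
  have "(*v) X ` span {x} = span {A *v x}" if "X \<in> psl_class A" for X
  proof -
    obtain c where c: "c = 1 \<or> c = -1" "X = c *\<^sub>R A" using psl_class_sign[OF \<open>X \<in> psl_class A\<close>] .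
    have "(*v) X ` span {x} = span ((*v) X ` {x})"
      by (rule linear_span_image[symmetric]) simp
    also have "\<dots> = span {c *\<^sub>R (A *v x)}" using c by (simp add: scaleR_matrix_vector_assoc)
    also have "\<dots> = span {A *v x}" using c(1) by (intro span_scaleR_singleton) auto
    finally show ?thesis .
  qed
  then show ?thesis unfolding psl_act_def using psl_class_self[of A] by auto
qed

lemma span_eq_span_iff:
  assumes "x \<noteq> (0 :: 'a::real_vector)" "span {x} = span {y}" obtains c where "y = c *\<^sub>R x" "c \<noteq> 0"
proof -
  have "y \<in> span {x}" using assms(2) span_base[of y "{y}"] by simp
  then obtain c where c: "y = c *\<^sub>R x" unfolding span_singleton by auto
  moreover have "c \<noteq> 0" 
  proof
    assume "c = 0"
    then have "span {x} = {0}" using assms(2) c by simp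
    then show False using assms(1) span_base[of x "{x}"] by simp
  qed
  ultimately show ?thesis using that by blast
qed

definition form_matrix :: "real^('p::finite + 'q::finite)^('p + 'q)" where
  "form_matrix = (\<chi> i j. if i = j then (case i of Inl _ \<Rightarrow> 1 | Inr _ \<Rightarrow> -1) else 0)"

lemma sum_UNIV_sum: "(\<Sum>i\<in>(UNIV :: ('p::finite + 'q::finite) set). f i) = (\<Sum>i\<in>UNIV. f (Inl i)) + (\<Sum>j\<in>UNIV. f (Inr j))"
  using sum.Plus[of "UNIV :: 'p set" "UNIV :: 'q set" f] by simp

lemma form_matrix_mult: "(form_matrix *v x) $ i = (case i of Inl _ \<Rightarrow> 1 | Inr _ \<Rightarrow> -1) * x $ i"
  by (simp add: form_matrix_def matrix_vector_mult_def if_distrib[of "\<lambda>t. t * _"] cong: if_cong)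

lemma pq_form_eq: "pq_form x y = x \<bullet> (form_matrix *v y)"
  by (simp add: pq_form_def inner_vec_def sum_UNIV_sum form_matrix_mult sum_negf)

lemma form_matrix_square: "form_matrix ** form_matrix = (mat 1 :: real^('p::finite + 'q::finite)^('p + 'q))"
proof -
  have "form_matrix *v (form_matrix *v x) = x" for x :: "real^('p + 'q)"
    by (simp add: vec_eq_iff form_matrix_mult split: sum.split)
  then show ?thesis by (simp add: matrix_eq matrix_vector_mul_assoc)
qed

lemma pq_form_sym: "pq_form x y = pq_form y x"
  by (simp add: pq_form_def mult.commute)

lemma pq_form_simps:
  "pq_form (x + y) z = pq_form x z + pq_form y z" "pq_form z (x + y) = pq_form z x + pq_form z y"
  "pq_form (x - y) z = pq_form x z - pq_form y z" "pq_form z (x - y) = pq_form z x - pq_form z y"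
  "pq_form (c *\<^sub>R x) z = c * pq_form x z" "pq_form z (c *\<^sub>R x) = c * pq_form z x"
  "pq_form 0 z = 0" "pq_form z 0 = 0" "pq_form (- x) z = - pq_form x z" "pq_form z (- x) = - pq_form z x"
  by (simp_all add: pq_form_eq inner_add_left inner_add_right inner_diff_left inner_diff_right
      matrix_vector_right_distrib matrix_vector_mult_diff_distrib matrix_vector_mult_scaleR
      linear_neg[OF matrix_vector_mul_linear])

lemma pq_form_nondegenerate: assumes "\<And>y. pq_form x y = 0" shows "x = 0"
proof -
  have "x \<bullet> (form_matrix *v (form_matrix *v x)) = 0" using assms unfolding pq_form_eq by blast
  then show ?thesis by (simp add: matrix_vector_mul_assoc form_matrix_square)
qed

definition pq_isometry :: "real^('p::finite + 'q::finite)^('p + 'q) \<Rightarrow> bool" where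
  "pq_isometry A \<longleftrightarrow> (\<forall>x y. pq_form (A *v x) (A *v y) = pq_form x y)"

lemma pq_isometryD: "pq_isometry A \<Longrightarrow> pq_form (A *v x) (A *v y) = pq_form x y"
  unfolding pq_isometry_def by blast

lemma pq_isometry_iff: "pq_isometry A \<longleftrightarrow> transpose A ** form_matrix ** A = form_matrix"
proof -
  have e: "pq_form (A *v x) (A *v y) = x \<bullet> ((transpose A ** form_matrix ** A) *v y)" for x y
    unfolding pq_form_eq
    by (simp flip: matrix_vector_mul_assoc dot_lmul_matrix del: transpose_matrix_vector)
  show ?thesis
  proof
    assume A: "pq_isometry A"
    have "x \<bullet> ((transpose A ** form_matrix ** A) *v y - form_matrix *v y) = 0" for x y
      using pq_isometryD[OF A, of x y] e[of x y] unfolding pq_form_eq[of x y] by (simp add: inner_diff_right)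
    then have "(transpose A ** form_matrix ** A) *v y = form_matrix *v y" for y
      by (metis inner_eq_zero_iff right_minus_eq)
    then show "transpose A ** form_matrix ** A = form_matrix" by (simp add: matrix_eq)
  next
    assume "transpose A ** form_matrix ** A = form_matrix"
    then show "pq_isometry A" unfolding pq_isometry_def using e pq_form_eq by metis
  qed
qed

lemma pq_isometry_inverse:
  assumes "pq_isometry A" defines "A' \<equiv> form_matrix ** transpose A ** form_matrix"
  shows "A' ** A = mat 1" "A ** A' = mat 1"
proof -
  have "A' ** A = form_matrix ** (transpose A ** form_matrix ** A)"
    unfolding A'_def by (simp add: matrix_mul_assoc)
  then show 1: "A' ** A = mat 1" using assms(1) by (simp add: pq_isometry_iff form_matrix_square)
  then show "A ** A' = mat 1" by (rule matrix_left_right_inverse[THEN iffD1])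
qed

lemma pq_isometry_det:
  fixes A :: "real^('p::finite + 'q::finite)^('p + 'q)"
  assumes "pq_isometry A" shows "det A = 1 \<or> det A = -1"
proof -
  have "det (form_matrix :: real^('p + 'q)^('p + 'q)) * det (form_matrix :: real^('p + 'q)^('p + 'q)) = 1"
    using arg_cong[OF form_matrix_square, of det] by (simp only: det_mul det_I)
  then have "det (form_matrix :: real^('p + 'q)^('p + 'q)) \<noteq> 0" by auto
  moreover have "det A * det (form_matrix :: real^('p + 'q)^('p + 'q)) * det A = det (form_matrix :: real^('p + 'q)^('p + 'q))"
    using arg_cong[OF assms[unfolded pq_isometry_iff], of det] by (simp only: det_mul det_transpose)
  ultimately have "det A * det A = 1" by (simp add: mult.commute mult.left_commute)
  then show ?thesis by (simp add: square_eq_1_iff)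
qed

lemma pq_isometry_mult: "pq_isometry A \<Longrightarrow> pq_isometry B \<Longrightarrow> pq_isometry (A ** B)"
  unfolding pq_isometry_def by (simp flip: matrix_vector_mul_assoc)

lemma pq_isometry_left_inverse:
  assumes "pq_isometry A" "A ** B = mat 1" shows "pq_isometry B"
  unfolding pq_isometry_def
proof (intro allI)
  fix x y
  have "pq_form (B *v x) (B *v y) = pq_form (A *v (B *v x)) (A *v (B *v y))"
    using pq_isometryD[OF assms(1)] by simp
  then show "pq_form (B *v x) (B *v y) = pq_form x y" by (simp add: matrix_vector_mul_assoc assms(2))
qed

definition special_isometry :: "real^('p::finite + 'q::finite)^('p + 'q) \<Rightarrow> bool" where
  "special_isometry A \<longleftrightarrow> det A = 1 \<and> pq_isometry A"

lemma PSO_iff: "g \<in> PSO \<longleftrightarrow> (\<exists>A. special_isometry A \<and> g = psl_class A)"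
  unfolding PSO_def special_isometry_def pq_isometry_def by blast

lemma PSO_rep:
  fixes A :: "real^('a::finite + 'b::finite)^('a + 'b)"
  assumes g: "g \<in> PSO" and A: "A \<in> g" shows "special_isometry A" "g = psl_class A"
proof -
  obtain B where B: "special_isometry B" "g = psl_class B" using g PSO_iff by blast
  then show "g = psl_class A" using A psl_class_eqI by blast
  obtain c where c: "A = c *\<^sub>R B" "c ^ CARD('a + 'b) = 1" using A unfolding B(2) psl_class_iff by blast
  have "det A = c ^ CARD('a + 'b) * det B"
  proof -
    have "A = (c *\<^sub>R mat 1) ** B" using c(1) by (simp add: matrix_mult.scaleR_left)
    moreover have "det (c *\<^sub>R mat 1 :: real^('a + 'b)^('a + 'b)) = c ^ CARD('a + 'b)"
      by (subst det_diagonal) (auto simp: mat_def)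
    ultimately show ?thesis by (simp add: det_mul)
  qed
  moreover have "c * c = 1" using root_of_unity_real[OF c(2)] by auto
  then have "pq_isometry A" using B(1) unfolding special_isometry_def pq_isometry_def c(1)
    by (simp add: pq_form_simps mult.assoc[symmetric] flip: scaleR_matrix_vector_assoc)
  ultimately show "special_isometry A" using B(1) c(2) unfolding special_isometry_def by simp
qed

lemma special_isometry_mult: "special_isometry A \<Longrightarrow> special_isometry B \<Longrightarrow> special_isometry (A ** B)"
  unfolding special_isometry_def using pq_isometry_mult by (auto simp: det_mul)

definition pq_reflection :: "real^('p::finite + 'q::finite) \<Rightarrow> real^('p + 'q)^('p + 'q)" where
  "pq_reflection w = mat 1 + outer ((- 2 / pq_form w w) *\<^sub>R w) (form_matrix *v w)"

lemma pq_reflection_mult: "pq_reflection w *v x = x - (2 * pq_form x w / pq_form w w) *\<^sub>R w"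
  unfolding pq_reflection_def
  by (simp add: matrix_vector_mult_add_rdistrib outer_mult_vec pq_form_eq[of x] inner_commute)

lemma pq_reflection_isometry: assumes "pq_form w w \<noteq> 0" shows "pq_isometry (pq_reflection w)"
  unfolding pq_isometry_def
proof (intro allI)
  fix x y
  show "pq_form (pq_reflection w *v x) (pq_reflection w *v y) = pq_form x y"
    unfolding pq_reflection_mult using assms pq_form_sym[of w y]
    by (simp add: pq_form_simps field_simps)
qed

lemma pq_reflection_det: assumes "pq_form w w \<noteq> 0" shows "det (pq_reflection w) = -1"
proof -
  have "((- 2 / pq_form w w) *\<^sub>R w) \<bullet> (form_matrix *v w) = (- 2 / pq_form w w) * pq_form w w"
    by (simp add: pq_form_eq)
  then show ?thesis unfolding pq_reflection_def det_mat1_plus_outer using assms by simp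
qed

lemma two_reflections_special:
  "pq_form w w \<noteq> 0 \<Longrightarrow> pq_form z z \<noteq> 0 \<Longrightarrow> special_isometry (pq_reflection w ** pq_reflection z)"
  unfolding special_isometry_def
  by (simp add: det_mul pq_reflection_det pq_reflection_isometry pq_isometry_mult)

lemma nonisotropic_orthogonal_vector:
  fixes b v :: "real^('p::finite + 'q::finite)"
  assumes card: "CARD('p + 'q) > 2" and b: "pq_form b b = -1" and v: "pq_form v v = 1" and bv: "pq_form b v = 0"
  obtains z where "pq_form z b = 0" "pq_form z v = 0" "pq_form z z \<noteq> 0"
proof (rule ccontr)
  assume "\<not> thesis"
  with that have iso: "\<And>z. pq_form z b = 0 \<Longrightarrow> pq_form z v = 0 \<Longrightarrow> pq_form z z = 0" by blast
  define \<pi> where "\<pi> x = x + pq_form x b *\<^sub>R b - pq_form x v *\<^sub>R v" for x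
  have pi: "pq_form (\<pi> x) b = 0" "pq_form (\<pi> x) v = 0" for x
    unfolding \<pi>_def using b v bv pq_form_sym[of v b] by (simp_all add: pq_form_simps)
  have "pq_form (\<pi> x) y = 0" for x y
  proof -
    have "pq_form (\<pi> x + \<pi> y) (\<pi> x + \<pi> y) = 0" using pi by (intro iso) (simp_all add: pq_form_simps)
    then have "pq_form (\<pi> x) (\<pi> y) = 0"
      using iso[OF pi, of x] iso[OF pi, of y] pq_form_sym[of "\<pi> x" "\<pi> y"] by (simp add: pq_form_simps)
    then show ?thesis unfolding \<pi>_def[of y] using pi by (simp add: pq_form_simps)
  qed
  then have "\<pi> x = 0" for x using pq_form_nondegenerate by blast
  then have "x = (- pq_form x b) *\<^sub>R b + pq_form x v *\<^sub>R v" for x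
    unfolding \<pi>_def by (metis (no_types, lifting) add.commute add_diff_cancel_left' diff_add_cancel eq_iff_diff_eq_0 diff_diff_add minus_add_cancel scaleR_minus_left)
  then have "x \<in> span {b, v}" for x
    by (metis insertI1 insertI2 singletonI span_add span_base span_scale)
  then have "dim (UNIV :: (real^('p + 'q)) set) \<le> card {b, v}"
    by (intro dim_le_card) auto
  also have "\<dots> \<le> 2" by (simp add: card_insert_if)
  finally show False using card by simp
qed

text \<open>Two unit space-like vectors are exchanged, up to sign, by the reflection in their difference or
  in their sum; the determinant is corrected by a further reflection in an orthogonal vector or in
  \<open>b\<close> itself.\<close>

lemma spacelike_transitive:
  fixes b e v :: "real^('p::finite + 'q::finite)"
  assumes card: "CARD('p + 'q) > 2" and b: "pq_form b b = -1"
    and e: "pq_form e e = 1" "pq_form e b = 0" and v: "pq_form v v = 1" "pq_form v b = 0"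
  obtains h \<eta> where "special_isometry h" "\<eta> = 1 \<or> \<eta> = -1" "h *v b = \<eta> *\<^sub>R b" "h *v e = \<eta> *\<^sub>R v"
proof (cases "pq_form (e + v) (e + v) = 0")
  case False
  let ?R = "pq_reflection (e + v)"
  have ev: "pq_form (e + v) (e + v) = 2 * (1 + pq_form e v)"
    using e v pq_form_sym[of e v] by (simp add: pq_form_simps)
  have "?R *v e = e - (2 * (1 + pq_form e v) / pq_form (e + v) (e + v)) *\<^sub>R (e + v)"
    unfolding pq_reflection_mult using e by (simp add: pq_form_simps)
  then have Re: "?R *v e = - v" using False unfolding ev by simp
  have Rb: "?R *v b = b" unfolding pq_reflection_mult
    using e v pq_form_sym[of b e] pq_form_sym[of b v] by (simp add: pq_form_simps)
  have Sb: "pq_reflection b *v b = - b" "pq_reflection b *v (- v) = - v"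
    unfolding pq_reflection_mult using b v by (simp_all add: pq_form_simps algebra_simps) (simp add: scaleR_2)
  show ?thesis
    by (rule that[of "pq_reflection b ** ?R" "-1"])
      (use b False in \<open>simp_all add: two_reflections_special Rb Re Sb flip: matrix_vector_mul_assoc\<close>)
next
  case True
  then have ev: "pq_form e v = -1"
    using e v pq_form_sym[of e v] by (simp add: pq_form_simps)
  let ?R = "pq_reflection (e - v)"
  have ww: "pq_form (e - v) (e - v) = 4" using e v ev pq_form_sym[of e v] by (simp add: pq_form_simps)
  have Re: "?R *v e = v" unfolding pq_reflection_mult ww using e ev by (simp add: pq_form_simps)
  have Rb: "?R *v b = b" unfolding pq_reflection_mult
    using e v pq_form_sym[of b e] pq_form_sym[of b v] by (simp add: pq_form_simps)
  obtain z where z: "pq_form z b = 0" "pq_form z v = 0" "pq_form z z \<noteq> 0"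
    using nonisotropic_orthogonal_vector[OF card b v(1)] v(2) pq_form_sym[of v b] by metis
  have Sz: "pq_reflection z *v b = b" "pq_reflection z *v v = v"
    unfolding pq_reflection_mult using z pq_form_sym[of b z] pq_form_sym[of v z] by simp_all
  show ?thesis
    by (rule that[of "pq_reflection z ** ?R" 1])
      (use z ww in \<open>simp_all add: two_reflections_special Rb Re Sz flip: matrix_vector_mul_assoc\<close>)
qed


lemma dim_pq_orth:
  fixes T :: "(real^('p::finite + 'q::finite)) set"
  assumes "subspace T" shows "dim (pq_orth T) + dim T = CARD('p + 'q)"
proof -
  let ?f = "(*v) (form_matrix :: real^('p + 'q)^('p + 'q))"
  have inj: "inj ?f"
    by (rule inj_on_inverseI[where g = ?f]) (simp add: matrix_vector_mul_assoc form_matrix_square)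
  have "pq_orth T = {x. \<forall>y\<in>?f ` T. orthogonal y x}"
    by (auto simp: pq_orth_def pq_form_eq orthogonal_def inner_commute)
  moreover have "dim {x \<in> UNIV. \<forall>y\<in>?f ` T. orthogonal y x} + dim (?f ` T) = dim (UNIV :: (real^('p + 'q)) set)"
    using assms by (intro dim_subspace_orthogonal_to_vectors linear_subspace_image) auto
  moreover have "dim (?f ` T) = dim T" using inj by (intro dim_image_eq) (auto intro: inj_on_subset)
  ultimately show ?thesis by simp
qed

lemma subspace_pq_orth: "subspace (pq_orth T)"
  by (rule subspaceI) (auto simp: pq_orth_def pq_form_simps)

lemma definite_decomposition:
  assumes T: "subspace T" and def: "\<And>y. y \<in> T \<Longrightarrow> pq_form y y = 0 \<Longrightarrow> y = 0"
  obtains y z where "y \<in> T" "z \<in> pq_orth T" "x = y + z"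
proof -
  have "T \<inter> pq_orth T = {0}" using def subspace_0[OF T] subspace_0[OF subspace_pq_orth[of T]]
    by (auto simp: pq_orth_def)
  then have "dim {y + z |y z. y \<in> T \<and> z \<in> pq_orth T} = CARD('a + 'b)"
    using dim_sums_Int[OF T subspace_pq_orth[of T]] dim_pq_orth[OF T] by simp
  then have "{y + z |y z. y \<in> T \<and> z \<in> pq_orth T} = UNIV"
    using subspace_sums[OF T subspace_pq_orth[of T]]
    by (intro subspace_dim_equal[OF _ subspace_UNIV]) simp_all
  then have "x \<in> {y + z |y z. y \<in> T \<and> z \<in> pq_orth T}" by (simp only: UNIV_I)
  then show ?thesis using that by blast
qed

lemma pq_orth_maximal_negative:
  fixes T :: "(real^('p::finite + 'q::finite)) set"
  assumes T: "T \<in> X_G" and z: "z \<in> pq_orth T" "z \<noteq> 0"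
  shows "pq_form z z > 0"
proof (rule ccontr)
  assume neg: "\<not> pq_form z z > 0"
  have sT: "subspace T" "dim T = CARD('q)" "\<And>v. v \<in> T \<Longrightarrow> v \<noteq> 0 \<Longrightarrow> pq_form v v < 0"
    using T unfolding X_G_def by auto
  define S where "S = {x :: real^('p + 'q). \<forall>j. x $ Inr j = 0}"
  define N where "N = {x :: real^('p + 'q). \<forall>i. x $ Inl i = 0}"
  have S: "subspace S" and N: "subspace N" unfolding S_def N_def by (auto intro!: subspaceI)
  have zT: "z \<notin> T" using z sT(3)[of z] by (auto simp: pq_orth_def)
  have "dim (insert z T) = Suc (dim T)" using zT sT(1) by (simp add: dim_insert span_eq_iff[THEN iffD2])
  then have dT: "dim (span (insert z T)) = Suc (CARD('q))" using sT(2) by (simp add: dim_span)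
  have "N \<subseteq> span ((\<lambda>j. axis (Inr j) 1) ` (UNIV :: 'q set))"
  proof
    fix x assume x: "x \<in> N"
    have "x = (\<Sum>i\<in>UNIV. x $ i *\<^sub>R axis i 1)"
      using basis_expansion[of x] by (simp add: scalar_mult_eq_scaleR)
    also have "\<dots> = (\<Sum>j\<in>UNIV. x $ Inr j *\<^sub>R axis (Inr j) 1)"
      using x unfolding sum_UNIV_sum N_def by simp
    finally have "x = (\<Sum>j\<in>UNIV. x $ Inr j *\<^sub>R axis (Inr j) 1)" .
    moreover have "(\<Sum>j\<in>UNIV. x $ Inr j *\<^sub>R axis (Inr j) 1) \<in> span ((\<lambda>j. axis (Inr j) (1::real)) ` (UNIV :: 'q set) :: (real^('p + 'q)) set)"
      by (intro span_sum span_scale span_base) auto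
    ultimately show "x \<in> span ((\<lambda>j. axis (Inr j) 1) ` (UNIV :: 'q set))" by simp
  qed
  then have "dim N \<le> card ((\<lambda>j. axis (Inr j) (1::real) :: real^('p + 'q)) ` (UNIV :: 'q set))"
    by (rule dim_le_card) simp
  also have "\<dots> \<le> CARD('q)" by (rule card_image_le) simp
  finally have dN: "dim N \<le> CARD('q)" .
  have "x \<in> {a + b |a b. a \<in> S \<and> b \<in> N}" for x
  proof -
    let ?a = "\<chi> i. (case i of Inl _ \<Rightarrow> x $ i | Inr _ \<Rightarrow> 0)" and ?b = "\<chi> i. (case i of Inl _ \<Rightarrow> 0 | Inr _ \<Rightarrow> x $ i)"
    have "x = ?a + ?b" by (simp add: vec_eq_iff split: sum.split)
    moreover have "?a \<in> S" "?b \<in> N" by (simp_all add: S_def N_def)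
    ultimately show ?thesis by blast
  qed
  then have "{a + b |a b. a \<in> S \<and> b \<in> N} = UNIV" by blast
  then have "CARD('p) + CARD('q) \<le> dim S + dim N"
    using dim_sums_Int[OF S N] by simp
  then have dS: "dim S \<ge> CARD('p)" using dN by simp
  have "dim (span (insert z T) \<inter> S) \<noteq> 0"
  proof
    assume "dim (span (insert z T) \<inter> S) = 0"
    then have "dim {a + b |a b. a \<in> span (insert z T) \<and> b \<in> S} = Suc (CARD('q)) + dim S"
      using dim_sums_Int[OF subspace_span[of "insert z T"] S] dT by linarith
    moreover have "dim {a + b |a b. a \<in> span (insert z T) \<and> b \<in> S} \<le> CARD('p) + CARD('q)"
      using dim_subset_UNIV[of "{a + b |a b. a \<in> span (insert z T) \<and> b \<in> S}"] by simp
    ultimately show False using dS by simp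
  qed
  then obtain y where y: "y \<in> span (insert z T)" "y \<in> S" "y \<noteq> 0" by (auto simp: dim_eq_0)
  obtain k where "y - k *\<^sub>R z \<in> span T" using y(1) unfolding span_insert by blast
  then have "y - k *\<^sub>R z \<in> T" using sT(1) span_eq_iff by blast
  then obtain t where kt: "y = k *\<^sub>R z + t" "t \<in> T" by (metis add.commute diff_add_cancel)
  have "pq_form t t \<le> 0" using sT(3)[OF kt(2)] by (cases "t = 0") (auto simp: pq_form_simps less_imp_le)
  moreover have "pq_form z t = 0" "pq_form t z = 0" using z(1) kt(2) pq_form_sym[of z t] by (auto simp: pq_orth_def)
  then have "pq_form y y = k * k * pq_form z z + pq_form t t" unfolding kt(1) by (simp add: pq_form_simps)
  moreover have "k * k * pq_form z z \<le> 0" using neg by (simp add: mult_le_0_iff)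
  ultimately have "pq_form y y \<le> 0" by simp
  moreover have "pq_form y y = (\<Sum>i\<in>UNIV. (y $ Inl i)\<^sup>2)" using y(2) unfolding S_def pq_form_def by (simp add: power2_eq_square)
  ultimately have "(\<Sum>i\<in>UNIV. (y $ Inl i)\<^sup>2) = 0" by (smt (verit) sum_nonneg zero_le_power2)
  then have "\<forall>i. y $ Inl i = 0" by (simp add: sum_nonneg_eq_0_iff)
  then have "y $ i = 0" for i using y(2) unfolding S_def by (cases i) auto
  then show False using y(3) by (simp add: vec_eq_iff)
qed

lemma ip_of_spec:
  fixes T :: "(real^('p::finite + 'q::finite)) set"
  assumes T: "T \<in> X_G"
  shows "inner_product (ip_of T) \<and>
     (\<forall>x\<in>T. \<forall>y\<in>T. ip_of T x y = - pq_form x y) \<and>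
     (\<forall>x\<in>pq_orth T. \<forall>y\<in>pq_orth T. ip_of T x y = pq_form x y) \<and>
     (\<forall>x\<in>T. \<forall>y\<in>pq_orth T. ip_of T x y = 0)"
proof -
  have sT: "subspace T" "\<And>v. v \<in> T \<Longrightarrow> v \<noteq> 0 \<Longrightarrow> pq_form v v < 0"
    using T unfolding X_G_def by auto
  have def: "\<And>v. v \<in> T \<Longrightarrow> pq_form v v = 0 \<Longrightarrow> v = 0" using sT(2) by force
  have "\<exists>y. y \<in> T \<and> x - y \<in> pq_orth T" for x
    using definite_decomposition[OF sT(1) def, of x] by (metis add_diff_cancel_left')
  then obtain \<pi> where pi: "\<And>x. \<pi> x \<in> T" "\<And>x. x - \<pi> x \<in> pq_orth T" by metis
  have uniq: "\<pi> x = y" if "y \<in> T" "x - y \<in> pq_orth T" for x y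
  proof -
    have "\<pi> x - y \<in> T" using pi that sT(1) by (simp add: subspace_diff)
    moreover have "(x - y) - (x - \<pi> x) \<in> pq_orth T" using pi that subspace_diff[OF subspace_pq_orth] by blast
    then have "\<pi> x - y \<in> pq_orth T" by simp
    ultimately have "pq_form (\<pi> x - y) (\<pi> x - y) = 0" by (auto simp: pq_orth_def)
    then show ?thesis using def \<open>\<pi> x - y \<in> T\<close> by fastforce
  qed
  have add: "\<pi> (x + y) = \<pi> x + \<pi> y" for x y
  proof (rule uniq)
    have "(x - \<pi> x) + (y - \<pi> y) \<in> pq_orth T" using pi subspace_add[OF subspace_pq_orth] by blast
    then show "x + y - (\<pi> x + \<pi> y) \<in> pq_orth T" by (simp add: algebra_simps)
  qed (use pi sT(1) in \<open>simp add: subspace_add\<close>)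
  have scale: "\<pi> (c *\<^sub>R x) = c *\<^sub>R \<pi> x" for c x
  proof (rule uniq)
    have "c *\<^sub>R (x - \<pi> x) \<in> pq_orth T" using pi subspace_scale[OF subspace_pq_orth] by blast
    then show "c *\<^sub>R x - c *\<^sub>R \<pi> x \<in> pq_orth T" by (simp add: algebra_simps)
  qed (use pi sT(1) in \<open>simp add: subspace_scale\<close>)
  have pT: "\<pi> x = x" if "x \<in> T" for x using that by (intro uniq) (simp_all add: subspace_0[OF subspace_pq_orth])
  have pO: "\<pi> x = 0" if "x \<in> pq_orth T" for x using that by (intro uniq) (simp_all add: subspace_0[OF sT(1)])
  define B where "B x y = pq_form x y - 2 * pq_form (\<pi> x) (\<pi> y)" for x y
  have orth: "pq_form (\<pi> x) (y - \<pi> y) = 0" "pq_form (y - \<pi> y) (\<pi> x) = 0" for x y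
    using pi pq_form_sym[of "\<pi> x" "y - \<pi> y"] unfolding pq_orth_def by auto
  have Bpos: "B x x > 0" if "x \<noteq> 0" for x
  proof -
    have "pq_form x x = pq_form (\<pi> x + (x - \<pi> x)) (\<pi> x + (x - \<pi> x))" by simp
    also have "\<dots> = pq_form (\<pi> x) (\<pi> x) + pq_form (x - \<pi> x) (x - \<pi> x)"
      by (simp only: pq_form_simps(1,2) orth)
    finally have e: "B x x = - pq_form (\<pi> x) (\<pi> x) + pq_form (x - \<pi> x) (x - \<pi> x)" unfolding B_def by simp
    have 1: "\<pi> x = 0 \<or> pq_form (\<pi> x) (\<pi> x) < 0" using sT(2) pi by blast
    have 2: "x - \<pi> x = 0 \<or> pq_form (x - \<pi> x) (x - \<pi> x) > 0" using pq_orth_maximal_negative[OF T] pi by blast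
    show ?thesis
    proof (cases "\<pi> x = 0")
      case True
      then show ?thesis using 2 that e by (auto simp: pq_form_simps(7,8))
    next
      case False
      then have "pq_form (\<pi> x) (\<pi> x) < 0" using 1 by blast
      moreover have "pq_form (x - \<pi> x) (x - \<pi> x) \<ge> 0"
        using 2 by (metis less_imp_le order_refl pq_form_simps(7))
      ultimately show ?thesis using e by linarith
    qed
  qed
  have "bilinear B" unfolding bilinear_def B_def
    by (intro conjI allI linearI) (simp_all add: add scale pq_form_simps algebra_simps)
  moreover have "B x y = B y x" for x y unfolding B_def using pq_form_sym by metis
  ultimately have "inner_product B" unfolding inner_product_def using Bpos by blast
  moreover have "pq_form x y = 0" if "x \<in> T" "y \<in> pq_orth T" for x y
    using that pq_form_sym[of x y] by (simp add: pq_orth_def)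
  ultimately have BB: "inner_product B \<and> (\<forall>x\<in>T. \<forall>y\<in>T. B x y = - pq_form x y) \<and>
     (\<forall>x\<in>pq_orth T. \<forall>y\<in>pq_orth T. B x y = pq_form x y) \<and> (\<forall>x\<in>T. \<forall>y\<in>pq_orth T. B x y = 0)"
    unfolding B_def by (auto simp: pT pO pq_form_simps)
  let ?P = "\<lambda>B. inner_product B \<and> (\<forall>x\<in>T. \<forall>y\<in>T. B x y = - pq_form x y) \<and>
     (\<forall>x\<in>pq_orth T. \<forall>y\<in>pq_orth T. B x y = pq_form x y) \<and> (\<forall>x\<in>T. \<forall>y\<in>pq_orth T. B x y = 0)"
  have uniqB: "C x y = B x y" if C: "?P C" for C x y
  proof -
    have expand: "D x y = D (\<pi> x) (\<pi> y) + D (\<pi> x) (y - \<pi> y) + (D (\<pi> y) (x - \<pi> x) + D (x - \<pi> x) (y - \<pi> y))"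
      if D: "inner_product D" for D
    proof -
      have bil: "bilinear D" and sym: "D (x - \<pi> x) (\<pi> y) = D (\<pi> y) (x - \<pi> x)" using D unfolding inner_product_def by auto
      have "D x y = D (\<pi> x + (x - \<pi> x)) (\<pi> y + (y - \<pi> y))" by simp
      then show ?thesis unfolding bilinear_ladd[OF bil] bilinear_radd[OF bil] sym by simp
    qed
    show "C x y = B x y"
      unfolding expand[OF conjunct1[OF C]] expand[OF conjunct1[OF BB]] using C BB pi by simp
  qed
  have "\<exists>!B. ?P B"
  proof (rule ex1I[of ?P B])
    show "?P B" by (rule BB)
    show "C = B" if "?P C" for C using uniqB[OF that] by blast
  qed
  from theI'[of ?P, OF this] show ?thesis unfolding ip_of_def .
qed

section \<open>The polar decomposition\<close>

locale pq_base_point =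
  fixes b :: "real^('p::finite + 'q::finite)"
  assumes unit: "pq_form b b = -1"
begin

lemma b_nonzero: "b \<noteq> 0"
  using unit by (auto simp: pq_form_simps)

lemma pq_orth_base: "x \<in> pq_orth (span {b}) \<longleftrightarrow> pq_form x b = 0"
proof
  assume "x \<in> pq_orth (span {b})"
  then show "pq_form x b = 0" using span_base[of b "{b}"] unfolding pq_orth_def by blast
next
  assume "pq_form x b = 0"
  then show "x \<in> pq_orth (span {b})" unfolding pq_orth_def span_singleton by (auto simp: pq_form_simps(6))
qed

lemma J_mat_mult: "J_mat (span {b}) *v x = - x - pq_form x b *\<^sub>R b - pq_form x b *\<^sub>R b"
proof -
  define J where "J = (-1) *\<^sub>R mat 1 - outer (b + b) (form_matrix *v b)"
  have Jx: "J *v x = - x - pq_form x b *\<^sub>R b - pq_form x b *\<^sub>R b" for x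
    unfolding J_def matrix_vector_mult_diff_rdistrib outer_mult_vec scaleR_matrix_vector_assoc[symmetric]
    by (simp add: pq_form_eq[of x] inner_commute scaleR_add_right)
  have "J_mat (span {b}) = J" unfolding J_mat_def
  proof (rule the_equality)
    show "(\<forall>v\<in>span {b}. J *v v = v) \<and> (\<forall>v\<in>pq_orth (span {b}). J *v v = - v)"
      unfolding Jx Ball_def pq_orth_base
      by (auto simp: span_singleton pq_form_simps unit)
  next
    fix J' assume J': "(\<forall>v\<in>span {b}. J' *v v = v) \<and> (\<forall>v\<in>pq_orth (span {b}). J' *v v = - v)"
    have "J' *v x = J *v x" for x
    proof -
      define k where "k = pq_form x b"
      define y where "y = x + k *\<^sub>R b"
      have "y \<in> pq_orth (span {b})" unfolding pq_orth_base y_def k_def by (simp add: pq_form_simps unit)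
      then have 1: "J' *v y = - y" using J' by blast
      have 2: "J' *v b = b" using J' span_base[of b "{b}"] by blast
      have "J' *v x = J' *v (y - k *\<^sub>R b)" unfolding y_def by simp
      also have "\<dots> = - y - k *\<^sub>R b" by (simp add: matrix_vector_mult_diff_distrib matrix_vector_mult_scaleR 1 2)
      also have "\<dots> = J *v x" unfolding Jx k_def[symmetric] y_def by simp
      finally show ?thesis .
    qed
    then show "J' = J" by (simp add: matrix_eq)
  qed
  then show ?thesis using Jx by simp
qed

lemma q_space_form:
  assumes X: "X \<in> q_space (span {b})"
  shows "pq_form (X *v b) b = 0" and "X *v x = pq_form x (X *v b) *\<^sub>R b - pq_form x b *\<^sub>R (X *v b)"
proof -
  have skew: "pq_form (X *v x) y = - pq_form x (X *v y)" for x y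
    using X unfolding q_space_def so_algebra_def by (simp add: eq_neg_iff_add_eq_0)
  have anti: "J_mat (span {b}) *v (X *v (J_mat (span {b}) *v x)) = - (X *v x)" for x
  proof -
    have "(J_mat (span {b}) ** X ** J_mat (span {b})) *v x = (- X) *v x"
      using X unfolding q_space_def by simp
    moreover have "(- X) *v x = - (X *v x)" by (simp add: vec_eq_iff matrix_vector_mult_def sum_negf)
    ultimately show ?thesis by (simp add: matrix_vector_mul_assoc matrix_mul_assoc)
  qed
  show ab: "pq_form (X *v b) b = 0" using skew[of b b] pq_form_sym[of b "X *v b"] by simp
  have orth: "X *v y = pq_form y (X *v b) *\<^sub>R b" if y: "pq_form y b = 0" for y
  proof -
    have "J_mat (span {b}) *v y = - y" using y by (simp add: J_mat_mult)
    then have "J_mat (span {b}) *v (- (X *v y)) = - (X *v y)"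
      using anti[of y] by (simp add: linear_neg[OF matrix_vector_mul_linear])
    then have "X *v y - pq_form (- (X *v y)) b *\<^sub>R b - pq_form (- (X *v y)) b *\<^sub>R b = - (X *v y)"
      unfolding J_mat_mult by simp
    moreover have "pq_form (- (X *v y)) b = pq_form y (X *v b)" using skew[of y b] by (simp add: pq_form_simps)
    ultimately have "X *v y + X *v y = pq_form y (X *v b) *\<^sub>R b + pq_form y (X *v b) *\<^sub>R b"
      by (simp add: algebra_simps)
    then show ?thesis by (metis scaleR_half_double)
  qed
  define y where "y = x + pq_form x b *\<^sub>R b"
  have "pq_form y b = 0" unfolding y_def by (simp add: pq_form_simps unit)
  from orth[OF this] have "X *v y = pq_form x (X *v b) *\<^sub>R b"
    unfolding y_def using ab pq_form_sym[of b "X *v b"] by (simp add: pq_form_simps)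
  moreover have "X *v x = X *v y - pq_form x b *\<^sub>R (X *v b)"
    unfolding y_def by (simp add: matrix_vector_right_distrib matrix_vector_mult_scaleR)
  ultimately show "X *v x = pq_form x (X *v b) *\<^sub>R b - pq_form x b *\<^sub>R (X *v b)" by simp
qed

lemma p_q_space_spacelike:
  assumes T: "T \<in> S_sub (span {b})" and X: "X \<in> p_space T \<inter> q_space (span {b})" and X0: "X \<noteq> 0"
  shows "pq_form (X *v b) (X *v b) > 0"
proof -
  let ?a = "X *v b"
  have TX: "T \<in> X_G" and bT: "b \<in> T" using T span_base[of b "{b}"] unfolding S_sub_def by auto
  have sT: "subspace T" using TX unfolding X_G_def by blast
  have Xq: "X \<in> q_space (span {b})" using X by blast
  note form = q_space_form[OF Xq]
  have "?a \<noteq> 0"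
  proof
    assume "?a = 0"
    then have "X *v x = 0" for x using form(2)[of x] by (simp add: pq_form_simps)
    then show False using X0 by (simp add: matrix_eq)
  qed
  let ?B = "ip_of T"
  note spec = ip_of_spec[OF TX]
  have bil: "bilinear ?B" and symB: "?B x y = ?B y x" for x y using spec unfolding inner_product_def by auto
  have orth0: "pq_form ?a y = 0" if y: "y \<in> T" "pq_form y b = 0" for y
  proof -
    have def: "\<And>v. v \<in> T \<Longrightarrow> pq_form v v = 0 \<Longrightarrow> v = 0" using TX unfolding X_G_def by force
    obtain a1 a2 where a: "a1 \<in> T" "a2 \<in> pq_orth T" "?a = a1 + a2"
      using definite_decomposition[OF sT def] by blast
    have "?B ?a y = ?B a1 y + ?B y a2" unfolding a(3) bilinear_ladd[OF bil] using symB by simp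
    also have "\<dots> = - pq_form a1 y" using spec a y by simp
    also have "\<dots> = - pq_form ?a y" using a(2,3) y(1) by (simp add: pq_form_simps pq_orth_def)
    finally have l: "?B ?a y = - pq_form ?a y" .
    have "?B ?a y = ?B b (X *v y)" using X unfolding p_space_def by blast
    also have "\<dots> = pq_form y ?a * ?B b b"
      unfolding form(2)[of y] y(2) by (simp add: bilinear_rmul[OF bil])
    also have "?B b b = 1" using spec bT unit by simp
    finally show ?thesis using l pq_form_sym[of y ?a] by simp
  qed
  have "pq_form ?a y = 0" if y: "y \<in> T" for y
  proof -
    let ?y = "y + pq_form y b *\<^sub>R b"
    have "?y \<in> T" using sT y bT by (simp add: subspace_add subspace_scale)
    moreover have "pq_form ?y b = 0" by (simp add: pq_form_simps unit)
    ultimately have "pq_form ?a ?y = 0" by (rule orth0)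
    then show ?thesis using form(1) by (simp add: pq_form_simps)
  qed
  then have "?a \<in> pq_orth T" unfolding pq_orth_def by blast
  then show ?thesis using pq_orth_maximal_negative[OF TX] \<open>?a \<noteq> 0\<close> by blast
qed

end

locale pq_boost = pq_base_point b for b :: "real^('p::finite + 'q::finite)" +
  fixes Y :: "real^('p + 'q)^('p + 'q)" and e :: "real^('p + 'q)"
  assumes Y: "Y *v x = pq_form x e *\<^sub>R b - pq_form x b *\<^sub>R e"
    and e_unit: "pq_form e e = 1" and e_orth: "pq_form e b = 0"
begin

lemma e_orth': "pq_form b e = 0" using e_orth pq_form_sym by metis

lemma Yb: "Y *v b = e" and Ye: "Y *v e = b"
  by (simp_all add: Y unit e_unit e_orth e_orth')

lemma Y_cube: "Y ** (Y ** Y) = Y"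
proof -
  have "Y *v (Y *v (Y *v x)) = Y *v x" for x
  proof -
    have 1: "Y *v (Y *v x) = pq_form x e *\<^sub>R e - pq_form x b *\<^sub>R b"
      unfolding Y[of x] by (simp add: Yb Ye matrix_vector_mult_diff_distrib matrix_vector_mult_scaleR)
    show ?thesis
      unfolding 1 by (simp add: Yb Ye matrix_vector_mult_diff_distrib matrix_vector_mult_scaleR Y[of x])
  qed
  then show ?thesis by (simp add: matrix_eq flip: matrix_vector_mul_assoc)
qed

lemma Y_skew: "pq_form (Y *v x) y = - pq_form x (Y *v y)"
  unfolding Y by (simp add: pq_form_simps pq_form_sym[of b y] pq_form_sym[of e y] mult.commute)

lemma Y_square: "Y ** Y = outer e (form_matrix *v e) - outer b (form_matrix *v b)"
proof -
  have "(Y ** Y) *v x = (outer e (form_matrix *v e) - outer b (form_matrix *v b)) *v x" for x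
    unfolding matrix_vector_mul_assoc[symmetric] Y[of x]
    by (simp add: Yb Ye matrix_vector_mult_diff_distrib matrix_vector_mult_scaleR
        matrix_vector_mult_diff_rdistrib outer_mult_vec pq_form_eq inner_commute)
  then show ?thesis by (simp add: matrix_eq)
qed

lemma q_abs_Y: assumes "CARD('p + 'q) > 2" shows "q_abs (s *\<^sub>R Y) = s\<^sup>2"
proof -
  have "trace ((s *\<^sub>R Y) ** (s *\<^sub>R Y)) = s\<^sup>2 * trace (Y ** Y)"
    by (simp add: matrix_mult.scaleR_left matrix_mult.scaleR_right linear_scale[OF linear_trace] power2_eq_square)
  also have "trace (Y ** Y) = 2"
    unfolding Y_square linear_diff[OF linear_trace] trace_outer using e_unit unit by (simp add: pq_form_eq)
  finally have t: "trace ((s *\<^sub>R Y) ** (s *\<^sub>R Y)) = s\<^sup>2 * 2" .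
  have "real CARD('p + 'q) - 2 \<noteq> 0" using assms by linarith
  then show ?thesis unfolding q_abs_def killing_form_def t by (simp add: field_simps del: card_sum)
qed

definition E :: "real \<Rightarrow> real^('p + 'q)^('p + 'q)" where
  "E s = mat 1 + sinh s *\<^sub>R Y + (cosh s - 1) *\<^sub>R (Y ** Y)"

lemma E_0: "E 0 = mat 1" by (simp add: E_def)

lemma E_b: "E s *v b = cosh s *\<^sub>R b + sinh s *\<^sub>R e"
  unfolding E_def by (simp add: matrix_vector_mult_add_rdistrib Yb Ye algebra_simps
      flip: scaleR_matrix_vector_assoc matrix_vector_mul_assoc)

lemma E_add: "E s ** E t = E (s + t)"
proof -
  have Y4: "(Y ** Y) ** (Y ** Y) = Y ** Y" "(Y ** Y) ** Y = Y"
    using Y_cube by (simp_all add: matrix_mul_assoc)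
  have "(mat 1 + a *\<^sub>R Y + c *\<^sub>R (Y ** Y)) ** (mat 1 + a' *\<^sub>R Y + c' *\<^sub>R (Y ** Y)) =
      mat 1 + (a + a' + a * c' + c * a') *\<^sub>R Y + (c + c' + a * a' + c * c') *\<^sub>R (Y ** Y)" for a a' c c'
    by (simp add: matrix_mult.add_left matrix_mult.add_right matrix_mult.scaleR_left
        matrix_mult.scaleR_right Y_cube Y4 scaleR_add_left scaleR_add_right ac_simps)
  then have "E s ** E t = mat 1 + (sinh s + sinh t + sinh s * (cosh t - 1) + (cosh s - 1) * sinh t) *\<^sub>R Y
      + ((cosh s - 1) + (cosh t - 1) + sinh s * sinh t + (cosh s - 1) * (cosh t - 1)) *\<^sub>R (Y ** Y)"
    unfolding E_def .
  also have "sinh s + sinh t + sinh s * (cosh t - 1) + (cosh s - 1) * sinh t = sinh (s + t)"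
    by (simp add: sinh_add algebra_simps)
  also have "(cosh s - 1) + (cosh t - 1) + sinh s * sinh t + (cosh s - 1) * (cosh t - 1) = cosh (s + t) - 1"
    by (simp add: cosh_add algebra_simps)
  finally show ?thesis unfolding E_def .
qed

lemma E_inverse: "E (- s) ** E s = mat 1" "E s ** E (- s) = mat 1"
  by (simp_all add: E_add E_0)

lemma E_special: "special_isometry (E s)"
proof -
  have adj: "pq_form (E s *v x) y = pq_form x (E (- s) *v y)" for s x y
    unfolding E_def matrix_vector_mult_add_rdistrib scaleR_matrix_vector_assoc[symmetric]
      matrix_vector_mul_assoc[symmetric] matrix_vector_mul_lid sinh_minus cosh_minus
    by (simp add: pq_form_simps Y_skew)
  have iso: "pq_isometry (E s)" for s
    unfolding pq_isometry_def adj by (simp add: matrix_vector_mul_assoc E_inverse)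
  have "E s = E (s / 2) ** E (s / 2)" by (simp add: E_add)
  then have "det (E s) = det (E (s / 2)) * det (E (s / 2))" using det_mul[of "E (s / 2)" "E (s / 2)"] by simp
  then have "det (E s) \<ge> 0" by simp
  then have "det (E s) = 1" using pq_isometry_det[OF iso] by force
  then show ?thesis using iso unfolding special_isometry_def by blast
qed

lemma mat_exp_Y: "mat_exp (s *\<^sub>R Y) = E s"
proof -
  have pw: "matpow (s *\<^sub>R Y) n = s ^ n *\<^sub>R matpow Y n" for n
    by (induction n) (simp_all add: matpow_Suc matrix_mult.scaleR_left matrix_mult.scaleR_right)
  have odd: "matpow Y (Suc (2 * k)) = Y \<and> matpow Y (Suc (Suc (2 * k))) = Y ** Y" for k
    by (induction k) (simp_all add: matpow_Suc Y_cube)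
  have term_eq: "matpow (s *\<^sub>R Y) n /\<^sub>R fact n =
      (if n = 0 then mat 1 - Y ** Y else 0) + ((if even n then 0 else s ^ n /\<^sub>R fact n) *\<^sub>R Y
       + (if even n then s ^ n /\<^sub>R fact n else 0) *\<^sub>R (Y ** Y))" for n
  proof (cases "even n")
    case False
    then obtain k where "n = Suc (2 * k)" by (metis oddE Suc_eq_plus1)
    then show ?thesis using odd[of k] pw[of n] by simp
  next
    case True
    show ?thesis
    proof (cases n)
      case (Suc m)
      then obtain k where "n = Suc (Suc (2 * k))" using True by (metis oddE Suc_eq_plus1 even_Suc)
      then show ?thesis using odd[of k] pw[of n] by simp
    qed simp
  qed
  have "(\<lambda>n. matpow (s *\<^sub>R Y) n /\<^sub>R fact n) sums ((mat 1 - Y ** Y) + (sinh s *\<^sub>R Y + cosh s *\<^sub>R (Y ** Y)))"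
    unfolding term_eq
    by (intro sums_add sums_scaleR_left sinh_converges cosh_converges sums_single)
  then have "mat_exp (s *\<^sub>R Y) = (mat 1 - Y ** Y) + (sinh s *\<^sub>R Y + cosh s *\<^sub>R (Y ** Y))"
    unfolding mat_exp_def matpow_def[symmetric] by (rule sums_unique[symmetric])
  also have "\<dots> = E s" unfolding E_def by (simp add: algebra_simps)
  finally show ?thesis .
qed

lemma H_stab_rep:
  assumes "h \<in> H_stab (span {b})"
  obtains A c where "special_isometry A" "h = psl_class A" "A *v b = c *\<^sub>R b" "c = 1 \<or> c = -1"
proof -
  obtain A where A: "special_isometry A" "h = psl_class A" "psl_act h (span {b}) = span {b}"
    using assms PSO_iff unfolding H_stab_def by blast
  then have "span {b} = span {A *v b}" by (simp add: psl_act_line)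
  then obtain c where c: "A *v b = c *\<^sub>R b" using span_eq_span_iff[OF b_nonzero] by metis
  have "pq_form (A *v b) (A *v b) = -1" using A(1) unit unfolding special_isometry_def pq_isometry_def by simp
  then have "c * c = 1" unfolding c using unit by (simp add: pq_form_simps)
  then show ?thesis using that A c by (auto simp: square_eq_1_iff)
qed

lemma H_stabI:
  assumes "special_isometry A" "A *v b = c *\<^sub>R b" "c = 1 \<or> c = -1" shows "psl_class A \<in> H_stab (span {b})"
proof -
  have "span {A *v b} = span {b}" unfolding assms(2) using assms(3) by (intro span_scaleR_singleton) auto
  then show ?thesis using assms(1) PSO_iff[of "psl_class A"] unfolding H_stab_def
    by (auto simp: psl_act_line)
qed

lemma polar_decomposition_cosh:
  assumes h: "h \<in> H_stab (span {b})" "h' \<in> H_stab (span {b})"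
    and g: "g = h \<otimes>\<^bsub>PSL_group\<^esub> psl_class (E s) \<otimes>\<^bsub>PSL_group\<^esub> h'" and A: "A \<in> g"
  shows "\<bar>pq_form b (A *v b)\<bar> = cosh s"
proof -
  obtain B c where B: "special_isometry B" "h = psl_class B" "B *v b = c *\<^sub>R b" "c = 1 \<or> c = -1"
    using H_stab_rep[OF h(1)] .
  obtain B' c' where B': "special_isometry B'" "h' = psl_class B'" "B' *v b = c' *\<^sub>R b" "c' = 1 \<or> c' = -1"
    using H_stab_rep[OF h(2)] .
  have "A \<in> psl_class (B ** E s ** B')" using A unfolding g B(2) B'(2) PSL_mult .
  then obtain k where k: "k = 1 \<or> k = -1" "A = k *\<^sub>R (B ** E s ** B')" using psl_class_sign by blast
  have "A *v b = (k * c') *\<^sub>R (B *v (E s *v b))"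
    unfolding k(2) by (simp add: B'(3) matrix_vector_mult_scaleR
      flip: scaleR_matrix_vector_assoc matrix_vector_mul_assoc)
  moreover have "b = c *\<^sub>R (B *v b)" using B(3,4) by auto
  then have "pq_form b (B *v (E s *v b)) = c * pq_form (B *v b) (B *v (E s *v b))"
    by (metis pq_form_simps(5))
  then have "pq_form b (B *v (E s *v b)) = c * pq_form b (E s *v b)"
    using B(1) unfolding special_isometry_def pq_isometry_def by simp
  then have "pq_form b (B *v (E s *v b)) = - (c * cosh s)"
    unfolding E_b using unit e_orth' by (simp add: pq_form_simps)
  ultimately have "pq_form b (A *v b) = - (k * c' * c * cosh s)" by (simp add: pq_form_simps)
  then show ?thesis using k(1) B(4) B'(4) by (auto simp: abs_mult)
qed

lemma C_space_orthogonal_part: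
  assumes x: "span {x} \<in> C_space (span {b})" and x1: "pq_form x x = -1"
  obtains s v c where "s \<ge> 0" "c = 1 \<or> c = -1" "pq_form v v = 1" "pq_form v b = 0"
    "x = c *\<^sub>R (cosh s *\<^sub>R b + sinh s *\<^sub>R v)"
proof -
  obtain P where P: "plane_of_signature_1_1 P" "span {b} \<subseteq> P" "span {x} \<subseteq> P"
    using x unfolding C_space_def spacelike_geodesic_def by blast
  then obtain u w where uw: "P = span {u, w}" "pq_form u w = 0" "pq_form u u > 0" "pq_form w w < 0"
    unfolding plane_of_signature_1_1_def by blast
  have coord: "\<exists>r t. y = r *\<^sub>R u + t *\<^sub>R w" if yP: "y \<in> P" for y
  proof -
    obtain r where "y - r *\<^sub>R u \<in> span {w}" using yP unfolding uw(1) span_insert[of u] by blast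
    then obtain t where "y - r *\<^sub>R u = t *\<^sub>R w" unfolding span_singleton by blast
    then have "y = r *\<^sub>R u + t *\<^sub>R w" by (simp add: algebra_simps)
    then show ?thesis by blast
  qed
  define z where "z = x + pq_form x b *\<^sub>R b"
  have zb: "pq_form z b = 0" unfolding z_def by (simp add: pq_form_simps unit)
  have bP: "b \<in> P" and xP: "x \<in> P" using P span_base by blast+
  have "z \<in> P" unfolding z_def using bP xP unfolding uw(1) by (intro span_add span_scale)
  then obtain z1 z2 where z: "z = z1 *\<^sub>R u + z2 *\<^sub>R w" using coord by blast
  obtain b1 b2 where b: "b = b1 *\<^sub>R u + b2 *\<^sub>R w" using coord bP by blast
  let ?U = "pq_form u u" and ?W = "pq_form w w"
  have wu: "pq_form w u = 0" using uw(2) pq_form_sym by metis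
  have bb: "b1 * b1 * ?U + b2 * b2 * ?W = -1"
    using unit unfolding b by (simp add: pq_form_simps uw(2) wu mult.assoc)
  have zbU: "z1 * b1 * ?U + z2 * b2 * ?W = 0"
    using zb unfolding z by (subst (asm) b) (simp add: pq_form_simps uw(2) wu ac_simps)
  have zz: "pq_form z z = z1 * z1 * ?U + z2 * z2 * ?W"
    unfolding z by (simp add: pq_form_simps uw(2) wu mult.assoc)
  have gram: "- pq_form z z = (b1 * z2 - b2 * z1)\<^sup>2 * (?U * ?W)"
  proof -
    have "- pq_form z z = (b1 * b1 * ?U + b2 * b2 * ?W) * (z1 * z1 * ?U + z2 * z2 * ?W)
        - (z1 * b1 * ?U + z2 * b2 * ?W)\<^sup>2"
      unfolding bb zbU zz by simp
    also have "\<dots> = (b1 * z2 - b2 * z1)\<^sup>2 * (?U * ?W)" by (simp add: power2_eq_square algebra_simps)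
    finally show ?thesis .
  qed
  have UW: "?U * ?W < 0" using uw by (simp add: mult_pos_neg)
  have zz0: "pq_form z z \<ge> 0" using gram UW by (smt (verit) mult_nonneg_nonpos zero_le_power2)
  have z0: "z = 0" if "pq_form z z = 0"
  proof -
    have "b1 * z2 = b2 * z1" using gram UW that by auto
    have "z1 = - (z1 * (b1 * b1 * ?U + b2 * b2 * ?W))" unfolding bb by simp
    also have "\<dots> = - (b1 * (z1 * b1 * ?U) + b2 * (b2 * z1) * ?W)" by (simp add: algebra_simps)
    also have "\<dots> = - (b1 * (z1 * b1 * ?U + z2 * b2 * ?W))" 
      unfolding \<open>b1 * z2 = b2 * z1\<close>[symmetric] by (simp add: algebra_simps)
    finally have "z1 = 0" using zbU by simp
    have "z2 = - (z2 * (b1 * b1 * ?U + b2 * b2 * ?W))" unfolding bb by simp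
    also have "\<dots> = - (b1 * (b1 * z2) * ?U + b2 * (z2 * b2 * ?W))" by (simp add: algebra_simps)
    also have "\<dots> = - (b2 * (z1 * b1 * ?U + z2 * b2 * ?W))" 
      unfolding \<open>b1 * z2 = b2 * z1\<close> by (simp add: algebra_simps)
    finally have "z2 = 0" using zbU by simp
    then show ?thesis using \<open>z1 = 0\<close> z by simp
  qed
  define al where "al = - pq_form x b"
  have x_eq: "x = al *\<^sub>R b + z" unfolding z_def al_def by simp
  have bz: "pq_form b z = 0" using zb pq_form_sym by metis
  have "pq_form x x = - (al * al) + pq_form z z" by (subst (1 2) x_eq) (simp add: pq_form_simps unit zb bz)
  then have al2: "al * al = 1 + pq_form z z" using x1 by simp
  define c :: real where "c = (if al \<ge> 0 then 1 else -1)"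
  have c: "c = 1 \<or> c = -1" "c * c = 1" "al = c * \<bar>al\<bar>" unfolding c_def by auto
  define s where "s = arsinh (sqrt (pq_form z z))"
  have sh: "sinh s = sqrt (pq_form z z)" unfolding s_def by simp
  then have s0: "s \<ge> 0" using zz0 by (metis real_sqrt_ge_zero sinh_real_nonneg_iff)
  have "(cosh s)\<^sup>2 = \<bar>al\<bar>\<^sup>2" unfolding cosh_square_eq sh using zz0 al2 by (simp add: power2_eq_square)
  then have ch: "cosh s = \<bar>al\<bar>" by (rule power2_eq_imp_eq) auto
  show ?thesis
  proof (cases "z = 0")
    case True
    then have "x = c *\<^sub>R (cosh s *\<^sub>R b + sinh s *\<^sub>R e)" using x_eq c(3) ch sh by (simp add: pq_form_simps)
    then show ?thesis using that[OF s0 c(1) e_unit e_orth] by blast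
  next
    case False
    then have pos: "sqrt (pq_form z z) > 0" using z0 zz0 by force
    define v where "v = (c / sqrt (pq_form z z)) *\<^sub>R z"
    have sq: "sqrt (pq_form z z) * sqrt (pq_form z z) = pq_form z z" using zz0 by simp
    have "pq_form v v = (c * c) * pq_form z z / (sqrt (pq_form z z) * sqrt (pq_form z z))"
      unfolding v_def by (simp add: pq_form_simps)
    then have "pq_form v v = 1" unfolding sq c(2) using pos by simp
    moreover have "pq_form v b = 0" unfolding v_def by (simp add: pq_form_simps zb)
    moreover have "x = c *\<^sub>R (cosh s *\<^sub>R b + sinh s *\<^sub>R v)"
    proof -
      have "c *\<^sub>R (sinh s *\<^sub>R v) = (c * c) *\<^sub>R z" unfolding sh v_def using pos by simp
      then show ?thesis unfolding ch using x_eq c by (simp add: scaleR_add_right)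
    qed
    ultimately show ?thesis using that[OF s0 c(1)] by blast
  qed
qed

lemma polar_decomposition_exists:
  assumes card: "CARD('p + 'q) > 2" and g: "g \<in> C_space_group (span {b})"
  obtains s h h' where "s \<ge> 0" "h \<in> H_stab (span {b})" "h' \<in> H_stab (span {b})"
    "g = h \<otimes>\<^bsub>PSL_group\<^esub> psl_class (E s) \<otimes>\<^bsub>PSL_group\<^esub> h'"
proof -
  obtain A where A: "special_isometry A" "g = psl_class A" "span {A *v b} \<in> C_space (span {b})"
    using g PSO_iff psl_act_line unfolding C_space_group_def by (metis (mono_tags, lifting) mem_Collect_eq)
  have "pq_form (A *v b) (A *v b) = -1" using A(1) unit unfolding special_isometry_def pq_isometry_def by simp
  from C_space_orthogonal_part[OF A(3) this] obtain s v c where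
    s: "s \<ge> 0" "c = 1 \<or> c = -1" "pq_form v v = 1" "pq_form v b = 0" "A *v b = c *\<^sub>R (cosh s *\<^sub>R b + sinh s *\<^sub>R v)" .
  obtain H \<eta> where H: "special_isometry H" "\<eta> = 1 \<or> \<eta> = -1" "H *v b = \<eta> *\<^sub>R b" "H *v e = \<eta> *\<^sub>R v"
    using spacelike_transitive[OF card unit e_unit e_orth s(3,4)] .
  define B where "B = H ** E s"
  have B: "special_isometry B" unfolding B_def using H(1) E_special special_isometry_mult by blast
  define B' where "B' = form_matrix ** transpose B ** form_matrix"
  have BB': "B' ** B = mat 1" "B ** B' = mat 1"
    using pq_isometry_inverse[of B] B unfolding B'_def special_isometry_def by blast+
  have B's: "special_isometry B'"
  proof -
    have "det B * det B' = 1" using BB'(2) by (metis det_I det_mul)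
    then show ?thesis using B BB' pq_isometry_left_inverse unfolding special_isometry_def by auto
  qed
  have Bb: "B *v b = \<eta> *\<^sub>R (cosh s *\<^sub>R b + sinh s *\<^sub>R v)"
    unfolding B_def by (simp add: E_b H(3,4) matrix_vector_right_distrib matrix_vector_mult_scaleR algebra_simps
      flip: matrix_vector_mul_assoc)
  have "A *v b = (c * \<eta>) *\<^sub>R (B *v b)" unfolding Bb s(5) using H(2) by auto
  then have "(B' ** A) *v b = (c * \<eta>) *\<^sub>R b"
    by (simp add: matrix_vector_mult_scaleR matrix_vector_mul_assoc BB' flip: matrix_vector_mul_assoc[of B' A])
  then have h': "psl_class (B' ** A) \<in> H_stab (span {b})"
    by (rule H_stabI[OF special_isometry_mult[OF B's A(1)]]) (use s(2) H(2) in auto)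
  have h: "psl_class H \<in> H_stab (span {b})" using H by (intro H_stabI)
  have "A = H ** E s ** (B' ** A)" using BB'(2) unfolding B_def[symmetric] by (simp add: matrix_mul_assoc)
  then have "g = psl_class H \<otimes>\<^bsub>PSL_group\<^esub> psl_class (E s) \<otimes>\<^bsub>PSL_group\<^esub> psl_class (B' ** A)"
    unfolding A(2) PSL_mult by simp
  then show ?thesis using that[OF s(1) h h'] by blast
qed

lemma polar_proj_Y:
  assumes card: "CARD('p + 'q) > 2" and g: "g \<in> C_space_group (span {b})"
    and chamber: "bp = {s *\<^sub>R Y |s. s \<ge> 0}" and A: "A \<in> g"
  shows "\<bar>pq_form b (A *v b)\<bar> = cosh (sqrt (q_abs (polar_proj (span {b}) bp g))) \<and>
    q_abs (polar_proj (span {b}) bp g) \<ge> 0"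
proof -
  obtain s h h' where s: "s \<ge> 0" "h \<in> H_stab (span {b})" "h' \<in> H_stab (span {b})"
    "g = h \<otimes>\<^bsub>PSL_group\<^esub> psl_class (E s) \<otimes>\<^bsub>PSL_group\<^esub> h'"
    using polar_decomposition_exists[OF card g] .
  have ch: "\<bar>pq_form b (A *v b)\<bar> = cosh s" by (rule polar_decomposition_cosh[OF s(2-4) A])
  have "polar_proj (span {b}) bp g = s *\<^sub>R Y" unfolding polar_proj_def
  proof (rule the_equality)
    show "s *\<^sub>R Y \<in> bp \<and> (\<exists>h\<in>H_stab (span {b}). \<exists>h'\<in>H_stab (span {b}).
        g = h \<otimes>\<^bsub>PSL_group\<^esub> psl_class (mat_exp (s *\<^sub>R Y)) \<otimes>\<^bsub>PSL_group\<^esub> h')"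
      unfolding mat_exp_Y chamber using s by blast
  next
    fix X assume "X \<in> bp \<and> (\<exists>h\<in>H_stab (span {b}). \<exists>h'\<in>H_stab (span {b}).
        g = h \<otimes>\<^bsub>PSL_group\<^esub> psl_class (mat_exp X) \<otimes>\<^bsub>PSL_group\<^esub> h')"
    then obtain t k k' where t: "X = t *\<^sub>R Y" "t \<ge> 0" "k \<in> H_stab (span {b})" "k' \<in> H_stab (span {b})"
      "g = k \<otimes>\<^bsub>PSL_group\<^esub> psl_class (mat_exp X) \<otimes>\<^bsub>PSL_group\<^esub> k'"
      unfolding chamber by blast
    have "cosh t = cosh s" using polar_decomposition_cosh[OF t(3,4) t(5)[unfolded t(1) mat_exp_Y] A] ch by simp
    then have "t = s" using t(2) s(1) cosh_real_nonneg_less_iff by (metis linorder_neqE_linordered_idom less_irrefl)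
    then show "X = s *\<^sub>R Y" using t by simp
  qed
  then show ?thesis using ch s(1) q_abs_Y[OF card, of s] by simp
qed

end

lemma polar_proj_cosh:
  fixes b :: "real^('p::finite + 'q::finite)"
  assumes card: "CARD('p + 'q) > 2" and b: "pq_form b b = -1"
    and T: "T \<in> S_sub (span {b})" and sub: "\<bb> \<subseteq> p_space T \<inter> q_space (span {b})"
    and chamber: "closed_weyl_chamber \<bb> \<bb>\<^sub>p" and g: "g \<in> C_space_group (span {b})" and A: "A \<in> g"
  shows "\<bar>pq_form b (A *v b)\<bar> = cosh (sqrt (q_abs (polar_proj (span {b}) \<bb>\<^sub>p g))) \<and>
    q_abs (polar_proj (span {b}) \<bb>\<^sub>p g) \<ge> 0"
proof -
  interpret pq_base_point b by unfold_locales (rule b)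
  obtain X where X: "X \<in> \<bb>" "X \<noteq> 0" "\<bb>\<^sub>p = {s *\<^sub>R X | s. s \<ge> 0}"
    using chamber unfolding closed_weyl_chamber_def by blast
  have Xpq: "X \<in> p_space T \<inter> q_space (span {b})" using X(1) sub by blast
  define k where "k = sqrt (pq_form (X *v b) (X *v b))"
  have pos: "pq_form (X *v b) (X *v b) > 0" by (rule p_q_space_spacelike[OF T Xpq X(2)])
  then have k: "k > 0" "k * k = pq_form (X *v b) (X *v b)" unfolding k_def by auto
  define Y where "Y = (1 / k) *\<^sub>R X"
  define e where "e = (1 / k) *\<^sub>R (X *v b)"
  note form = q_space_form[OF IntD2[OF Xpq]]
  interpret pq_boost b Y e
  proof
    show "Y *v x = pq_form x e *\<^sub>R b - pq_form x b *\<^sub>R e" for x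
      unfolding Y_def e_def scaleR_matrix_vector_assoc[symmetric] form(2)[of x]
      by (simp add: pq_form_simps scaleR_diff_right)
    show "pq_form e e = 1" unfolding e_def using k by (simp add: pq_form_simps k(2)[symmetric])
    show "pq_form e b = 0" unfolding e_def using form(1) by (simp add: pq_form_simps)
  qed
  have "\<bb>\<^sub>p = {s *\<^sub>R Y |s. s \<ge> 0}"
  proof -
    have "s *\<^sub>R X = (s * k) *\<^sub>R Y" "s *\<^sub>R Y = (s / k) *\<^sub>R X" for s unfolding Y_def using k by simp_all
    moreover have "s * k \<ge> 0" "s / k \<ge> 0" if "s \<ge> 0" for s using that k by simp_all
    ultimately show ?thesis unfolding X(3) by blast
  qed
  then show ?thesis using polar_proj_Y[OF card g _ A] by blast
qed

section \<open>Attracting lines and the limit set\<close>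

lemma (in marked_group) word_length_comparison:
  assumes "finite_symmetric_generating_set \<Gamma> S'"
  obtains k :: real where "k > 0"
    "\<And>x. x \<in> carrier \<Gamma> \<Longrightarrow> real (word_length \<Gamma> S x) \<le> k * real (word_length \<Gamma> S' x)"
proof -
  interpret other: marked_group \<Gamma> S' by unfold_locales (rule assms)
  define k where "k = 1 + (\<Sum>s\<in>S'. len s)"
  have k: "len s \<le> k" if "s \<in> S'" for s
    using member_le_sum[of s S' len] other.gens_finite that unfolding k_def by simp
  have k0: "k > 0" unfolding k_def by (simp add: add_pos_nonneg sum_nonneg)
  have w: "set ws \<subseteq> S' \<Longrightarrow> len (other.word_val ws) \<le> k * length ws" for ws
  proof (induction ws)
    case (Cons s ws)
    have "len (s \<otimes> other.word_val ws) \<le> len s + len (other.word_val ws)"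
      using Cons.prems other.gens_carrier by (intro len_mult) auto
    then show ?case using Cons k[of s] by (simp add: algebra_simps)
  qed simp
  show ?thesis
  proof (rule that[OF k0])
    fix x assume "x \<in> carrier \<Gamma>"
    then obtain ws where "set ws \<subseteq> S'" "length ws = word_length \<Gamma> S' x" "other.word_val ws = x"
      using other.geodesic_word by blast
    then show "len x \<le> k * real (word_length \<Gamma> S' x)" using w[of ws] by simp
  qed
qed

lemma near_rank1_uminus:
  assumes "near_rank1 \<epsilon> A u v" "c = 1 \<or> c = -1" shows "near_rank1 \<epsilon> (c *\<^sub>R A) (c *\<^sub>R u) v"
proof -
  have "c *\<^sub>R A - norm (c *\<^sub>R A) *\<^sub>R outer (c *\<^sub>R u) v = c *\<^sub>R (A - norm A *\<^sub>R outer u v)"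
    using assms(2) by (auto simp: outer_scaleR_left scaleR_diff_right)
  then have "norm (c *\<^sub>R A - norm (c *\<^sub>R A) *\<^sub>R outer (c *\<^sub>R u) v) = norm (A - norm A *\<^sub>R outer u v)"
    using assms(2) by (simp only: norm_scaleR) auto
  then show ?thesis using assms unfolding near_rank1_def by auto
qed

lemma outer_self_sign: "c = 1 \<or> c = (-1::real) \<Longrightarrow> outer (c *\<^sub>R u) (c *\<^sub>R u) = outer u u"
  by (auto simp: outer_scaleR_left outer_scaleR_right vec_eq_iff)

lemma special_isometry_invertible: "special_isometry A \<Longrightarrow> invertible A"
  unfolding special_isometry_def invertible_det_nz by simp

definition attracting_lines :: "(real^'n^'n) set set \<Rightarrow> (real^'n) set set" where
  "attracting_lines R = {L. \<exists>g\<in>R. \<exists>A\<in>g. attractive_fixed_line A L}"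

lemma span_nonzero_proj_space: "x \<noteq> 0 \<Longrightarrow> span {x} \<in> proj_space" for x :: "real^'n"
  unfolding proj_space_def by (simp add: dim_singleton)

lemma limit_setI:
  fixes z :: "real^'n"
  assumes "z \<noteq> 0" and w: "w \<longlonglongrightarrow> z"
    and attr: "\<forall>\<^sub>F n in sequentially. span {w n} \<in> attracting_lines R"
  shows "span {z} \<in> limit_set R"
proof -
  have "openin proj_topology (proj_space :: (real^'n) set set)"
    unfolding openin_proj_topology
  proof
    have "{v :: real^'n. v \<noteq> 0 \<and> span {v} \<in> proj_space} = - {0}"
      using span_nonzero_proj_space by auto
    then show "open {v :: real^'n. v \<noteq> 0 \<and> span {v} \<in> proj_space}" by (simp add: open_Compl)
  qed simp
  then have "span {z} \<in> topspace proj_topology"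
    using span_nonzero_proj_space[OF assms(1)] openin_subset by blast
  moreover have "\<exists>y\<in>attracting_lines R. y \<in> U" if U: "span {z} \<in> U" "openin proj_topology U" for U
  proof -
    have "open {v. v \<noteq> 0 \<and> span {v} \<in> U}" using U(2) openin_proj_topology by blast
    from topological_tendstoD[OF w this]
    have "\<forall>\<^sub>F n in sequentially. w n \<in> {v. v \<noteq> 0 \<and> span {v} \<in> U}"
      using U(1) assms(1) by simp
    with attr have "\<forall>\<^sub>F n in sequentially. span {w n} \<in> attracting_lines R \<and> span {w n} \<in> U"
      by eventually_elim simp
    then show ?thesis using eventually_happens'[OF sequentially_bot] by blast
  qed
  ultimately show ?thesis unfolding limit_set_def attracting_lines_def[symmetric] in_closure_of by blast
qed

locale anosov_hyperbolic = hyperbolic_marked_group \<Gamma> S \<delta>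
  for \<Gamma> :: "('g, 'm) monoid_scheme" (structure) and S \<delta> +
  fixes \<rho> :: "'g \<Rightarrow> (real^('p::finite + 'q::finite)^('p + 'q)) set" and K \<alpha> :: real
  assumes non_elem: "non_elementary \<Gamma>"
    and \<rho>_hom: "\<rho> \<in> hom \<Gamma> PSL_group" and \<rho>_PSO: "\<rho> ` carrier \<Gamma> \<subseteq> PSO"
    and \<alpha>_pos: "\<alpha> > 0" and K_pos: "K > 0"
    and gap: "\<And>x. x \<in> carrier \<Gamma> \<Longrightarrow>
      \<exists>u v. near_rank1 (K * exp (- \<alpha> * real (word_length \<Gamma> S x))) (SOME A. A \<in> \<rho> x) u v"
begin

definition rep :: "'g \<Rightarrow> real^('p + 'q)^('p + 'q)" where "rep x = (SOME A. A \<in> \<rho> x)"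

lemma rep_in: assumes "x \<in> carrier \<Gamma>" shows "rep x \<in> \<rho> x"
proof -
  have "\<exists>A. A \<in> \<rho> x" using \<rho>_PSO assms PSO_iff psl_class_self by blast
  then show ?thesis unfolding rep_def by (rule someI_ex)
qed

lemma rep_special: "x \<in> carrier \<Gamma> \<Longrightarrow> special_isometry (rep x)"
  and \<rho>_eq: "x \<in> carrier \<Gamma> \<Longrightarrow> \<rho> x = psl_class (rep x)"
  using PSO_rep[OF _ rep_in[of x]] \<rho>_PSO by (simp_all add: image_subset_iff)

lemma rep_nonzero: "x \<in> carrier \<Gamma> \<Longrightarrow> rep x \<noteq> 0"
proof
  assume "x \<in> carrier \<Gamma>" "rep x = 0"
  then obtain B where "B ** (0 :: real^('p + 'q)^('p + 'q)) = (mat 1 :: real^('p + 'q)^('p + 'q))"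
    using special_isometry_invertible[OF rep_special] unfolding invertible_def by metis
  then have "(mat 1 :: real^('p + 'q)^('p + 'q)) = 0" by (simp add: matrix_mult.zero_right)
  then show False using norm_mat_1_pos[where 'n = "'p + 'q"] by simp
qed

lemma rep_mult:
  assumes "x \<in> carrier \<Gamma>" "y \<in> carrier \<Gamma>"
  obtains c where "c = 1 \<or> c = -1" "rep (x \<otimes> y) = c *\<^sub>R (rep x ** rep y)"
proof -
  have "\<rho> (x \<otimes> y) = psl_class (rep x ** rep y)"
    using hom_mult[OF \<rho>_hom assms] \<rho>_eq assms by (simp add: PSL_mult)
  then have "rep (x \<otimes> y) \<in> psl_class (rep x ** rep y)" using rep_in assms by (metis m_closed)
  then show ?thesis using psl_class_sign that by blast
qed

lemma rep_one: obtains c where "c = 1 \<or> c = -1" "rep \<one> = c *\<^sub>R mat 1"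
proof -
  obtain c where c: "c = 1 \<or> c = -1" "rep (\<one> \<otimes> \<one>) = c *\<^sub>R (rep \<one> ** rep \<one>)"
    using rep_mult[OF one_closed one_closed] .
  obtain B where B: "B ** rep \<one> = mat 1" "rep \<one> ** B = mat 1"
    using special_isometry_invertible[OF rep_special[OF one_closed]] unfolding invertible_def by blast
  have "rep \<one> ** B = c *\<^sub>R (rep \<one> ** (rep \<one> ** B))"
    using c(2) by (metis l_one matrix_mul_assoc matrix_mult.scaleR_left one_closed)
  then have "mat 1 = c *\<^sub>R rep \<one>" by (simp add: B)
  then have "rep \<one> = c *\<^sub>R mat 1" using c(1) by auto
  then show ?thesis using that c(1) by blast
qed

lemma rep_pow:
  assumes x: "x \<in> carrier \<Gamma>"
  obtains c where "c = 1 \<or> c = -1" "matpow (rep x) k = c *\<^sub>R rep (x [^] k)"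
proof -
  have "\<exists>c. (c = 1 \<or> c = -1) \<and> matpow (rep x) k = c *\<^sub>R rep (x [^] k)"
  proof (induction k)
    case 0
    obtain c where "c = 1 \<or> c = -1" "rep \<one> = c *\<^sub>R mat 1" using rep_one .
    then show ?case by (intro exI[of _ c]) auto
  next
    case (Suc k)
    then obtain c where c: "c = 1 \<or> c = -1" "matpow (rep x) k = c *\<^sub>R rep (x [^] k)" by blast
    obtain e where e: "e = 1 \<or> e = -1" "rep (x [^] k \<otimes> x) = e *\<^sub>R (rep (x [^] k) ** rep x)"
      using rep_mult[of "x [^] k" x] x by auto
    have "matpow (rep x) (Suc k) = c *\<^sub>R (rep (x [^] k) ** rep x)"
      unfolding matpow_Suc2 c(2) by (simp add: matrix_mult.scaleR_left)
    also have "rep (x [^] k) ** rep x = e *\<^sub>R rep (x [^] Suc k)" using e by auto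
    finally show ?case using c(1) e(1) by (intro exI[of _ "c * e"]) auto
  qed
  then show ?thesis using that by blast
qed

lemma rep_inv:
  assumes x: "x \<in> carrier \<Gamma>"
  obtains c where "c = 1 \<or> c = -1"
    "rep (inv x) = c *\<^sub>R (form_matrix ** transpose (rep x) ** form_matrix)"
proof -
  let ?B = "form_matrix ** transpose (rep x) ** form_matrix"
  have B: "rep x ** ?B = mat 1"
    using pq_isometry_inverse(2)[of "rep x"] rep_special[OF x] unfolding special_isometry_def by blast
  obtain c where c: "c = 1 \<or> c = -1" "rep (inv x \<otimes> x) = c *\<^sub>R (rep (inv x) ** rep x)"
    using rep_mult[of "inv x" x] x by auto
  obtain e where e: "e = 1 \<or> e = -1" "rep \<one> = e *\<^sub>R mat 1" using rep_one .
  have "e *\<^sub>R mat 1 = c *\<^sub>R (rep (inv x) ** rep x)" using c(2) e(2) x by simp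
  then have "(e *\<^sub>R mat 1) ** ?B = (c *\<^sub>R (rep (inv x) ** rep x)) ** ?B" by simp
  then have "e *\<^sub>R ?B = c *\<^sub>R rep (inv x)"
    using B by (simp add: matrix_mult.scaleR_left flip: matrix_mul_assoc)
  then have "rep (inv x) = (c * e) *\<^sub>R ?B" using c(1) by auto
  then show ?thesis using that[of "c * e"] c(1) e(1) by auto
qed

definition U :: "'g \<Rightarrow> real^('p + 'q)" where
  "U x = (SOME u. \<exists>v. near_rank1 (K * exp (- \<alpha> * len x)) (rep x) u v)"
definition V :: "'g \<Rightarrow> real^('p + 'q)" where
  "V x = (SOME v. near_rank1 (K * exp (- \<alpha> * len x)) (rep x) (U x) v)"

lemma near_UV: assumes "x \<in> carrier \<Gamma>" shows "near_rank1 (K * exp (- \<alpha> * len x)) (rep x) (U x) (V x)"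
proof -
  have "\<exists>v. near_rank1 (K * exp (- \<alpha> * len x)) (rep x) (U x) v"
    unfolding U_def using gap[OF assms] unfolding rep_def[symmetric] by (rule someI_ex)
  then show ?thesis unfolding V_def by (rule someI_ex)
qed

lemma direction_step:
  "\<exists>C>0. \<forall>x\<in>carrier \<Gamma>. \<forall>s\<in>S.
    norm (outer (U (x \<otimes> s)) (U (x \<otimes> s)) - outer (U x) (U x)) \<le> C * exp (- \<alpha> * len x)"
proof -
  define kk where "kk s = norm (form_matrix ** transpose (rep s) ** form_matrix) * norm (rep s)" for s
  define k where "k = (\<Sum>s\<in>S. kk s)"
  have k: "kk s \<le> k" if "s \<in> S" for s
    unfolding k_def using gens_finite that by (intro member_le_sum) (auto simp: kk_def)
  have k0: "k \<ge> 0" unfolding k_def by (auto intro: sum_nonneg simp: kk_def)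
  define C where "C = 2 * (K * k + K * exp \<alpha>)"
  have C: "C > 0" unfolding C_def using K_pos k0 by (simp add: add_nonneg_pos)
  have "norm (outer (U (x \<otimes> s)) (U (x \<otimes> s)) - outer (U x) (U x)) \<le> C * exp (- \<alpha> * len x)"
    if x: "x \<in> carrier \<Gamma>" and s: "s \<in> S" for x s
  proof -
    have sc: "s \<in> carrier \<Gamma>" using s gens_carrier by blast
    obtain c where c: "c = 1 \<or> c = -1" "rep (x \<otimes> s) = c *\<^sub>R (rep x ** rep s)" using rep_mult[OF x sc] .
    have "near_rank1 (K * exp (- \<alpha> * len (x \<otimes> s))) (c *\<^sub>R rep (x \<otimes> s)) (c *\<^sub>R U (x \<otimes> s)) (V (x \<otimes> s))"
      using near_rank1_uminus[OF near_UV c(1)] x sc by blast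
    moreover have cc: "c *\<^sub>R rep (x \<otimes> s) = rep x ** rep s" using c by auto
    ultimately have nr: "near_rank1 (K * exp (- \<alpha> * len (x \<otimes> s))) (rep x ** rep s) (c *\<^sub>R U (x \<otimes> s)) (V (x \<otimes> s))"
      by simp
    have "rep (x \<otimes> s) \<noteq> 0" using rep_nonzero x sc by blast
    then have nz: "rep x ** rep s \<noteq> 0" using c(2) by auto
    have "norm (rep x) * norm (rep s) \<le> kk s * norm (rep x ** rep s)"
      unfolding kk_def
      by (rule norm_mult_le_mult_inverse)
        (use pq_isometry_inverse(2)[of "rep s"] rep_special[OF sc] in \<open>auto simp: special_isometry_def\<close>)
    also have "\<dots> \<le> k * norm (rep x ** rep s)" by (intro mult_right_mono k s) simp
    finally have "norm (outer (U x) (U x) - outer (c *\<^sub>R U (x \<otimes> s)) (c *\<^sub>R U (x \<otimes> s)))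
        \<le> 2 * ((K * exp (- \<alpha> * len x)) * k + K * exp (- \<alpha> * len (x \<otimes> s)))"
      using K_pos by (intro near_rank1_mult_right_close[OF near_UV[OF x] nr nz]) auto
    also have "exp (- \<alpha> * len (x \<otimes> s)) \<le> exp \<alpha> * exp (- \<alpha> * len x)"
    proof -
      have "len x \<le> len (x \<otimes> s) + len (inv s)"
        using len_mult[of "x \<otimes> s" "inv s"] x sc by (simp add: m_assoc)
      then have "len x \<le> len (x \<otimes> s) + 1" using len_gen_le[OF s] sc by simp
      then have "\<alpha> * len x \<le> \<alpha> * (len (x \<otimes> s) + 1)" using \<alpha>_pos by (intro mult_left_mono) auto
      then show ?thesis by (simp add: algebra_simps flip: exp_add)
    qed
    finally show ?thesis unfolding outer_self_sign[OF c(1)] C_def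
      using K_pos by (simp add: norm_minus_commute algebra_simps)
  qed
  then show ?thesis using C by blast
qed

text \<open>Along the powers of \<open>h = x f\<close> the image directions converge to the attracting line of \<open>h\<close>, and the
  quasigeodesic path from \<open>x\<close> to these powers moves them by little.\<close>

lemma attracting_line_near_direction:
  "\<exists>C N \<beta>. \<beta> > 0 \<and> (\<forall>x\<in>carrier \<Gamma>. len x \<ge> N \<longrightarrow>
    (\<exists>a. norm a = 1 \<and> span {a} \<in> attracting_lines (\<rho> ` carrier \<Gamma>) \<and>
      norm (outer (U x) (U x) - outer a a) \<le> C * exp (- \<beta> * len x)))"
proof -
  obtain C where "C > 0" "\<forall>x\<in>carrier \<Gamma>. \<forall>s\<in>S.
    norm (outer (U (x \<otimes> s)) (U (x \<otimes> s)) - outer (U x) (U x)) \<le> C * exp (- \<alpha> * len x)"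
    using direction_step by auto
  note C = this(1) this(2)[THEN bspec, THEN bspec]
  obtain N D where ND: "\<forall>x\<in>carrier \<Gamma>. len x \<ge> N \<longrightarrow> (\<exists>f m p. f \<in> carrier \<Gamma> \<and> (m::nat) > 0 \<and>
        (\<forall>i::nat. p i \<in> carrier \<Gamma>) \<and> (\<forall>i. \<exists>s\<in>S. p (Suc i) = p i \<otimes> s) \<and>
        p (word_length \<Gamma> S x) = x \<and> (\<forall>k. p (k * m) = (x \<otimes> f) [^] k) \<and>
        (\<forall>i. len (p i) \<ge> real i / 2 - D))"
    using quasigeodesic_power_path[OF non_elem] by (elim exE)
  define \<beta> where "\<beta> = \<alpha> / 2"
  have beta: "\<beta> > 0" using \<alpha>_pos by (simp add: \<beta>_def)
  define C' where "C' = C * exp (\<alpha> * D)"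
  have expD: "exp (- \<alpha> * l) \<le> exp (\<alpha> * D) * exp (- \<beta> * i)" if "l \<ge> i / 2 - D" for l i :: real
  proof -
    have "\<alpha> * (i / 2 - D) \<le> \<alpha> * l" using that \<alpha>_pos by (intro mult_left_mono) auto
    then show ?thesis unfolding \<beta>_def by (simp add: algebra_simps flip: exp_add)
  qed
  have "\<exists>a. norm a = 1 \<and> span {a} \<in> attracting_lines (\<rho> ` carrier \<Gamma>) \<and>
      norm (outer (U x) (U x) - outer a a) \<le> C' / (1 - exp (- \<beta>)) * exp (- \<beta> * len x)"
    if x: "x \<in> carrier \<Gamma>" "len x \<ge> N" for x
  proof -
    obtain f m p where f: "f \<in> carrier \<Gamma>" "(m::nat) > 0" and "\<forall>i::nat. p i \<in> carrier \<Gamma>"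
        "\<forall>i. \<exists>s\<in>S. p (Suc i) = p i \<otimes> s" "p (word_length \<Gamma> S x) = x"
        "\<forall>k. p (k * m) = (x \<otimes> f) [^] k" "\<forall>i. len (p i) \<ge> real i / 2 - D"
      using ND[rule_format, OF x] by (elim exE conjE)
    note p = this(3)[THEN spec] this(4)[THEN spec] this(5) this(6)[THEN spec] this(7)[THEN spec]
    define Q where "Q i = outer (U (p i)) (U (p i))" for i
    have "norm (Q (Suc i) - Q i) \<le> C' * exp (- \<beta> * i)" for i
    proof -
      obtain s where s: "s \<in> S" "p (Suc i) = p i \<otimes> s" using p(2) by blast
      have "norm (Q (Suc i) - Q i) \<le> C * exp (- \<alpha> * len (p i))"
        unfolding Q_def s(2) by (rule C(2)[OF p(1) s(1)])
      also have "\<dots> \<le> C * (exp (\<alpha> * D) * exp (- \<beta> * i))"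
        using C(1) by (intro mult_left_mono expD p(5)) simp
      finally show ?thesis by (simp add: C'_def mult.assoc)
    qed
    from exponential_steps_convergent[OF beta this] obtain l where l: "Q \<longlonglongrightarrow> l"
      "\<And>i. norm (Q i - l) \<le> C' / (1 - exp (- \<beta>)) * exp (- \<beta> * i)" by blast
    define h where "h = x \<otimes> f"
    have h: "h \<in> carrier \<Gamma>" using x f by (simp add: h_def)
    define A where "A = rep h"
    define B where "B = form_matrix ** transpose A ** form_matrix"
    have AB: "A ** B = mat 1" "B ** A = mat 1"
      using pq_isometry_inverse[of A] rep_special[OF h] unfolding A_def B_def special_isometry_def by blast+
    have "\<forall>k. \<exists>c. (c = 1 \<or> c = -1) \<and> matpow A k = c *\<^sub>R rep (h [^] k)"
      using rep_pow[OF h] unfolding A_def by metis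
    then obtain c where c: "\<And>k. c k = 1 \<or> c k = -1" "\<And>k. matpow A k = c k *\<^sub>R rep (h [^] k)" by metis
    have near: "near_rank1 (K * exp (\<alpha> * D) * exp (- (\<beta> * m) * k)) (matpow A k)
        (c k *\<^sub>R U (h [^] k)) (V (h [^] k))" for k
    proof -
      have "near_rank1 (K * exp (- \<alpha> * len (h [^] k))) (matpow A k) (c k *\<^sub>R U (h [^] k)) (V (h [^] k))"
        unfolding c(2) using h by (intro near_rank1_uminus near_UV c(1)) simp
      moreover have "len (h [^] k) \<ge> real (k * m) / 2 - D" using p(4,5)[of "k * m"] p(4)[of k] by (metis h_def p(5))
      then have "exp (- \<alpha> * len (h [^] k)) \<le> exp (\<alpha> * D) * exp (- \<beta> * real (k * m))" by (rule expD)
      then have "K * exp (- \<alpha> * len (h [^] k)) \<le> K * (exp (\<alpha> * D) * exp (- \<beta> * real (k * m)))"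
        using K_pos by (intro mult_left_mono) auto
      then have "K * exp (- \<alpha> * len (h [^] k)) \<le> K * exp (\<alpha> * D) * exp (- (\<beta> * m) * k)"
        by (simp add: mult.assoc mult.commute[of "real k"])
      ultimately show ?thesis using near_rank1_mono by blast
    qed
    have "\<beta> * m > 0" using beta f(2) by simp
    from exponential_gap_dominant[OF AB this near]
    obtain a b r where a: "norm a = 1" "a \<bullet> b = 1" "r \<noteq> 0"
      "A ** outer a b = r *\<^sub>R outer a b" "outer a b ** A = r *\<^sub>R outer a b"
      "(\<lambda>k. (1 / r ^ k) *\<^sub>R matpow A k) \<longlonglongrightarrow> outer a b"
      "(\<lambda>k. outer (c k *\<^sub>R U (h [^] k)) (c k *\<^sub>R U (h [^] k))) \<longlonglongrightarrow> outer a a" by blast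
    have "attractive_fixed_line A (span {a})" by (rule attractive_fixed_line_of_power_limit[OF a(2-6)])
    then have attr: "span {a} \<in> attracting_lines (\<rho> ` carrier \<Gamma>)"
      unfolding attracting_lines_def using rep_in[OF h] h A_def by blast
    have "strict_mono (\<lambda>k. k * m)" using f(2) by (simp add: strict_mono_def)
    from LIMSEQ_subseq_LIMSEQ[OF l(1) this] have "(\<lambda>k. Q (k * m)) \<longlonglongrightarrow> l" by (simp add: o_def)
    moreover have "Q (k * m) = outer (c k *\<^sub>R U (h [^] k)) (c k *\<^sub>R U (h [^] k))" for k
      unfolding Q_def p(4) outer_self_sign[OF c(1)] h_def ..
    ultimately have "l = outer a a" using a(7) LIMSEQ_unique by simp
    then have "norm (outer (U x) (U x) - outer a a) \<le> C' / (1 - exp (- \<beta>)) * exp (- \<beta> * len x)"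
      using l(2)[of "word_length \<Gamma> S x"] unfolding Q_def p(3) by simp
    then show ?thesis using a(1) attr by blast
  qed
  then have "\<forall>x\<in>carrier \<Gamma>. len x \<ge> N \<longrightarrow>
    (\<exists>a. norm a = 1 \<and> span {a} \<in> attracting_lines (\<rho> ` carrier \<Gamma>) \<and>
      norm (outer (U x) (U x) - outer a a) \<le> C' / (1 - exp (- \<beta>)) * exp (- \<beta> * len x))" by simp
  with beta show ?thesis by blast
qed

lemma limit_direction_in_limit_set:
  assumes x: "\<And>n. x n \<in> carrier \<Gamma>" and inf: "filterlim (\<lambda>n. len (x n)) at_top sequentially"
    and M: "(\<lambda>n. c n *\<^sub>R rep (x n)) \<longlonglongrightarrow> M" and My: "M *v y \<noteq> 0"
  shows "span {M *v y} \<in> limit_set (\<rho> ` carrier \<Gamma>)"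
proof -
  obtain C N \<beta> where attr: "\<beta> > 0" "\<forall>x\<in>carrier \<Gamma>. len x \<ge> N \<longrightarrow>
    (\<exists>a. norm a = 1 \<and> span {a} \<in> attracting_lines (\<rho> ` carrier \<Gamma>) \<and>
      norm (outer (U x) (U x) - outer a a) \<le> C * exp (- \<beta> * len x))"
    using attracting_line_near_direction by (elim exE conjE)
  have exp0: "(\<lambda>n. exp (- k * len (x n))) \<longlonglongrightarrow> 0" if "k > 0" for k
  proof -
    have "filterlim (\<lambda>n. - k * len (x n)) at_bot sequentially"
      using filterlim_tendsto_pos_mult_at_top[OF tendsto_const that inf]
      by (simp add: filterlim_uminus_at_bot)
    then show ?thesis by (rule filterlim_compose[OF exp_at_bot])
  qed
  have "\<forall>n. \<exists>a. len (x n) \<ge> N \<longrightarrow> norm a = 1 \<and> span {a} \<in> attracting_lines (\<rho> ` carrier \<Gamma>) \<and>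
      norm (outer (U (x n)) (U (x n)) - outer a a) \<le> C * exp (- \<beta> * len (x n))"
    using attr(2) x by simp
  then obtain a where a: "\<And>n. len (x n) \<ge> N \<Longrightarrow> norm (a n) = 1 \<and>
      span {a n} \<in> attracting_lines (\<rho> ` carrier \<Gamma>) \<and>
      norm (outer (U (x n)) (U (x n)) - outer (a n) (a n)) \<le> C * exp (- \<beta> * len (x n))" by metis
  have largeN: "\<forall>\<^sub>F n in sequentially. len (x n) \<ge> N" using inf by (simp add: filterlim_at_top)
  define u where "u n = U (x n)" for n
  define \<epsilon> where "\<epsilon> n = K * exp (- \<alpha> * len (x n))" for n
  define b where "b n = norm (c n *\<^sub>R rep (x n)) * norm y" for n
  define t where "t n = c n * norm (rep (x n)) * (V (x n) \<bullet> y)" for n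
  have near: "norm (u n) = 1" "norm (V (x n)) = 1"
    "norm (rep (x n) - norm (rep (x n)) *\<^sub>R outer (u n) (V (x n))) \<le> \<epsilon> n * norm (rep (x n))" for n
    using near_UV[OF x] unfolding near_rank1_def u_def \<epsilon>_def by auto
  have lim_b: "b \<longlonglongrightarrow> norm M * norm y" unfolding b_def by (intro tendsto_intros M)
  have tb: "\<bar>t n\<bar> \<le> b n" for n
  proof -
    have "\<bar>t n\<bar> = norm (c n *\<^sub>R rep (x n)) * \<bar>V (x n) \<bullet> y\<bar>" unfolding t_def by (simp add: abs_mult)
    also have "\<dots> \<le> norm (c n *\<^sub>R rep (x n)) * (norm (V (x n)) * norm y)"
      by (intro mult_left_mono Cauchy_Schwarz_ineq2) simp
    finally show ?thesis unfolding b_def near(2) by simp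
  qed
  have d1: "norm ((c n *\<^sub>R rep (x n)) *v y - t n *\<^sub>R u n) \<le> \<epsilon> n * b n" for n
  proof -
    have "(c n *\<^sub>R rep (x n)) *v y - t n *\<^sub>R u n = c n *\<^sub>R ((rep (x n) - norm (rep (x n)) *\<^sub>R outer (u n) (V (x n))) *v y)"
      unfolding t_def by (simp add: matrix_vector_mult_diff_rdistrib outer_mult_vec scaleR_diff_right
          flip: scaleR_matrix_vector_assoc)
    then have "norm ((c n *\<^sub>R rep (x n)) *v y - t n *\<^sub>R u n) =
        \<bar>c n\<bar> * norm ((rep (x n) - norm (rep (x n)) *\<^sub>R outer (u n) (V (x n))) *v y)" by simp
    also have "\<dots> \<le> \<bar>c n\<bar> * ((\<epsilon> n * norm (rep (x n))) * norm y)"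
      by (intro mult_left_mono order_trans[OF norm_matrix_vector_mult] mult_right_mono near(3)) auto
    finally show ?thesis unfolding b_def by (simp add: mult.commute mult.left_commute)
  qed
  define w where "w n = (t n * (a n \<bullet> u n)) *\<^sub>R a n" for n
  have d2: "norm (t n *\<^sub>R u n - w n) \<le> b n * (C * exp (- \<beta> * len (x n)))" if "len (x n) \<ge> N" for n
  proof -
    have uu: "u n \<bullet> u n = 1" using near(1) by (simp add: norm_eq_1)
    have "t n *\<^sub>R u n - w n = t n *\<^sub>R ((outer (u n) (u n) - outer (a n) (a n)) *v u n)"
      unfolding w_def by (simp add: matrix_vector_mult_diff_rdistrib outer_mult_vec uu scaleR_diff_right)
    then have "norm (t n *\<^sub>R u n - w n) = \<bar>t n\<bar> * norm ((outer (u n) (u n) - outer (a n) (a n)) *v u n)" by simp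
    also have "\<dots> \<le> b n * (norm (outer (u n) (u n) - outer (a n) (a n)) * norm (u n))"
      by (intro mult_mono tb norm_matrix_vector_mult) (auto simp: b_def)
    also have "\<dots> \<le> b n * (C * exp (- \<beta> * len (x n)))"
      using a[OF that] near(1)[of n] unfolding u_def by (intro mult_left_mono) (auto simp: b_def)
    finally show ?thesis .
  qed
  have "(\<lambda>n. (c n *\<^sub>R rep (x n)) *v y - w n) \<longlonglongrightarrow> 0"
  proof (rule Lim_null_comparison)
    show "\<forall>\<^sub>F n in sequentially. norm ((c n *\<^sub>R rep (x n)) *v y - w n) \<le> \<epsilon> n * b n + b n * (C * exp (- \<beta> * len (x n)))"
      using largeN
    proof eventually_elim
      case (elim n)
      show ?case
        using norm_triangle_ineq[of "(c n *\<^sub>R rep (x n)) *v y - t n *\<^sub>R u n" "t n *\<^sub>R u n - w n"] d1[of n] d2[OF elim]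
        by simp
    qed
    have "\<epsilon> \<longlonglongrightarrow> K * 0" unfolding \<epsilon>_def by (intro tendsto_mult tendsto_const exp0 \<alpha>_pos)
    then have "(\<lambda>n. \<epsilon> n * b n + b n * (C * exp (- \<beta> * len (x n))))
        \<longlonglongrightarrow> (K * 0) * (norm M * norm y) + (norm M * norm y) * (C * 0)"
      by (intro tendsto_add tendsto_mult lim_b tendsto_const exp0 attr(1))
    then show "(\<lambda>n. \<epsilon> n * b n + b n * (C * exp (- \<beta> * len (x n)))) \<longlonglongrightarrow> 0" by simp
  qed
  moreover have My_lim: "(\<lambda>n. (c n *\<^sub>R rep (x n)) *v y) \<longlonglongrightarrow> M *v y"
  proof -
    have "bounded_linear (\<lambda>M :: real^('p + 'q)^('p + 'q). M *v y)"
      by (intro bounded_linearI' matrix_vector_mult_add_rdistrib) (simp add: scaleR_matrix_vector_assoc)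
    from bounded_linear.tendsto[OF this M] show ?thesis .
  qed
  ultimately have wlim: "w \<longlonglongrightarrow> M *v y"
    using tendsto_diff[OF My_lim, of "\<lambda>n. (c n *\<^sub>R rep (x n)) *v y - w n" 0] by simp
  show ?thesis
  proof (rule limit_setI[OF My wlim])
    have "\<forall>\<^sub>F n in sequentially. w n \<noteq> 0" using tendsto_imp_eventually_ne[OF wlim My] .
    with largeN show "\<forall>\<^sub>F n in sequentially. span {w n} \<in> attracting_lines (\<rho> ` carrier \<Gamma>)"
    proof eventually_elim
      case (elim n)
      then have "span {w n} = span {a n}" unfolding w_def by (intro span_scaleR_singleton) auto
      then show ?case using a[OF elim(1)] by simp
    qed
  qed
qed

lemma filterlim_len_inj:
  assumes "inj x" "\<And>n. x n \<in> carrier \<Gamma>" shows "filterlim (\<lambda>n::nat. len (x n)) at_top sequentially"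
  unfolding filterlim_at_top
proof
  fix Z
  have "finite (x -` {y \<in> carrier \<Gamma>. len y \<le> Z})" by (rule finite_vimageI[OF finite_len_ball assms(1)])
  then have "\<forall>\<^sub>F n in sequentially. n \<notin> x -` {y \<in> carrier \<Gamma>. len y \<le> Z}"
    by (simp add: eventually_cofinite flip: cofinite_eq_sequentially)
  then show "\<forall>\<^sub>F n in sequentially. Z \<le> len (x n)"
    by eventually_elim (use assms(2) in auto)
qed

lemma finite_bounded_matrix_coefficient:
  assumes card: "CARD('p + 'q) > 2" and bO: "span {b} \<in> Omega (\<rho> ` carrier \<Gamma>)" and b0: "b \<noteq> 0"
  shows "finite {x \<in> carrier \<Gamma>. \<bar>pq_form b (rep x *v b)\<bar> \<le> c}"
proof (rule ccontr)
  assume "infinite {x \<in> carrier \<Gamma>. \<bar>pq_form b (rep x *v b)\<bar> \<le> c}"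
  then obtain x0 :: "nat \<Rightarrow> 'g" where x0: "inj x0" "range x0 \<subseteq> {x \<in> carrier \<Gamma>. \<bar>pq_form b (rep x *v b)\<bar> \<le> c}"
    using infinite_countable_subset by blast
  define M0 where "M0 n = (1 / norm (rep (x0 n))) *\<^sub>R rep (x0 n)" for n
  have x0c: "x0 n \<in> carrier \<Gamma>" for n using x0(2) by blast
  have "norm (M0 n) = 1" for n using rep_nonzero[OF x0c] by (simp add: M0_def)
  moreover have "norm (U (x0 n)) = 1" "norm (V (x0 n)) = 1" for n
    using near_UV[OF x0c] unfolding near_rank1_def by auto
  moreover define Z where "Z = sphere (0 :: real^('p + 'q)^('p + 'q)) 1 \<times> sphere (0 :: real^('p + 'q)) 1
    \<times> sphere (0 :: real^('p + 'q)) 1"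
  moreover define F where "F n = (M0 n, U (x0 n), V (x0 n))" for n
  ultimately have memb: "\<forall>n. F n \<in> Z" by simp
  have "compact Z" unfolding Z_def by (intro compact_Times compact_sphere)
  from seq_compactE[OF compact_imp_seq_compact[OF this] memb]
  obtain L r where L: "L \<in> Z" "strict_mono (r :: nat \<Rightarrow> nat)" "(F \<circ> r) \<longlonglongrightarrow> L" by blast
  obtain M u v where Muv: "L = (M, u, v)" by (cases L)
  define x where "x n = x0 (r n)" for n
  have xc: "x n \<in> carrier \<Gamma>" for n using x0c by (simp add: x_def)
  have xb: "\<bar>pq_form b (rep (x n) *v b)\<bar> \<le> c" for n using x0(2) unfolding x_def by blast
  have "inj x" unfolding x_def
    using inj_compose[OF x0(1) strict_mono_imp_inj_on[OF L(2)]] by (simp add: o_def)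
  then have inf: "filterlim (\<lambda>n. len (x n)) at_top sequentially" using filterlim_len_inj xc by blast
  have M: "(\<lambda>n. (1 / norm (rep (x n))) *\<^sub>R rep (x n)) \<longlonglongrightarrow> M"
    and u: "(\<lambda>n. U (x n)) \<longlonglongrightarrow> u" and v: "(\<lambda>n. V (x n)) \<longlonglongrightarrow> v"
    using tendsto_fst[OF L(3)] tendsto_fst[OF tendsto_snd[OF L(3)]] tendsto_snd[OF tendsto_snd[OF L(3)]]
    unfolding Muv x_def M0_def F_def by (simp_all add: o_def)
  have M1: "norm M = 1" using L(1) unfolding Muv Z_def by simp
  have Mo: "M = outer u v"
  proof -
    have "(\<lambda>n. (1 / norm (rep (x n))) *\<^sub>R rep (x n) - outer (U (x n)) (V (x n))) \<longlonglongrightarrow> 0"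
    proof (rule Lim_null_comparison)
      show "\<forall>\<^sub>F n in sequentially. norm ((1 / norm (rep (x n))) *\<^sub>R rep (x n) - outer (U (x n)) (V (x n)))
        \<le> K * exp (- \<alpha> * len (x n))"
        by (intro always_eventually allI near_rank1_normalized near_UV rep_nonzero xc)
      have "filterlim (\<lambda>n. - \<alpha> * len (x n)) at_bot sequentially"
        using filterlim_tendsto_pos_mult_at_top[OF tendsto_const \<alpha>_pos inf]
        by (simp add: filterlim_uminus_at_bot)
      from filterlim_compose[OF exp_at_bot this] show "(\<lambda>n. K * exp (- \<alpha> * len (x n))) \<longlonglongrightarrow> 0"
        by (rule tendsto_mult_right_zero)
    qed
    moreover have "(\<lambda>n. (1 / norm (rep (x n))) *\<^sub>R rep (x n) - outer (U (x n)) (V (x n))) \<longlonglongrightarrow> M - outer u v"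
      by (intro tendsto_diff M bounded_bilinear.tendsto[OF bounded_bilinear_outer] u v)
    ultimately have "M - outer u v = 0" using LIMSEQ_unique by blast
    then show ?thesis by simp
  qed
  have detM: "det M = 0"
  proof -
    have "v \<noteq> 0" using M1 unfolding Mo norm_outer by auto
    then have "dim {y. v \<bullet> y = 0} = CARD('p + 'q) - 1" by (simp add: dim_hyperplane)
    then have "dim {y. v \<bullet> y = 0} \<noteq> 0" using card by simp
    then obtain y where "y \<noteq> 0" "v \<bullet> y = 0" by (auto simp: dim_eq_0)
    then have "M *v y = 0" unfolding Mo outer_mult_vec by simp
    then have "\<not> invertible M" using \<open>y \<noteq> 0\<close> matrix_left_invertible_ker[of M] unfolding invertible_def by blast
    then show ?thesis by (simp add: invertible_det_nz)
  qed
  define \<eta> where "\<eta> n = 1 / norm (rep (x n))" for n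
  have eta: "\<eta> \<longlonglongrightarrow> 0"
  proof -
    have "(\<lambda>n. det (\<eta> n *\<^sub>R rep (x n))) \<longlonglongrightarrow> det M"
      using M unfolding \<eta>_def det_def by (intro tendsto_intros tendsto_vec_nth) 
    moreover have "det (\<eta> n *\<^sub>R rep (x n)) = \<eta> n ^ CARD('p + 'q)" for n
    proof -
      have "\<eta> n *\<^sub>R rep (x n) = (\<eta> n *\<^sub>R mat 1) ** rep (x n)" by (simp add: matrix_mult.scaleR_left)
      moreover have "det (\<eta> n *\<^sub>R mat 1 :: real^('p + 'q)^('p + 'q)) = \<eta> n ^ CARD('p + 'q)"
        by (subst det_diagonal) (auto simp: mat_def)
      ultimately show ?thesis using rep_special[OF xc[of n]] unfolding special_isometry_def by (simp add: det_mul)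
    qed
    ultimately have pw: "(\<lambda>n. \<eta> n ^ CARD('p + 'q)) \<longlonglongrightarrow> 0" using detM by simp
    have eta0: "\<eta> n \<ge> 0" for n by (simp add: \<eta>_def)
    show ?thesis
    proof (rule order_tendstoI)
      fix e :: real assume "e < 0"
      then show "\<forall>\<^sub>F n in sequentially. e < \<eta> n" using eta0 by (intro always_eventually allI) (rule less_le_trans)
    next
      fix e :: real assume e: "0 < e"
      then have "\<forall>\<^sub>F n in sequentially. \<eta> n ^ CARD('p + 'q) < e ^ CARD('p + 'q)"
        by (intro order_tendstoD(2)[OF pw]) simp
      then show "\<forall>\<^sub>F n in sequentially. \<eta> n < e"
        by eventually_elim (use e in \<open>auto intro: power_less_imp_less_base\<close>)
    qed
  qed
  have Fb: "pq_form b (M *v b) = 0"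
  proof -
    have "bounded_linear (\<lambda>M :: real^('p + 'q)^('p + 'q). pq_form b (M *v b))"
      by (intro bounded_linearI')
        (simp_all add: matrix_vector_mult_add_rdistrib pq_form_simps flip: scaleR_matrix_vector_assoc)
    from bounded_linear.tendsto[OF this M]
    have "(\<lambda>n. pq_form b ((\<eta> n *\<^sub>R rep (x n)) *v b)) \<longlonglongrightarrow> pq_form b (M *v b)" unfolding \<eta>_def .
    moreover have "(\<lambda>n. pq_form b ((\<eta> n *\<^sub>R rep (x n)) *v b)) \<longlonglongrightarrow> 0"
    proof (rule Lim_null_comparison)
      show "\<forall>\<^sub>F n in sequentially. norm (pq_form b ((\<eta> n *\<^sub>R rep (x n)) *v b)) \<le> \<eta> n * c"
        using xb by (intro always_eventually allI)
          (simp add: pq_form_simps abs_mult \<eta>_def divide_right_mono flip: scaleR_matrix_vector_assoc)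
      show "(\<lambda>n. \<eta> n * c) \<longlonglongrightarrow> 0" using eta by (rule tendsto_mult_left_zero)
    qed
    ultimately show ?thesis using LIMSEQ_unique by blast
  qed
  have contra: False if "w \<noteq> 0" "span {w} \<in> limit_set (\<rho> ` carrier \<Gamma>)" "pq_form b w = 0" for w
  proof -
    have "b \<in> span {b} - {0}" "w \<in> span {w} - {0}" using b0 that(1) by (auto intro: span_base)
    then show False using bO that(2,3) unfolding Omega_def by blast
  qed
  show False
  proof (cases "M *v b = 0")
    case False
    show False by (rule contra[OF False limit_direction_in_limit_set[OF xc inf M False] Fb])
  next
    case True
    let ?adj = "\<lambda>A :: real^('p + 'q)^('p + 'q). form_matrix ** transpose A ** form_matrix"
    have "\<forall>n. \<exists>e. (e = 1 \<or> e = -1) \<and> rep (inv (x n)) = e *\<^sub>R ?adj (rep (x n))"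
      using rep_inv[OF xc] by metis
    then obtain e where e: "\<And>n. e n = 1 \<or> e n = -1" "\<And>n. rep (inv (x n)) = e n *\<^sub>R ?adj (rep (x n))" by metis
    have "bounded_linear ?adj"
    proof (intro bounded_linearI')
      have t: "transpose (A + B) = transpose A + transpose B" "transpose (k *\<^sub>R A) = k *\<^sub>R transpose A"
        for A B :: "real^('p + 'q)^('p + 'q)" and k by (simp_all add: vec_eq_iff transpose_def)
      show "?adj (A + B) = ?adj A + ?adj B" "?adj (k *\<^sub>R A) = k *\<^sub>R ?adj A" for A B k
        unfolding t by (simp_all add: matrix_mult.add_left matrix_mult.add_right
            matrix_mult.scaleR_left matrix_mult.scaleR_right)
    qed
    note lin = this
    have "?adj (\<eta> n *\<^sub>R rep (x n)) = (\<eta> n * e n) *\<^sub>R rep (inv (x n))" for n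
      unfolding e(2) linear_scale[OF bounded_linear.linear[OF lin]] using e(1)[of n] by auto
    then have lim: "(\<lambda>n. (\<eta> n * e n) *\<^sub>R rep (inv (x n))) \<longlonglongrightarrow> ?adj M"
      using bounded_linear.tendsto[OF lin M] unfolding \<eta>_def[symmetric] by simp
    have adjF: "pq_form b (?adj M *v y) = pq_form (M *v b) y" for y
    proof -
      have "form_matrix *v (?adj M *v y) = transpose M *v (form_matrix *v y)"
        by (simp add: matrix_vector_mul_assoc matrix_mul_assoc form_matrix_square del: transpose_matrix_vector)
      then have "pq_form b (?adj M *v y) = b \<bullet> (transpose M *v (form_matrix *v y))" by (simp only: pq_form_eq)
      also have "\<dots> = (M *v b) \<bullet> (form_matrix *v y)"
        by (simp flip: dot_lmul_matrix del: transpose_matrix_vector)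
      finally show ?thesis by (simp only: pq_form_eq)
    qed
    have "?adj M \<noteq> 0"
    proof
      assume "?adj M = 0"
      moreover have "form_matrix ** ?adj M ** form_matrix
          = (form_matrix ** form_matrix) ** transpose M ** (form_matrix ** form_matrix)"
        by (simp only: matrix_mul_assoc)
      ultimately have "transpose M = 0"
        by (simp add: form_matrix_square matrix_mult.zero_left matrix_mult.zero_right)
      then show False using M1 norm_transpose[of M] by simp
    qed
    then obtain y where y: "?adj M *v y \<noteq> 0" by (auto simp: matrix_eq)
    have "filterlim (\<lambda>n. len (inv (x n))) at_top sequentially" using inf xc by simp
    from limit_direction_in_limit_set[OF _ this lim y] xc
    have "span {?adj M *v y} \<in> limit_set (\<rho> ` carrier \<Gamma>)" by simp
    then show False using contra[OF y] adjF[of y] True by (simp add: pq_form_simps)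
  qed
qed

end

theorem proposition6p8:
  fixes \<Gamma> :: "('g, 'm) monoid_scheme" and S :: "'g set"
    and ip :: "real^('p::finite + 'q::finite) \<Rightarrow> real^('p + 'q) \<Rightarrow> real"
    and \<rho> :: "'g \<Rightarrow> (real^('p + 'q)^('p + 'q)) set"
    and pt \<tau> :: "(real^('p + 'q)) set"
    and \<bb> \<bb>\<^sub>p :: "(real^('p + 'q)^('p + 'q)) set"
    and t :: real
  assumes "CARD('p) + CARD('q) > 2"
    and "word_hyperbolic \<Gamma>" and "non_elementary \<Gamma>"
    and "finite_symmetric_generating_set \<Gamma> S" and "inner_product ip"
    and "pq_anosov \<Gamma> S ip \<rho>"
    and "pt \<in> Omega (\<rho> ` carrier \<Gamma>)"
    and "\<tau> \<in> S_sub pt"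
    and "maximal_subalgebra_in (p_space \<tau> \<inter> q_space pt) \<bb>"
    and "closed_weyl_chamber \<bb> \<bb>\<^sub>p"
    and "t \<ge> 0"
  shows "finite {\<gamma> \<in> carrier \<Gamma>. \<rho> \<gamma> \<in> C_space_group pt \<and>
                   sqrt (q_abs (polar_proj pt \<bb>\<^sub>p (\<rho> \<gamma>))) \<le> t}"
proof -
  have card: "CARD('p + 'q) > 2" using assms(1) by simp
  obtain S' \<delta> where S': "group \<Gamma>" "finite_symmetric_generating_set \<Gamma> S'" "\<delta> \<ge> 0"
    "\<And>w x y z. \<lbrakk>w \<in> carrier \<Gamma>; x \<in> carrier \<Gamma>; y \<in> carrier \<Gamma>; z \<in> carrier \<Gamma>\<rbrakk> \<Longrightarrow>
      gromov_product \<Gamma> S' w x z \<ge> min (gromov_product \<Gamma> S' w x y) (gromov_product \<Gamma> S' w y z) - \<delta>"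
    using assms(2) unfolding word_hyperbolic_def by blast
  interpret hyperbolic_marked_group \<Gamma> S' \<delta>
    using S' by (intro hyperbolic_marked_group.intro marked_group.intro marked_group_axioms.intro
        hyperbolic_marked_group_axioms.intro)
  obtain k where k: "k > 0" "\<And>x. x \<in> carrier \<Gamma> \<Longrightarrow> len x \<le> k * real (word_length \<Gamma> S x)"
    using word_length_comparison[OF assms(4)] by blast
  obtain C \<alpha> where C: "\<alpha> > 0" "\<And>x. x \<in> carrier \<Gamma> \<Longrightarrow>
      log_sv ip 1 (\<rho> x) - log_sv ip 2 (\<rho> x) \<ge> \<alpha> * real (word_length \<Gamma> S x) - C"
    and \<rho>: "\<rho> \<in> hom \<Gamma> PSL_group" "\<rho> ` carrier \<Gamma> \<subseteq> PSO"
    using assms(6) unfolding pq_anosov_def projective_anosov_def by blast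
  have "CARD('p + 'q) \<ge> 2" using card by simp
  from singular_value_gap_near_rank1[OF assms(5) this] obtain K where K: "K > 0"
    "\<And>A. invertible A \<Longrightarrow> \<exists>u w. near_rank1
      (K * exp (- (ln (singular_values ip A ! 0) - ln (singular_values ip A ! 1)))) A u w" by blast
  have gap: "\<exists>u v. near_rank1 (K * exp C * exp (- (\<alpha> / k) * len x)) (SOME A. A \<in> \<rho> x) u v"
    if x: "x \<in> carrier \<Gamma>" for x
  proof -
    define A where "A = (SOME A. A \<in> \<rho> x)"
    have xP: "\<rho> x \<in> PSO" using \<rho>(2) x by blast
    then have "\<exists>A. A \<in> \<rho> x" using PSO_iff psl_class_self by blast
    then have "A \<in> \<rho> x" unfolding A_def by (rule someI_ex)
    then have "invertible A" using PSO_rep(1)[OF xP] special_isometry_invertible by blast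
    then obtain u w where uw: "near_rank1
      (K * exp (- (ln (singular_values ip A ! 0) - ln (singular_values ip A ! 1)))) A u w" using K(2) by blast
    have "(\<alpha> / k) * len x \<le> (\<alpha> / k) * (k * real (word_length \<Gamma> S x))"
      using k C(1) x by (intro mult_left_mono) auto
    also have "\<dots> = \<alpha> * real (word_length \<Gamma> S x)" using k(1) by simp
    also have "\<dots> \<le> C + (ln (singular_values ip A ! 0) - ln (singular_values ip A ! 1))"
      using C(2)[OF x] unfolding log_sv_def A_def[symmetric] by simp
    finally have "exp (- (ln (singular_values ip A ! 0) - ln (singular_values ip A ! 1))) \<le> exp C * exp (- (\<alpha> / k) * len x)"
      by (simp flip: exp_add)
    then have "K * exp (- (ln (singular_values ip A ! 0) - ln (singular_values ip A ! 1)))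
        \<le> K * exp C * exp (- (\<alpha> / k) * len x)"
      using K(1) by (simp add: mult.assoc)
    from near_rank1_mono[OF uw this] show ?thesis unfolding A_def by blast
  qed
  interpret anosov_hyperbolic \<Gamma> S' \<delta> \<rho> "K * exp C" "\<alpha> / k"
    using assms(3) \<rho> C(1) k(1) K(1) gap by unfold_locales auto
  obtain v where v: "pt = span {v}" "pq_form v v < 0" using assms(7) unfolding Omega_def H_pq_def by blast
  define b where "b = (1 / sqrt (- pq_form v v)) *\<^sub>R v"
  have pt: "pt = span {b}" unfolding v(1) b_def using v(2) by (intro span_scaleR_singleton[symmetric]) auto
  have b: "pq_form b b = -1"
  proof -
    have "sqrt (- pq_form v v) * sqrt (- pq_form v v) = - pq_form v v" using v(2) by simp
    then show ?thesis unfolding b_def using v(2) by (simp add: pq_form_simps divide_eq_eq)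
  qed
  have b0: "b \<noteq> 0" using b by (auto simp: pq_form_simps)
  have sub: "\<bb> \<subseteq> p_space \<tau> \<inter> q_space (span {b})" using assms(9) unfolding pt maximal_subalgebra_in_def by blast
  have "\<bar>pq_form b (rep x *v b)\<bar> \<le> cosh t"
    if x: "x \<in> carrier \<Gamma>" "\<rho> x \<in> C_space_group pt" "sqrt (q_abs (polar_proj pt \<bb>\<^sub>p (\<rho> x))) \<le> t" for x
  proof -
    have "\<bar>pq_form b (rep x *v b)\<bar> = cosh (sqrt (q_abs (polar_proj pt \<bb>\<^sub>p (\<rho> x))))"
      "q_abs (polar_proj pt \<bb>\<^sub>p (\<rho> x)) \<ge> 0"
      using polar_proj_cosh[OF card b assms(8)[unfolded pt] sub assms(10) x(2)[unfolded pt] rep_in[OF x(1)]]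
      unfolding pt by auto
    then show ?thesis using x(3) assms(11) by (simp add: cosh_real_nonneg_le_iff)
  qed
  then have "{\<gamma> \<in> carrier \<Gamma>. \<rho> \<gamma> \<in> C_space_group pt \<and> sqrt (q_abs (polar_proj pt \<bb>\<^sub>p (\<rho> \<gamma>))) \<le> t}
      \<subseteq> {x \<in> carrier \<Gamma>. \<bar>pq_form b (rep x *v b)\<bar> \<le> cosh t}" by blast
  then show ?thesis using finite_bounded_matrix_coefficient[OF card assms(7)[unfolded pt] b0] finite_subset by blast
qed

end
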